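(* Let $u\in H^1_0(\Omega)$ be Lipschitz continuous on $\overline\Omega$, nondegenerate, satisfy $-\Delta u=(u-1)_+^{p-1}$ in $\Omega\setminus\partial\{u>1\}$, and minimize $J|_{\mathcal{M}}$. Let $\delta_0:=\operatorname{dist}(\{u>1\},\partial\Omega)>0$. Then there is a constant $c>0$ such that whenever $x_0\in\partial\{u>1\}$ and $0<r\le\delta_0/2$, $$c\le\frac{\mathcal{L}(\{u>1\}\cap B_r(x_0))}{\mathcal{L}(B_r(x_0))}\le1-c,$$ where $\mathcal{L}$ denotes Lebesgue measure in $\mathbb{R}^N$. Thus, the topological boundary of $\{u>1\}$ coincides with its measure-theoretic boundary.
   Context: $N\ge2$, $\Omega\subset\mathbb{R}^N$ is a bounded domain with smooth boundary; $2<p<\infty$ if $N=2$, $2<p<2N/(N-2)$ if $N\ge3$; $w_+=\max\{w,0\}$. $J(v)=\int_\Omega[\frac12|\nabla v|^2+\chi_{\{v>1\}}-\frac1p(v-1)_+^p]\,dx$ for $v\in H^1_0(\Omega)$, and $$\mathcal{M}=\left\{v\in H^1_0(\Omega):\int_{\{v>1\}}|\nabla v|^2\,dx=\int_{\{v>1\}}(v-1)^p\,dx>0\right\}.$$ "$u$ minimizes $J|_{\mathcal{M}}$" means $u\in\mathcal{M}$ and $J(u)\le J(v)$ for all $v\in\mathcal{M}$. A continuous function $u$ on $\overline\Omega$ is nondegenerate if there exist constants $r_0,c>0$ such that if $x_0\in\{u>1\}$ and $r:=\operatorname{dist}(x_0,\{u\le1\})\le r_0$, then $u(x_0)\ge1+cr$.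 The measure-theoretic boundary of a measurable set $E\subset\mathbb{R}^N$ is the set of $x\in\mathbb{R}^N$ such that $\mathcal{L}(E\cap B_r(x))>0$ and $\mathcal{L}(E^c\cap B_r(x))>0$ for all $r>0$. *)

theory Defs
  imports "HOL-Analysis.Analysis"
begin

subsection \<open>Differentiable functions\<close>

text \<open>Intended for open \<open>S\<close>, so that the derivatives at points of \<open>S\<close> do not depend on the
  values outside \<open>S\<close>.\<close>

primrec C_on :: "nat \<Rightarrow> 'a::euclidean_space set \<Rightarrow> ('a \<Rightarrow> real) \<Rightarrow> bool" where
  "C_on 0 S f \<longleftrightarrow> continuous_on S f"
| "C_on (Suc k) S f \<longleftrightarrow> (\<forall>x\<in>S. f differentiable (at x)) \<and>
     (\<forall>i\<in>Basis. C_on k S (\<lambda>x. frechet_derivative f (at x) i))"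

definition smooth_on :: "'a::euclidean_space set \<Rightarrow> ('a \<Rightarrow> real) \<Rightarrow> bool" where
  "smooth_on S f \<longleftrightarrow> (\<forall>k. C_on k S f)"

definition grad :: "('a::euclidean_space \<Rightarrow> real) \<Rightarrow> 'a \<Rightarrow> 'a" where
  "grad f x = (\<Sum>i\<in>Basis. frechet_derivative f (at x) i *\<^sub>R i)"

definition laplacian :: "('a::euclidean_space \<Rightarrow> real) \<Rightarrow> 'a \<Rightarrow> real" where
  "laplacian f x =
     (\<Sum>i\<in>Basis. frechet_derivative (\<lambda>y. frechet_derivative f (at y) i) (at x) i)"

text \<open>The boundary is locally the graph of a smooth function over a hyperplane, with the set lying
  on one side of it. The unit vector \<open>e\<close> is the vertical direction; a function on the hyperplane
  orthogonal to \<open>e\<close> is encoded by a function \<open>\<gamma>\<close> on the whole space, which is only evaluated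
  at projections to that hyperplane.\<close>

definition smooth_boundary :: "'a::euclidean_space set \<Rightarrow> bool" where
  "smooth_boundary \<Omega> \<longleftrightarrow> (\<forall>x0\<in>frontier \<Omega>. \<exists>r>0. \<exists>e \<gamma>. norm e = 1 \<and> smooth_on UNIV \<gamma> \<and>
     \<Omega> \<inter> ball x0 r = {x \<in> ball x0 r. \<gamma> (x - (x \<bullet> e) *\<^sub>R e) < x \<bullet> e})"

definition smooth_bounded_domain :: "'a::euclidean_space set \<Rightarrow> bool" where
  "smooth_bounded_domain \<Omega> \<longleftrightarrow>
     open \<Omega> \<and> connected \<Omega> \<and> \<Omega> \<noteq> {} \<and> bounded \<Omega> \<and> smooth_boundary \<Omega>"


subsection \<open>Sobolev spaces\<close>

text \<open>Elements of the Sobolev spaces are represented by functions on the whole space, whose values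
  outside \<open>\<Omega>\<close> are irrelevant; functions that agree almost everywhere on \<open>\<Omega>\<close> represent the
  same element.\<close>

definition test_function :: "'a::euclidean_space set \<Rightarrow> ('a \<Rightarrow> real) \<Rightarrow> bool" where
  "test_function \<Omega> \<phi> \<longleftrightarrow> smooth_on UNIV \<phi> \<and>
     compact (closure {x. \<phi> x \<noteq> 0}) \<and> closure {x. \<phi> x \<noteq> 0} \<subseteq> \<Omega>"

definition locally_integrable ::
  "'a::euclidean_space set \<Rightarrow> ('a \<Rightarrow> 'b::euclidean_space) \<Rightarrow> bool" where
  "locally_integrable \<Omega> f \<longleftrightarrow> (\<forall>K. compact K \<and> K \<subseteq> \<Omega> \<longrightarrow> set_integrable lebesgue K f)"

definition has_weak_gradient ::
  "'a::euclidean_space set \<Rightarrow> ('a \<Rightarrow> real) \<Rightarrow> ('a \<Rightarrow> 'a) \<Rightarrow> bool" where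
  "has_weak_gradient \<Omega> v g \<longleftrightarrow> locally_integrable \<Omega> v \<and> locally_integrable \<Omega> g \<and>
     (\<forall>\<phi> i. test_function \<Omega> \<phi> \<and> i \<in> Basis \<longrightarrow>
        (LINT x:\<Omega>|lebesgue. v x * frechet_derivative \<phi> (at x) i) =
        - (LINT x:\<Omega>|lebesgue. (g x \<bullet> i) * \<phi> x))"

text \<open>Weak gradients are unique up to null sets, so the choice does not affect integrals.\<close>

definition weak_grad :: "'a::euclidean_space set \<Rightarrow> ('a \<Rightarrow> real) \<Rightarrow> 'a \<Rightarrow> 'a" where
  "weak_grad \<Omega> v = (SOME g. has_weak_gradient \<Omega> v g)"

definition L2 :: "'a::euclidean_space set \<Rightarrow> ('a \<Rightarrow> 'b::euclidean_space) set" where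
  "L2 \<Omega> = {f. f \<in> borel_measurable (lebesgue_on \<Omega>) \<and>
     integrable (lebesgue_on \<Omega>) (\<lambda>x. (norm (f x))\<^sup>2)}"

definition H1 :: "'a::euclidean_space set \<Rightarrow> ('a \<Rightarrow> real) set" where
  "H1 \<Omega> = {v \<in> L2 \<Omega>. \<exists>g \<in> L2 \<Omega>. has_weak_gradient \<Omega> v g}"

text \<open>The closure of the test functions in \<open>H1 \<Omega>\<close>.\<close>

definition H10 :: "'a::euclidean_space set \<Rightarrow> ('a \<Rightarrow> real) set" where
  "H10 \<Omega> = {v \<in> H1 \<Omega>. \<exists>\<phi> :: nat \<Rightarrow> 'a \<Rightarrow> real. (\<forall>n. test_function \<Omega> (\<phi> n)) \<and>
     (\<lambda>n. (LINT x:\<Omega>|lebesgue. (\<phi> n x - v x)\<^sup>2) +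
          (LINT x:\<Omega>|lebesgue. (norm (grad (\<phi> n) x - weak_grad \<Omega> v x))\<^sup>2)) \<longlonglongrightarrow> 0}"


subsection \<open>The variational problem\<close>

definition above1 :: "'a set \<Rightarrow> ('a \<Rightarrow> real) \<Rightarrow> 'a set" where
  "above1 \<Omega> v = {x \<in> \<Omega>. v x > 1}"

definition J_fun :: "'a::euclidean_space set \<Rightarrow> real \<Rightarrow> ('a \<Rightarrow> real) \<Rightarrow> real" where
  "J_fun \<Omega> p v = (LINT x:\<Omega>|lebesgue. (1/2) * (norm (weak_grad \<Omega> v x))\<^sup>2
      + indicat_real (above1 \<Omega> v) x - (1/p) * (max (v x - 1) 0) powr p)"

definition M_set :: "'a::euclidean_space set \<Rightarrow> real \<Rightarrow> ('a \<Rightarrow> real) set" where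
  "M_set \<Omega> p = {v \<in> H10 \<Omega>.
     (LINT x:above1 \<Omega> v|lebesgue. (norm (weak_grad \<Omega> v x))\<^sup>2) =
       (LINT x:above1 \<Omega> v|lebesgue. (v x - 1) powr p) \<and>
     (LINT x:above1 \<Omega> v|lebesgue. (v x - 1) powr p) > 0}"

definition minimizes_J_on_M :: "'a::euclidean_space set \<Rightarrow> real \<Rightarrow> ('a \<Rightarrow> real) \<Rightarrow> bool" where
  "minimizes_J_on_M \<Omega> p u \<longleftrightarrow> u \<in> M_set \<Omega> p \<and> (\<forall>v \<in> M_set \<Omega> p. J_fun \<Omega> p u \<le> J_fun \<Omega> p v)"

text \<open>Here \<open>u\<close> is a function on the closure of \<open>\<Omega>\<close>, so both sets in this definition are
  subsets of the closure.\<close>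

definition nondegenerate :: "'a::euclidean_space set \<Rightarrow> ('a \<Rightarrow> real) \<Rightarrow> bool" where
  "nondegenerate \<Omega> u \<longleftrightarrow> (\<exists>r0>0. \<exists>c>0. \<forall>x0 \<in> closure \<Omega>. u x0 > 1 \<longrightarrow>
     (let r = infdist x0 {x \<in> closure \<Omega>. u x \<le> 1} in r \<le> r0 \<longrightarrow> u x0 \<ge> 1 + c * r))"

text \<open>The equation is understood in the classical sense: \<open>u\<close> is twice continuously differentiable
  on the open set off the free boundary.\<close>

definition solves_off_free_boundary ::
  "'a::euclidean_space set \<Rightarrow> real \<Rightarrow> ('a \<Rightarrow> real) \<Rightarrow> bool" where
  "solves_off_free_boundary \<Omega> p u \<longleftrightarrow>
     C_on 2 (\<Omega> - frontier (above1 \<Omega> u)) u \<and>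
     (\<forall>x \<in> \<Omega> - frontier (above1 \<Omega> u). - laplacian u x = (max (u x - 1) 0) powr (p - 1))"

definition measure_boundary :: "'a::euclidean_space set \<Rightarrow> 'a set" where
  "measure_boundary E = {x. \<forall>r>0. measure lebesgue (E \<inter> ball x r) > 0 \<and>
     measure lebesgue (- E \<inter> ball x r) > 0}"

end

theory Submission
  imports Defs
begin

text \<open>Write \<open>w = u - 1\<close>, \<open>E = {u > 1}\<close> and \<open>N = DIM('a)\<close>. On \<open>E\<close> the function \<open>w\<close> is positive and
\<open>- \<Delta>w = w powr (p - 1)\<close>; since \<open>w\<close> is Lipschitz and vanishes on the free boundary, the right-hand side
is negligible at small scales, so that \<open>w\<close> is nearly harmonic there.

\<^bold>\<open>Positive density of \<open>E\<close>.\<close> Let \<open>x \<in> E\<close> have distance \<open>d\<close> from \<open>{u \<le> 1}\<close>. Nondegeneracy gives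
\<open>w x \<ge> c d\<close>, while \<open>w\<close> is zero at a point of the sphere of radius \<open>d\<close> about \<open>x\<close>. A nearly harmonic
function that is much smaller than its central value on a fixed fraction of the ball must exceed this
value by a fixed factor elsewhere (lemma \<open>improvement\<close>). Maximizing \<open>w - \<lambda> \<bar>\<cdot> - x1\<bar>\<close> near a free boundary
point \<open>x0\<close> turns this into a point within distance \<open>r / 2\<close> of \<open>x0\<close> at which \<open>w\<close> is at least a
multiple of \<open>r\<close>, hence, by the Lipschitz bound, into a ball of radius \<open>\<kappa> r\<close> on which
\<open>w \<ge> \<kappa> r\<close> (lemma \<open>frontier_growth\<close>).

\<^bold>\<open>Positive density of the complement.\<close> Let \<open>m\<close> be the measure of \<open>B_r(x0) - E\<close>. Raise \<open>u\<close> to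
\<open>u + t \<phi>\<close>, where \<open>\<phi> \<ge> 0\<close> lives in \<open>B_r(x0)\<close>, has size \<open>r\<close> and is subharmonic except very close to
\<open>x0\<close>, where \<open>w\<close> is very small. The growth of \<open>w\<close> makes the first variation \<open>\<integral> \<nabla>u \<bullet> \<nabla>\<phi>\<close> at most
\<open>- c r^N + C m\<close> (lemma \<open>first_variation_at_frontier\<close>). For a suitable constant \<open>t\<close> the Dirichlet
energy therefore drops by a multiple of \<open>r^N\<close>, up to a multiple of \<open>m\<close>, and \<open>{u > 1}\<close> grows by at
most \<open>m\<close>. The function \<open>u + t \<phi>\<close> violates the constraint by \<open>O(r^N)\<close>. Adding \<open>\<tau> \<psi>\<close> for a fixed bump
\<open>\<psi>\<close> supported in \<open>E\<close> restores it: as \<open>p > 2\<close>, the derivative of the constraint in the direction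
\<open>\<psi>\<close> is not zero, so \<open>\<tau> = O(r^N)\<close> suffices (lemma \<open>constraint_solvable\<close>). As \<open>u\<close> solves the equation
on the support of \<open>\<psi>\<close>, this correction changes \<open>J\<close> by at most \<open>O(\<tau>\<^sup>2) = O(r^(2 N))\<close>
(lemma \<open>competitor_inequality\<close>). Minimality then forces \<open>m \<ge> c r^N\<close> for small \<open>r\<close>
(lemma \<open>zero_set_density\<close>).

Both halves test the equation with the same family of functions (lemma \<open>concentrated_test_functions\<close>),
obtained from \<open>\<bar>x\<bar> powr - (N - 3/2)\<close> by smoothing at the origin and truncating. The exponent lies
strictly between \<open>N - 2\<close>, above which powers are subharmonic away from the origin, and \<open>N - 1\<close>, below
which the negative part of the Laplacian, integrated against a function of size \<open>\<bar>x\<bar>\<close>, becomes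
negligible as the smoothing scale tends to zero.

All competitors differ from \<open>u\<close> by test functions, so the only Sobolev theory involved is the
uniqueness of weak gradients, their bound by the Lipschitz constant, and the fact that a Lipschitz
function in \<open>H10\<close> vanishes on the boundary (lemma \<open>H10_lipschitz_zero_on_boundary\<close>); the latter keeps
\<open>E\<close> away from the boundary and gives \<open>\<delta>0 > 0\<close>.\<close>

section \<open>Calculus of \<open>C_on\<close>\<close>

abbreviation pd :: "'a::euclidean_space \<Rightarrow> ('a \<Rightarrow> real) \<Rightarrow> 'a \<Rightarrow> real" where
  "pd i f x \<equiv> frechet_derivative f (at x) i"

lemma pd_eqI: "(f has_derivative f') (at x) \<Longrightarrow> pd i f x = f' i"
  using frechet_derivative_at by metis

lemma pd_cong_open:
  assumes "open S" "x \<in> S" "\<And>y. y \<in> S \<Longrightarrow> f y = g y"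
  shows "pd i f x = pd i g x"
proof -
  have "(f has_derivative D) (at x) = (g has_derivative D) (at x)" for D
    using has_derivative_transform_within_open[OF _ assms(1,2)] assms(3) by metis
  then show ?thesis unfolding frechet_derivative_def by simp
qed

lemma differentiable_cong_open:
  assumes "open S" "x \<in> S" "\<And>y. y \<in> S \<Longrightarrow> f y = g y"
  shows "f differentiable (at x) \<longleftrightarrow> g differentiable (at x)"
  unfolding differentiable_def
  using has_derivative_transform_within_open[OF _ assms(1,2)] assms(3) by metis

lemma C_on_cong_open:
  assumes "open S"
  shows "(\<And>x. x \<in> S \<Longrightarrow> f x = g x) \<Longrightarrow> C_on k S f \<longleftrightarrow> C_on k S g"
proof (induction k arbitrary: f g)
  case 0
  then show ?case by (simp cong: continuous_on_cong)
next
  case (Suc k)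
  have "C_on k S (pd i f) \<longleftrightarrow> C_on k S (pd i g)" for i
    by (rule Suc.IH) (rule pd_cong_open[OF assms _ Suc.prems])
  moreover have "f differentiable (at x) \<longleftrightarrow> g differentiable (at x)" if "x \<in> S" for x
    by (rule differentiable_cong_open[OF assms that Suc.prems])
  ultimately show ?case by simp
qed

lemma C_on_subset: "C_on k S f \<Longrightarrow> T \<subseteq> S \<Longrightarrow> C_on k T f"
  by (induction k arbitrary: f) (auto intro: continuous_on_subset)

lemma C_on_Suc_imp_continuous_on: "C_on (Suc k) S f \<Longrightarrow> continuous_on S f"
  by (auto intro!: continuous_at_imp_continuous_on differentiable_imp_continuous_within)

lemma C_on_imp_continuous_on: "C_on k S f \<Longrightarrow> continuous_on S f"
  by (cases k) (auto intro: C_on_Suc_imp_continuous_on simp del: C_on.simps(2))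

lemma C_on_SucD: "C_on (Suc k) S f \<Longrightarrow> C_on k S f"
proof (induction k arbitrary: f)
  case 0
  then show ?case using C_on_Suc_imp_continuous_on[of 0] by (simp del: C_on.simps(2))
next
  case (Suc k)
  from Suc.prems have 1: "\<forall>x\<in>S. f differentiable (at x)" and
    2: "\<And>i. i \<in> Basis \<Longrightarrow> C_on (Suc k) S (pd i f)"
    unfolding C_on.simps(2)[of "Suc k"] by auto
  show ?case unfolding C_on.simps(2)[of k] using 1 Suc.IH[OF 2] by blast
qed

lemma C_on_SucI:
  assumes "open S" "\<And>x. x \<in> S \<Longrightarrow> (f has_derivative f' x) (at x)"
    "\<And>i. i \<in> Basis \<Longrightarrow> C_on k S (\<lambda>x. f' x i)"
  shows "C_on (Suc k) S f"
proof -
  have "C_on k S (pd i f)" if "i \<in> Basis" for i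
    by (rule C_on_cong_open[OF assms(1), THEN iffD1, OF _ assms(3)[OF that]])
      (simp add: pd_eqI[OF assms(2)])
  then show ?thesis using assms(2) by (auto simp: differentiable_def)
qed

lemma C_on_Suc_derivative:
  "C_on (Suc k) S f \<Longrightarrow> x \<in> S \<Longrightarrow> (f has_derivative frechet_derivative f (at x)) (at x)"
  by (simp add: frechet_derivative_works)

lemma C_on_const: "open S \<Longrightarrow> C_on k S (\<lambda>x. c)"
proof (induction k arbitrary: c)
  case (Suc k)
  show ?case
    by (rule C_on_SucI[where f'="\<lambda>_ _. 0"]) (use Suc in \<open>simp_all del: C_on.simps\<close>)
qed simp

lemma C_on_inner: "open S \<Longrightarrow> C_on k S (\<lambda>x. x \<bullet> a)"
proof (cases k)
  case (Suc n)
  assume S: "open S"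
  have "((\<lambda>x. x \<bullet> a) has_derivative (\<lambda>x. x \<bullet> a)) (at x)" for x
    by (auto intro!: derivative_eq_intros)
  then show ?thesis unfolding Suc by (rule C_on_SucI[OF S]) (rule C_on_const[OF S])
qed (auto intro!: continuous_intros)

lemma C_on_add:
  "open S \<Longrightarrow> C_on k S f \<Longrightarrow> C_on k S g \<Longrightarrow> C_on k S (\<lambda>x. f x + g x)"
proof (induction k arbitrary: f g)
  case (Suc k)
  show ?case
  proof (rule C_on_SucI[OF Suc.prems(1)])
    show "((\<lambda>x. f x + g x) has_derivative
        (\<lambda>i. frechet_derivative f (at x) i + frechet_derivative g (at x) i)) (at x)" if "x \<in> S" for x
      by (intro has_derivative_add C_on_Suc_derivative[OF Suc.prems(2) that] C_on_Suc_derivative[OF Suc.prems(3) that])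
    show "C_on k S (\<lambda>x. pd i f x + pd i g x)" if "i \<in> Basis" for i
      by (rule Suc.IH[OF Suc.prems(1)]) (use Suc.prems that in auto)
  qed
qed (auto intro: continuous_intros)

lemma C_on_mult:
  "open S \<Longrightarrow> C_on k S f \<Longrightarrow> C_on k S g \<Longrightarrow> C_on k S (\<lambda>x. f x * g x)"
proof (induction k arbitrary: f g)
  case (Suc k)
  show ?case
  proof (rule C_on_SucI[OF Suc.prems(1)])
    show "((\<lambda>x. f x * g x) has_derivative
        (\<lambda>i. f x * frechet_derivative g (at x) i + frechet_derivative f (at x) i * g x)) (at x)"
      if "x \<in> S" for x
      by (intro has_derivative_mult C_on_Suc_derivative[OF Suc.prems(2) that] C_on_Suc_derivative[OF Suc.prems(3) that])
    show "C_on k S (\<lambda>x. f x * pd i g x + pd i f x * g x)" if "i \<in> Basis" for i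
      by (intro C_on_add Suc.IH Suc.prems(1) C_on_SucD[OF Suc.prems(2)] C_on_SucD[OF Suc.prems(3)])
        (use Suc.prems that in auto)
  qed
qed (auto intro: continuous_intros)

lemma C_on_prod:
  "finite I \<Longrightarrow> open S \<Longrightarrow> (\<And>i. i \<in> I \<Longrightarrow> C_on k S (f i)) \<Longrightarrow> C_on k S (\<lambda>x. \<Prod>i\<in>I. f i x)"
  by (induction I rule: finite_induct) (auto intro: C_on_const C_on_mult)

lemma C_on_sum:
  "finite I \<Longrightarrow> open S \<Longrightarrow> (\<And>i. i \<in> I \<Longrightarrow> C_on k S (f i)) \<Longrightarrow> C_on k S (\<lambda>x. \<Sum>i\<in>I. f i x)"
  by (induction I rule: finite_induct) (auto intro: C_on_const C_on_add)

lemma C_on_minus: "open S \<Longrightarrow> C_on k S f \<Longrightarrow> C_on k S (\<lambda>x. - f x)"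
  using C_on_mult[OF _ C_on_const[where c="-1"], of S k f] by simp

lemma C_on_diff:
  "open S \<Longrightarrow> C_on k S f \<Longrightarrow> C_on k S g \<Longrightarrow> C_on k S (\<lambda>x. f x - g x)"
  using C_on_add[OF _ _ C_on_minus, of S k f g] by simp

lemma C_on_compose:
  fixes F :: "real \<Rightarrow> real"
  assumes "open S" "open T"
  shows "C_on k T F \<Longrightarrow> C_on k S f \<Longrightarrow> (\<And>x. x \<in> S \<Longrightarrow> f x \<in> T) \<Longrightarrow> C_on k S (\<lambda>x. F (f x))"
proof (induction k arbitrary: f F)
  case 0
  have "f ` S \<subseteq> T" using 0 by auto
  with 0 show ?case by (auto intro: continuous_on_compose2)
next
  case (Suc k)
  show ?case
  proof (rule C_on_SucI[OF assms(1)])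
    fix x assume x: "x \<in> S"
    have F: "(F has_derivative (\<lambda>t. t * pd 1 F (f x))) (at (f x))"
    proof -
      have d: "(F has_derivative frechet_derivative F (at (f x))) (at (f x))"
        using C_on_Suc_derivative[OF Suc.prems(1)] Suc.prems(3) x by blast
      have "frechet_derivative F (at (f x)) = (\<lambda>t. t * pd 1 F (f x))"
      proof
        fix t
        show "frechet_derivative F (at (f x)) t = t * pd 1 F (f x)"
          by (rule linear_scale[OF has_derivative_linear[OF d], of t 1, unfolded real_scaleR_def mult_1_right])
      qed
      with d show ?thesis by (rule has_derivative_eq_rhs)
    qed
    show "((\<lambda>x. F (f x)) has_derivative (\<lambda>i. frechet_derivative f (at x) i * pd 1 F (f x))) (at x)"
      by (rule has_derivative_compose[OF C_on_Suc_derivative[OF Suc.prems(2) x] F])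
  next
    fix i :: 'a assume i: "i \<in> Basis"
    show "C_on k S (\<lambda>x. pd i f x * pd 1 F (f x))"
    proof (rule C_on_mult[OF assms(1)])
      show "C_on k S (pd i f)" using Suc.prems(2) i by simp
      have "C_on k T (pd 1 F)" using Suc.prems(1) by simp
      then show "C_on k S (\<lambda>x. pd 1 F (f x))"
        by (rule Suc.IH[OF _ C_on_SucD[OF Suc.prems(2)] Suc.prems(3)])
    qed
  qed
qed

lemma C_on_SucI_real:
  fixes F :: "real \<Rightarrow> real"
  assumes "open T" "\<And>x. x \<in> T \<Longrightarrow> (F has_real_derivative F' x) (at x)" "C_on k T F'"
  shows "C_on (Suc k) T F"
  by (rule C_on_SucI[OF assms(1), of _ "\<lambda>x t. F' x * t"])
    (use assms in \<open>auto simp: has_field_derivative_def\<close>)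

lemma C_on_dist_power2: "open S \<Longrightarrow> C_on k S (\<lambda>x. (norm (x - a))\<^sup>2)"
proof -
  assume S: "open S"
  have eq: "(norm (x - a))\<^sup>2 = (\<Sum>i\<in>Basis. (x \<bullet> i - a \<bullet> i) * (x \<bullet> i - a \<bullet> i))" for x
    unfolding power2_norm_eq_inner by (subst euclidean_inner) (simp add: inner_diff_left)
  show ?thesis unfolding eq
    by (intro C_on_sum C_on_mult C_on_diff C_on_inner C_on_const S finite_Basis)
qed

lemma C_on_powr: "C_on k {0<..} (\<lambda>x::real. x powr b)"
proof (induction k arbitrary: b)
  case 0
  then show ?case by (auto intro!: continuous_intros)
next
  case (Suc k)
  show ?case
  proof (rule C_on_SucI_real[where F'="\<lambda>x. b * x powr (b - 1)"])
    show "C_on k {0<..} (\<lambda>x. b * x powr (b - 1))"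
      by (intro C_on_mult C_on_const Suc.IH open_greaterThan)
  qed (auto intro: has_real_derivative_powr)
qed

lemma smooth_onD: "smooth_on S f \<Longrightarrow> C_on k S f" by (simp add: smooth_on_def)

lemma smooth_on_derivative:
  "smooth_on S f \<Longrightarrow> x \<in> S \<Longrightarrow> (f has_derivative frechet_derivative f (at x)) (at x)"
  using C_on_Suc_derivative[OF smooth_onD] .

lemma smooth_on_continuous: "smooth_on S f \<Longrightarrow> continuous_on S f"
  using C_on_imp_continuous_on[OF smooth_onD] .

lemma C_on_affine: "C_on k UNIV f \<Longrightarrow> C_on k UNIV (\<lambda>x. f (c *\<^sub>R x + a))"
proof (induction k arbitrary: f)
  case 0
  then show ?case
    using continuous_on_compose2[of UNIV f UNIV "\<lambda>x. c *\<^sub>R x + a"] by (simp add: continuous_intros)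
next
  case (Suc k)
  show ?case
  proof (rule C_on_SucI[OF open_UNIV])
    fix x
    have "((\<lambda>x. c *\<^sub>R x + a) has_derivative (\<lambda>x. c *\<^sub>R x)) (at x)" by (auto intro!: derivative_eq_intros)
    from has_derivative_compose[OF this C_on_Suc_derivative[OF Suc.prems UNIV_I]]
    show "((\<lambda>x. f (c *\<^sub>R x + a)) has_derivative
        (\<lambda>e. frechet_derivative f (at (c *\<^sub>R x + a)) (c *\<^sub>R e))) (at x)" .
    fix j :: 'a assume j: "j \<in> Basis"
    have "pd (c *\<^sub>R j) f y = c * pd j f y" for y
      using linear_scale[OF has_derivative_linear[OF C_on_Suc_derivative[OF Suc.prems UNIV_I]], of y c j]
      by (simp only: real_scaleR_def)
    moreover have "C_on k UNIV (pd j f)" using Suc.prems j by simp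
    ultimately show "C_on k UNIV (\<lambda>x. pd (c *\<^sub>R j) f (c *\<^sub>R x + a))"
      by (simp only:) (intro C_on_mult C_on_const open_UNIV Suc.IH)
  qed
qed

lemma pd_affine:
  assumes "C_on 1 UNIV f"
  shows "pd e (\<lambda>x. f (c *\<^sub>R x + a)) x = c * pd e f (c *\<^sub>R x + a)"
proof -
  have C: "C_on (Suc 0) UNIV f" using assms by simp
  have "((\<lambda>x. c *\<^sub>R x + a) has_derivative (\<lambda>x. c *\<^sub>R x)) (at x)" by (auto intro!: derivative_eq_intros)
  from has_derivative_compose[OF this C_on_Suc_derivative[OF C UNIV_I]]
  have "pd e (\<lambda>x. f (c *\<^sub>R x + a)) x = pd (c *\<^sub>R e) f (c *\<^sub>R x + a)" by (rule pd_eqI)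
  also have "\<dots> = c * pd e f (c *\<^sub>R x + a)"
    using linear_scale[OF has_derivative_linear[OF C_on_Suc_derivative[OF C UNIV_I]]]
    by (simp only: real_scaleR_def)
  finally show ?thesis .
qed

lemma C_on_Un:
  assumes "open S" "open T"
  shows "C_on k S f \<Longrightarrow> C_on k T f \<Longrightarrow> C_on k (S \<union> T) f"
proof (induction k arbitrary: f)
  case 0
  then show ?case using continuous_on_open_Un[OF assms] by simp
next
  case (Suc k)
  have "C_on k (S \<union> T) (pd i f)" if "i \<in> Basis" for i
    by (rule Suc.IH) (use Suc.prems that in simp_all)
  moreover have "\<forall>x\<in>S \<union> T. f differentiable (at x)" using Suc.prems by auto
  ultimately show ?case by simp
qed

lemma C_on_extend_by_zero:
  fixes f :: "'a::euclidean_space \<Rightarrow> real"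
  assumes "open U" "C_on k U f" "closed K" "K \<subseteq> U" "\<And>x. x \<notin> K \<Longrightarrow> f x = 0"
  shows "C_on k UNIV f"
proof -
  have "C_on k (- K) f \<longleftrightarrow> C_on k (- K) (\<lambda>_. 0)"
    by (rule C_on_cong_open) (use assms(3,5) in auto)
  moreover have "C_on k (- K) (\<lambda>_::'a. 0)" using assms(3) by (intro C_on_const open_Compl)
  ultimately have "C_on k (- K) f" by blast
  then have "C_on k (U \<union> - K) f" using assms(1-3) by (intro C_on_Un) auto
  moreover have "U \<union> - K = UNIV" using assms(4) by blast
  ultimately show ?thesis by simp
qed

section \<open>A smooth cutoff of one variable\<close>

text \<open>The functions \<open>exp (- 1 / s) / s ^ j\<close>, extended by zero, are considered for all \<open>j\<close> together because the
derivative of each is a linear combination of two others; their smoothness is then a single induction.\<close>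

definition flat_exp :: "nat \<Rightarrow> real \<Rightarrow> real" where
  "flat_exp j s = (if s > 0 then exp (- 1 / s) / s ^ j else 0)"

lemma flat_exp_derivative:
  "(flat_exp j has_real_derivative (flat_exp (j + 2) s - real j * flat_exp (j + 1) s)) (at s)"
proof -
  have eq: "flat_exp k t = exp (- inverse t) * inverse t ^ k" if "t > 0" for k t
    using that by (simp add: flat_exp_def field_simps)
  consider "s < 0" | "s = 0" | "s > 0" by linarith
  then show ?thesis
  proof cases
    case 1
    have "((\<lambda>_. 0) has_real_derivative 0) (at s)" by simp
    then have "(flat_exp j has_real_derivative 0) (at s)"
      by (rule has_field_derivative_transform_within_open[where S="{..<0}"])
        (use 1 in \<open>auto simp: flat_exp_def\<close>)
    then show ?thesis using 1 by (simp add: flat_exp_def)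
  next
    case 2
    have R: "((\<lambda>x. flat_exp j x / x) \<longlongrightarrow> 0) (at_right 0)"
    proof -
      have "((\<lambda>x::real. exp (- 1 / x) / x ^ Suc j) \<longlongrightarrow> 0) (at_right 0)"
      proof -
        have "((\<lambda>x::real. inverse x ^ Suc j / exp (inverse x)) \<longlongrightarrow> 0) (at_right 0)"
          by (rule filterlim_compose[OF tendsto_power_div_exp_0 filterlim_inverse_at_top_right])
        moreover have "inverse x ^ Suc j / exp (inverse x) = exp (- 1 / x) / x ^ Suc j" for x :: real
          by (simp add: exp_minus field_simps del: power_Suc)
        ultimately show ?thesis by simp
      qed
      moreover have "\<forall>\<^sub>F x in at_right 0. exp (- 1 / x) / x ^ Suc j = flat_exp j x / x"
        by (auto simp: eventually_at_filter flat_exp_def)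
      ultimately show ?thesis by (rule Lim_transform_eventually)
    qed
    have L: "((\<lambda>x. flat_exp j x / x) \<longlongrightarrow> 0) (at_left 0)"
      by (rule tendsto_eventually) (auto simp: eventually_at_filter flat_exp_def)
    have "((\<lambda>x. flat_exp j x / x) \<longlongrightarrow> 0) (at 0)"
      using L R filterlim_at_split by blast
    moreover have "flat_exp k 0 = 0" for k by (simp add: flat_exp_def)
    ultimately show ?thesis unfolding 2 has_field_derivative_iff by simp
  next
    case 3
    have "((\<lambda>x. exp (- inverse x) * inverse x ^ j) has_real_derivative
       (exp (- inverse s) * (inverse s)\<^sup>2) * inverse s ^ j +
       (real j * inverse s ^ (j - 1) * - ((inverse s)\<^sup>2)) * exp (- inverse s)) (at s)"
      using 3 by (auto intro!: derivative_eq_intros simp: power2_eq_square)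
    also have "(exp (- inverse s) * (inverse s)\<^sup>2) * inverse s ^ j +
       (real j * inverse s ^ (j - 1) * - ((inverse s)\<^sup>2)) * exp (- inverse s) =
       flat_exp (j + 2) s - real j * flat_exp (j + 1) s"
    proof -
      have "real j * inverse s ^ (j - 1) * (inverse s)\<^sup>2 = real j * inverse s ^ (j+1)"
        by (cases j) (simp_all add: power2_eq_square)
      then have "real j * inverse s ^ (j - 1) * - ((inverse s)\<^sup>2) = - (real j * inverse s ^ (j+1))"
        by simp
      then show ?thesis unfolding eq[OF 3] by (simp only: power_add) (simp add: algebra_simps)
    qed
    finally have "((\<lambda>x. exp (- inverse x) * inverse x ^ j) has_real_derivative
       (flat_exp (j + 2) s - real j * flat_exp (j + 1) s)) (at s)" .
    then show ?thesis
      by (rule has_field_derivative_transform_within_open[where S="{0<..}"])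
        (use 3 in \<open>auto simp: eq\<close>)
  qed
qed

lemma C_on_flat_exp: "C_on k UNIV (flat_exp j)"
proof (induction k arbitrary: j)
  case 0
  then show ?case using DERIV_isCont[OF flat_exp_derivative] by (simp add: continuous_at_imp_continuous_on)
next
  case (Suc k)
  show ?case
    by (rule C_on_SucI_real[OF open_UNIV flat_exp_derivative])
      (intro C_on_diff C_on_mult C_on_const Suc.IH open_UNIV)
qed

text \<open>A smooth convex cutoff that vanishes for \<open>s \<le> 0\<close> and whose slope never exceeds 1. Convexity preserves
subharmonicity under composition, and the bounded slope keeps a large argument from being amplified.\<close>

definition ramp :: "real \<Rightarrow> real" where "ramp s = s * flat_exp 0 s"

lemma ramp_derivative: "(ramp has_real_derivative (flat_exp 0 s + flat_exp 1 s)) (at s)"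
proof -
  have "flat_exp 2 s * s = flat_exp 1 s" by (simp add: flat_exp_def power2_eq_square)
  then show ?thesis unfolding ramp_def[abs_def]
    by (auto intro!: derivative_eq_intros flat_exp_derivative[THEN DERIV_cong] simp: numeral_2_eq_2)
qed

lemma ramp_derivative2:
  "((\<lambda>s. flat_exp 0 s + flat_exp 1 s) has_real_derivative flat_exp 3 s) (at s)"
  by (auto intro!: derivative_eq_intros flat_exp_derivative[THEN DERIV_cong] simp: numeral_3_eq_3 numeral_2_eq_2)

lemma C_on_ramp: "C_on k UNIV ramp"
  unfolding ramp_def[abs_def] using C_on_mult[OF open_UNIV C_on_inner[of UNIV k 1] C_on_flat_exp[of k 0]] by simp

lemma flat_exp_nonneg: "flat_exp j s \<ge> 0" by (simp add: flat_exp_def)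

lemma ramp_derivative_bounds: "0 \<le> flat_exp 0 s + flat_exp 1 s" "flat_exp 0 s + flat_exp 1 s \<le> 1"
proof -
  show "0 \<le> flat_exp 0 s + flat_exp 1 s" by (simp add: flat_exp_nonneg)
  show "flat_exp 0 s + flat_exp 1 s \<le> 1"
  proof (cases "s > 0")
    case True
    define y where "y = 1 / s"
    have "exp (- y) * (1 + y) \<le> exp (- y) * exp y"
      by (rule mult_left_mono[OF exp_ge_add_one_self]) simp
    also have "\<dots> = 1" using exp_minus_inverse[of y] by (simp add: mult.commute)
    finally have "exp (- y) + exp (- y) * y \<le> 1" by (simp only: distrib_left mult_1_right)
    moreover have "flat_exp 0 s = exp (- y)" "flat_exp 1 s = exp (- y) * y"
      using True by (simp_all add: flat_exp_def y_def)
    ultimately show ?thesis by simp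
  qed (simp add: flat_exp_def)
qed

section \<open>Integrals of boundedly supported functions\<close>

lemma pd_zero_off_closed:
  assumes "closed K" "\<And>x. x \<notin> K \<Longrightarrow> f x = 0" "x \<notin> K"
  shows "pd e f x = 0"
proof -
  have "pd e f x = pd e (\<lambda>_. 0) x"
    by (rule pd_cong_open[of "- K"]) (use assms in auto)
  then show ?thesis by simp
qed

lemma bounded_range_if_compact_support:
  fixes f :: "'a::euclidean_space \<Rightarrow> real"
  assumes "continuous_on UNIV f" "compact K" "\<And>x. x \<notin> K \<Longrightarrow> f x = 0"
  obtains B where "B > 0" "\<And>x. \<bar>f x\<bar> \<le> B"
proof -
  have "compact (f ` K)" using assms continuous_on_subset compact_continuous_image by blast
  then obtain B where B: "B > 0" "\<forall>y\<in>f ` K. norm y \<le> B"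
    using bounded_pos compact_imp_bounded by metis
  show thesis by (rule that[OF B(1)]) (use B assms(3) in \<open>force simp: less_imp_le\<close>)
qed

lemma integrable_bounded_support:
  fixes f :: "'a::euclidean_space \<Rightarrow> real"
  assumes "f \<in> borel_measurable lebesgue" "bounded S" "\<And>x. x \<notin> S \<Longrightarrow> f x = 0" "\<And>x. \<bar>f x\<bar> \<le> B"
  shows "integrable lebesgue f"
proof -
  obtain a where a: "S \<subseteq> cbox (-a) a" using bounded_subset_cbox_symmetric[OF assms(2)] by blast
  show ?thesis
  proof (rule integrableI_bounded_set[where A="cbox (-a) a" and B=B])
    show "emeasure lebesgue (cbox (-a) a) < \<infinity>" by (simp add: emeasure_lborel_cbox_eq)
  qed (use assms a in auto)
qed

lemma borel_imp_lebesgue_measurable: "f \<in> borel_measurable borel \<Longrightarrow> f \<in> borel_measurable lebesgue"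
  by (simp add: measurable_completion)

lemma lebesgue_integral_shift:
  fixes f :: "'a::euclidean_space \<Rightarrow> real"
  assumes "f \<in> borel_measurable borel"
  shows "(LINT x|lebesgue. f (x + c)) = (LINT x|lebesgue. f x)"
proof -
  have "(LINT x|lebesgue. f (x + c)) = (LINT x|lborel. f (c + x))"
    using assms by (subst integral_completion) (auto simp: add.commute)
  also have "\<dots> = (LINT x|distr lborel borel ((+) c). f x)"
    by (rule integral_distr[symmetric]) (use assms in auto)
  also have "\<dots> = (LINT x|lebesgue. f x)"
    using assms by (simp add: lborel_distr_plus integral_completion)
  finally show ?thesis .
qed

lemma C_on_pd_vector_continuous:
  assumes "C_on 1 UNIV f"
  shows "continuous_on UNIV (pd e f)"
proof -
  have "pd e f x = (\<Sum>i\<in>Basis. (e \<bullet> i) * pd i f x)" for x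
  proof -
    have l: "linear (frechet_derivative f (at x))"
      using C_on_Suc_derivative[of 0 UNIV f x] assms has_derivative_linear by simp
    have "pd e f x = pd (\<Sum>i\<in>Basis. (e \<bullet> i) *\<^sub>R i) f x" by (simp only: euclidean_representation)
    then show ?thesis by (simp only: linear_sum[OF l] linear_scale[OF l] real_scaleR_def)
  qed
  then show ?thesis using assms by (simp add: continuous_on_sum continuous_on_mult)
qed

lemma lipschitz_along_direction:
  fixes f :: "'a::euclidean_space \<Rightarrow> real"
  assumes "C_on 1 UNIV f" "\<And>x. \<bar>pd e f x\<bar> \<le> C"
  shows "\<bar>f (x + h *\<^sub>R e) - f x\<bar> \<le> C * \<bar>h\<bar>"
    and "((\<lambda>s. f (x + s *\<^sub>R e)) has_real_derivative pd e f (x + t *\<^sub>R e)) (at t)"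
proof -
  have D: "((\<lambda>s. f (x + s *\<^sub>R e)) has_real_derivative pd e f (x + t *\<^sub>R e)) (at t)" for t
  proof -
    have F: "(f has_derivative frechet_derivative f (at (x + t *\<^sub>R e))) (at (x + t *\<^sub>R e))"
      using C_on_Suc_derivative[of 0 UNIV f] assms(1) by simp
    have G: "((\<lambda>s. x + s *\<^sub>R e) has_derivative (\<lambda>s. s *\<^sub>R e)) (at t)"
      by (auto intro!: derivative_eq_intros)
    have "((\<lambda>s. f (x + s *\<^sub>R e)) has_derivative (\<lambda>s. pd (s *\<^sub>R e) f (x + t *\<^sub>R e))) (at t)"
      by (rule has_derivative_compose[OF G F])
    moreover have "(\<lambda>s. pd (s *\<^sub>R e) f (x + t *\<^sub>R e)) = (*) (pd e f (x + t *\<^sub>R e))"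
      by (rule ext) (simp only: linear_scale[OF has_derivative_linear[OF F]] real_scaleR_def mult.commute)
    ultimately show ?thesis by (simp only: has_field_derivative_def)
  qed
  then show "((\<lambda>s. f (x + s *\<^sub>R e)) has_real_derivative pd e f (x + t *\<^sub>R e)) (at t)" .
  have "norm (f (x + h *\<^sub>R e) - f (x + 0 *\<^sub>R e)) \<le> C * norm (h - 0)"
    by (rule field_differentiable_bound[where f="\<lambda>s. f (x + s *\<^sub>R e)" and S=UNIV])
      (use assms(2) D in \<open>auto intro: has_field_derivative_at_within\<close>)
  then show "\<bar>f (x + h *\<^sub>R e) - f x\<bar> \<le> C * \<bar>h\<bar>" by simp
qed

text \<open>The derivative is recovered under the integral by dominated convergence: the quotients are bounded by
the supremum of the derivative and live in one fixed ball.\<close>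

lemma difference_quotient_limit:
  fixes f v :: "'a::euclidean_space \<Rightarrow> real"
  assumes f: "C_on 1 UNIV f" and K: "compact K" "\<And>x. x \<notin> K \<Longrightarrow> f x = 0"
    and v: "v \<in> borel_measurable lebesgue" "\<And>x. \<bar>v x\<bar> \<le> B"
    and h: "h \<longlonglongrightarrow> 0" "\<And>n. h n \<noteq> 0"
  shows "(\<lambda>n. LINT x|lebesgue. v x * ((f (x + h n *\<^sub>R e) - f x) / h n))
     \<longlonglongrightarrow> (LINT x|lebesgue. v x * pd e f x)"
proof -
  have "x \<notin> K \<Longrightarrow> pd e f x = 0" for x
    by (rule pd_zero_off_closed[OF compact_imp_closed[OF K(1)], where f=f]) (use K(2) in auto)
  then obtain C where C: "C > 0" "\<And>x. \<bar>pd e f x\<bar> \<le> C"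
    using bounded_range_if_compact_support[OF C_on_pd_vector_continuous[OF f] K(1), of e] by metis
  have cf: "continuous_on UNIV f" using f C_on_imp_continuous_on by blast
  have mf: "f \<in> borel_measurable borel" using cf borel_measurable_continuous_onI by blast
  have mp: "pd e f \<in> borel_measurable borel"
    using C_on_pd_vector_continuous[OF f] borel_measurable_continuous_onI by blast
  obtain H where H: "H > 0" "\<And>n. \<bar>h n\<bar> \<le> H"
    using convergent_imp_Bseq[OF convergentI[OF h(1)]] unfolding Bseq_def real_norm_def by blast
  obtain R where R: "K \<subseteq> cball 0 R" 
    using bounded_subset_ballD[OF compact_imp_bounded[OF K(1)], of 0] ball_subset_cball by blast
  define w where "w x = (B * C) * indicat_real (cball 0 (R + H * norm e)) x" for x :: 'a
  have B0: "B \<ge> 0" using v(2)[of undefined] by linarith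
  show ?thesis
  proof (rule integral_dominated_convergence[where w=w])
    show "integrable lebesgue w"
    proof (rule integrable_bounded_support[where S="cball 0 (R + H * norm e)" and B="B * C"])
      show "w \<in> borel_measurable lebesgue"
        unfolding w_def[abs_def]
        by (intro borel_measurable_times borel_measurable_const borel_measurable_indicator) simp
    qed (use B0 C(1) in \<open>auto simp: w_def indicator_def\<close>)
    show "(\<lambda>x. v x * pd e f x) \<in> borel_measurable lebesgue"
      using v(1) borel_imp_lebesgue_measurable[OF mp] by measurable
    have m: "(\<lambda>x. (f (x + h n *\<^sub>R e) - f x) / h n) \<in> borel_measurable borel" for n
      using mf by measurable
    show "(\<lambda>x. v x * ((f (x + h n *\<^sub>R e) - f x) / h n)) \<in> borel_measurable lebesgue" for n
      using v(1) borel_imp_lebesgue_measurable[OF m] by measurable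
    show "AE x in lebesgue. (\<lambda>n. v x * ((f (x + h n *\<^sub>R e) - f x) / h n)) \<longlonglongrightarrow> v x * pd e f x"
    proof (intro AE_I2 tendsto_mult tendsto_const)
      fix x :: 'a
      have "((\<lambda>y. (f (x + y *\<^sub>R e) - f (x + 0 *\<^sub>R e)) / (y - 0)) \<longlongrightarrow> pd e f (x + 0 *\<^sub>R e)) (at 0)"
        using lipschitz_along_direction(2)[OF f C(2), of x 0] unfolding has_field_derivative_iff .
      then have "((\<lambda>y. (f (x + y *\<^sub>R e) - f x) / y) \<longlongrightarrow> pd e f x) (at 0)" by simp
      then show "(\<lambda>n. (f (x + h n *\<^sub>R e) - f x) / h n) \<longlonglongrightarrow> pd e f x"
        by (rule filterlim_compose) (use h in \<open>auto simp: filterlim_at\<close>)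
    qed
    show "AE x in lebesgue. norm (v x * ((f (x + h n *\<^sub>R e) - f x) / h n)) \<le> w x" for n
    proof (rule AE_I2)
      fix x :: 'a
      have q: "\<bar>(f (x + h n *\<^sub>R e) - f x) / h n\<bar> \<le> C"
        using lipschitz_along_direction(1)[OF f C(2), of x "h n"] h(2)[of n]
        by (simp add: abs_divide pos_divide_le_eq)
      show "norm (v x * ((f (x + h n *\<^sub>R e) - f x) / h n)) \<le> w x"
      proof (cases "x \<in> cball 0 (R + H * norm e)")
        case True
        then show ?thesis using mult_mono[OF v(2)[of x] q] B0 by (simp add: w_def abs_mult)
      next
        case False
        have "norm (h n *\<^sub>R e) \<le> H * norm e" using H(2)[of n] by (simp add: mult_right_mono)
        moreover have "norm x \<le> norm (x + h n *\<^sub>R e) + norm (h n *\<^sub>R e)"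
          using norm_triangle_ineq4[of "x + h n *\<^sub>R e" "h n *\<^sub>R e"] by simp
        moreover have "H * norm e \<ge> 0" using H by simp
        ultimately have "norm x > R" "norm (x + h n *\<^sub>R e) > R" using False by auto
        then have "x \<notin> K" "x + h n *\<^sub>R e \<notin> K" using R by auto
        then show ?thesis using K(2) by (simp add: w_def B0 C(1) less_imp_le)
      qed
    qed
  qed
qed

text \<open>By translation invariance of Lebesgue measure, every difference quotient has integral zero.\<close>

lemma integral_pd_eq_zero:
  fixes f :: "'a::euclidean_space \<Rightarrow> real"
  assumes f: "C_on 1 UNIV f" and K: "compact K" "\<And>x. x \<notin> K \<Longrightarrow> f x = 0"
  shows "(LINT x|lebesgue. pd e f x) = 0"
proof -
  have cf: "continuous_on UNIV f" using f C_on_imp_continuous_on by blast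
  have mf: "f \<in> borel_measurable borel" using cf borel_measurable_continuous_onI by blast
  obtain B where B: "B > 0" "\<And>x. \<bar>f x\<bar> \<le> B"
    by (rule bounded_range_if_compact_support[OF cf K(1), of]) (use K(2) in auto)
  have int: "integrable lebesgue (\<lambda>x. f (x + c))" for c
  proof (rule integrable_bounded_support[where B=B and S="(\<lambda>x. x - c) ` K"])
    show "(\<lambda>x. f (x + c)) \<in> borel_measurable lebesgue"
      by (rule borel_imp_lebesgue_measurable) (use mf in measurable)
    show "bounded ((\<lambda>x. x - c) ` K)"
      using bounded_translation_minus compact_imp_bounded[OF K(1)] by blast
    show "x \<notin> (\<lambda>x. x - c) ` K \<Longrightarrow> f (x + c) = 0" for x
      using K(2)[of "x + c"] by (force simp: image_iff)
  qed (rule B)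
  have z: "(LINT x|lebesgue. 1 * ((f (x + h *\<^sub>R e) - f x) / h)) = 0" for h
    using int[of "h *\<^sub>R e"] int[of 0] by (simp add: lebesgue_integral_shift[OF mf])
  have "(\<lambda>n. LINT x|lebesgue. 1 * ((f (x + inverse (real (Suc n)) *\<^sub>R e) - f x) / inverse (real (Suc n))))
     \<longlonglongrightarrow> (LINT x|lebesgue. 1 * pd e f x)"
    by (rule difference_quotient_limit[OF f K, where B=1])
      (use LIMSEQ_inverse_real_of_nat in auto)
  then show ?thesis unfolding z using LIMSEQ_unique[OF tendsto_const] by fastforce
qed

section \<open>Test functions\<close>

lemma C_on_Suc_pd: "C_on (Suc k) S f \<Longrightarrow> i \<in> Basis \<Longrightarrow> C_on k S (pd i f)"
  by simp

lemma test_functionI: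
  assumes "\<And>k. C_on k UNIV \<phi>" "compact K" "K \<subseteq> \<Omega>" "\<And>x. x \<notin> K \<Longrightarrow> \<phi> x = 0"
  shows "test_function \<Omega> \<phi>"
proof -
  have c: "closure {x. \<phi> x \<noteq> 0} \<subseteq> K"
    by (rule closure_minimal) (use assms compact_imp_closed in auto)
  then have "compact (closure {x. \<phi> x \<noteq> 0})"
    using assms(2) compact_closure bounded_subset compact_imp_bounded closure_subset by meson
  then show ?thesis using assms c by (auto simp: test_function_def smooth_on_def)
qed

lemma test_functionE:
  assumes "test_function \<Omega> \<phi>"
  obtains K where "compact K" "K \<subseteq> \<Omega>" "\<And>x. x \<notin> K \<Longrightarrow> \<phi> x = 0" "\<And>e x. x \<notin> K \<Longrightarrow> pd e \<phi> x = 0"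
proof -
  define K where "K = closure {x. \<phi> x \<noteq> 0}"
  have z: "\<phi> x = 0" if "x \<notin> K" for x
  proof (rule ccontr)
    assume "\<phi> x \<noteq> 0"
    then have "x \<in> {x. \<phi> x \<noteq> 0}" by simp
    then have "x \<in> K" unfolding K_def by (rule subsetD[OF closure_subset])
    with that show False by simp
  qed
  have p: "pd e \<phi> x = 0" if "x \<notin> K" for e x
  proof (rule pd_zero_off_closed[where f=\<phi> and K=K])
    show "closed K" unfolding K_def by (rule closed_closure)
  qed (fact z that)+
  show thesis
    by (rule that[of K]) (use assms z p in \<open>unfold test_function_def K_def, blast+\<close>)
qed

lemma test_function_C_on: "test_function \<Omega> \<phi> \<Longrightarrow> C_on k UNIV \<phi>"
  by (simp add: test_function_def smooth_on_def)

lemma test_function_derivative: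
  "test_function \<Omega> \<phi> \<Longrightarrow> (\<phi> has_derivative frechet_derivative \<phi> (at x)) (at x)"
  using smooth_on_derivative[OF _ UNIV_I] by (simp only: test_function_def) blast

lemma test_function_mono: "test_function \<Omega> \<phi> \<Longrightarrow> \<Omega> \<subseteq> \<Omega>' \<Longrightarrow> test_function \<Omega>' \<phi>"
  by (auto simp: test_function_def)

lemma test_function_pd: "test_function \<Omega> \<phi> \<Longrightarrow> i \<in> Basis \<Longrightarrow> test_function \<Omega> (pd i \<phi>)"
proof -
  assume t: "test_function \<Omega> \<phi>" and i: "i \<in> Basis"
  obtain K where K: "compact K" "K \<subseteq> \<Omega>" "\<And>x. x \<notin> K \<Longrightarrow> pd i \<phi> x = 0"
    using test_functionE[OF t] by metis
  show ?thesis
  proof (rule test_functionI[OF _ K])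
    show "C_on k UNIV (pd i \<phi>)" for k

      by (rule C_on_Suc_pd[OF test_function_C_on[OF t] i])
  qed
qed

lemma test_function_bounded:
  assumes "test_function \<Omega> \<phi>"
  obtains B where "B > 0" "\<And>x. \<bar>\<phi> x\<bar> \<le> B"
proof -
  obtain K where K: "compact K" "K \<subseteq> \<Omega>" "\<And>x. x \<notin> K \<Longrightarrow> \<phi> x = 0"
    using test_functionE[OF assms] by metis
  show thesis
    by (rule bounded_range_if_compact_support[where f=\<phi> and K=K, OF
          C_on_imp_continuous_on[OF test_function_C_on[OF assms, of 0]] K(1) K(3)], assumption, rule that)
qed

lemma test_function_continuous: "test_function \<Omega> \<phi> \<Longrightarrow> continuous_on S \<phi>"
  using C_on_imp_continuous_on[OF test_function_C_on] continuous_on_subset by blast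

lemma test_function_borel: "test_function \<Omega> \<phi> \<Longrightarrow> \<phi> \<in> borel_measurable borel"
  using test_function_continuous borel_measurable_continuous_onI by blast

lemma test_function_measurable: "test_function \<Omega> \<phi> \<Longrightarrow> \<phi> \<in> borel_measurable lebesgue"
  using test_function_borel borel_imp_lebesgue_measurable by blast

lemma test_function_lincomb:
  assumes "test_function \<Omega> \<phi>" "test_function \<Omega> \<psi>"
  shows "test_function \<Omega> (\<lambda>x. a * \<phi> x + b * \<psi> x)"
proof -
  obtain K where K: "compact K" "K \<subseteq> \<Omega>" "\<And>x. x \<notin> K \<Longrightarrow> \<phi> x = 0"
    using test_functionE[OF assms(1)] by metis
  obtain L where L: "compact L" "L \<subseteq> \<Omega>" "\<And>x. x \<notin> L \<Longrightarrow> \<psi> x = 0"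
    using test_functionE[OF assms(2)] by metis
  show ?thesis
  proof (rule test_functionI[of _ "K \<union> L"])
    show "C_on k UNIV (\<lambda>x. a * \<phi> x + b * \<psi> x)" for k
      by (intro C_on_add[OF open_UNIV] C_on_mult[OF open_UNIV] C_on_const[OF open_UNIV]
          test_function_C_on[OF assms(1)] test_function_C_on[OF assms(2)])
  qed (use K L in auto)
qed

lemma pd_lincomb:
  assumes "test_function \<Omega> \<phi>" "test_function \<Omega> \<psi>"
  shows "pd e (\<lambda>x. a * \<phi> x + b * \<psi> x) x = a * pd e \<phi> x + b * pd e \<psi> x"
  by (rule pd_eqI[where f'="\<lambda>e. a * pd e \<phi> x + b * pd e \<psi> x"])
    (intro has_derivative_add has_derivative_mult_right test_function_derivative[OF assms(1)]
      test_function_derivative[OF assms(2)])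

lemma pd_mult:
  assumes "test_function \<Omega> \<phi>" "test_function \<Omega>' \<psi>"
  shows "pd e (\<lambda>x. \<phi> x * \<psi> x) x = \<phi> x * pd e \<psi> x + pd e \<phi> x * \<psi> x"
  by (rule pd_eqI[where f'="\<lambda>e. \<phi> x * pd e \<psi> x + pd e \<phi> x * \<psi> x"])
    (intro has_derivative_mult test_function_derivative[OF assms(1)]
      test_function_derivative[OF assms(2)])

lemma test_function_mult:
  assumes "test_function \<Omega> \<phi>" "\<And>k. C_on k UNIV \<psi>"
  shows "test_function \<Omega> (\<lambda>x. \<phi> x * \<psi> x)"
proof -
  obtain K where K: "compact K" "K \<subseteq> \<Omega>" "\<And>x. x \<notin> K \<Longrightarrow> \<phi> x = 0"
    using test_functionE[OF assms(1)] by metis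
  show ?thesis
  proof (rule test_functionI[of _ K])
    show "C_on k UNIV (\<lambda>x. \<phi> x * \<psi> x)" for k
      by (intro C_on_mult[OF open_UNIV] assms(2) test_function_C_on[OF assms(1)])
  qed (use K in auto)
qed

section \<open>The fundamental lemma of the calculus of variations\<close>

lemma flat_exp_le_1: "flat_exp 0 s \<le> 1"
  by (simp add: flat_exp_def)

text \<open>For each \<open>n\<close> a test function of the box; as \<open>n\<close> grows, these increase to the indicator function of its
interior. If a coordinate of \<open>x\<close> leaves its interval, exactly one of the two factors is nonpositive, so
the corresponding value of \<open>flat_exp\<close> is zero.\<close>

definition box_bump :: "nat \<Rightarrow> 'a::euclidean_space \<Rightarrow> 'a \<Rightarrow> 'a \<Rightarrow> real" where
  "box_bump n a b x = (\<Prod>i\<in>Basis. flat_exp 0 (real (Suc n) * ((x \<bullet> i - a \<bullet> i) * (b \<bullet> i - x \<bullet> i))))"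

lemma box_bump_bounds: "0 \<le> box_bump n a b x" "box_bump n a b x \<le> 1"
  unfolding box_bump_def by (intro prod_nonneg prod_le_1 ballI conjI flat_exp_nonneg flat_exp_le_1)+

lemma box_bump_outside:
  assumes "box a b \<noteq> {}" "x \<notin> box a b"
  shows "box_bump n a b x = 0"
proof -
  from assms(2) obtain i where i: "i \<in> Basis" "\<not> (a \<bullet> i < x \<bullet> i \<and> x \<bullet> i < b \<bullet> i)"
    by (auto simp: mem_box)
  have ab: "a \<bullet> i < b \<bullet> i" using assms(1) i(1) by (auto simp: box_ne_empty)
  have "(x \<bullet> i - a \<bullet> i) * (b \<bullet> i - x \<bullet> i) \<le> 0"
  proof (cases "a \<bullet> i < x \<bullet> i")
    case True
    show ?thesis by (rule mult_nonneg_nonpos) (use True i(2) in linarith)+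
  next
    case False
    show ?thesis by (rule mult_nonpos_nonneg) (use False ab in linarith)+
  qed
  then have "real (Suc n) * ((x \<bullet> i - a \<bullet> i) * (b \<bullet> i - x \<bullet> i)) \<le> 0"
    by (rule mult_nonneg_nonpos[OF of_nat_0_le_iff])
  then have "flat_exp 0 (real (Suc n) * ((x \<bullet> i - a \<bullet> i) * (b \<bullet> i - x \<bullet> i))) = 0"
    by (simp only: flat_exp_def not_less[symmetric] if_False)
  then show ?thesis unfolding box_bump_def using i(1) by (intro prod_zero[OF finite_Basis]) blast
qed

lemma box_bump_tendsto:
  assumes "x \<in> box a b"
  shows "(\<lambda>n. box_bump n a b x) \<longlonglongrightarrow> 1"
proof -
  have "(\<lambda>n. flat_exp 0 (real (Suc n) * c)) \<longlonglongrightarrow> 1" if c: "c > 0" for c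
  proof -
    have "(\<lambda>n. - (inverse (real (Suc n)) * inverse c)) \<longlonglongrightarrow> - (0 * inverse c)"
      by (intro tendsto_minus tendsto_mult LIMSEQ_inverse_real_of_nat tendsto_const)
    then have "(\<lambda>n. exp (- (inverse (real (Suc n)) * inverse c))) \<longlonglongrightarrow> exp (- (0 * inverse c))"
      by (rule tendsto_exp)
    moreover have "flat_exp 0 (real (Suc n) * c) = exp (- (inverse (real (Suc n)) * inverse c))" for n
      using c by (simp add: flat_exp_def divide_simps)
    ultimately show ?thesis by simp
  qed
  then have "(\<lambda>n. box_bump n a b x) \<longlonglongrightarrow> (\<Prod>i\<in>(Basis::'a set). 1)"
    unfolding box_bump_def using assms by (intro tendsto_prod) (auto simp: mem_box)
  then show ?thesis by simp
qed

lemma test_function_box_bump: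
  assumes "box a b \<noteq> {}" "cbox a b \<subseteq> \<Omega>"
  shows "test_function \<Omega> (box_bump n a b)"
proof (rule test_functionI[OF _ compact_cbox assms(2)])
  show "C_on k UNIV (box_bump n a b)" for k
    unfolding box_bump_def[abs_def]
  proof (rule C_on_prod[OF finite_Basis open_UNIV])
    fix i :: 'a assume "i \<in> Basis"
    have "C_on k UNIV (\<lambda>x. real (Suc n) * ((x \<bullet> i - a \<bullet> i) * (b \<bullet> i - x \<bullet> i)))"
      by (intro C_on_mult[OF open_UNIV] C_on_diff[OF open_UNIV] C_on_const[OF open_UNIV] C_on_inner[OF open_UNIV])
    then show "C_on k UNIV (\<lambda>x. flat_exp 0 (real (Suc n) * ((x \<bullet> i - a \<bullet> i) * (b \<bullet> i - x \<bullet> i))))"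
      by (rule C_on_compose[OF open_UNIV open_UNIV C_on_flat_exp]) simp
  qed
  show "x \<notin> cbox a b \<Longrightarrow> box_bump n a b x = 0" for x
    using box_bump_outside[OF assms(1)] box_subset_cbox by blast
qed

lemma integrable_times_test:
  fixes g :: "'a::euclidean_space \<Rightarrow> real"
  assumes "locally_integrable \<Omega> g" "test_function \<Omega> \<phi>"
  shows "set_integrable lebesgue \<Omega> (\<lambda>x. g x * \<phi> x)"
proof -
  obtain K where K: "compact K" "K \<subseteq> \<Omega>" "\<And>x. x \<notin> K \<Longrightarrow> \<phi> x = 0"
    using test_functionE[OF assms(2)] by metis
  obtain B where B: "B > 0" "\<And>x. \<bar>\<phi> x\<bar> \<le> B" using test_function_bounded[OF assms(2)] by metis
  have i: "integrable lebesgue (\<lambda>x. indicator K x *\<^sub>R g x)"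
    using assms(1) K(1,2) unfolding locally_integrable_def set_integrable_def by blast
  have eq: "indicator \<Omega> x *\<^sub>R (g x * \<phi> x) = (indicator K x *\<^sub>R g x) * \<phi> x" for x
  proof (cases "x \<in> K")
    case True
    then show ?thesis using K(2) by (auto simp: indicator_def)
  qed (simp add: K(3))
  show ?thesis unfolding set_integrable_def eq
  proof (rule Bochner_Integration.integrable_bound)
    show "integrable lebesgue (\<lambda>x. B * (indicator K x *\<^sub>R g x))"
      using i by (rule integrable_mult_right)
    show "(\<lambda>x. (indicator K x *\<^sub>R g x) * \<phi> x) \<in> borel_measurable lebesgue"
      by (intro borel_measurable_times borel_measurable_integrable[OF i] test_function_measurable[OF assms(2)])
    show "AE x in lebesgue. norm ((indicator K x *\<^sub>R g x) * \<phi> x) \<le> norm (B * (indicator K x *\<^sub>R g x))"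
    proof (rule AE_I2)
      fix x
      have "\<bar>\<phi> x\<bar> * \<bar>indicator K x *\<^sub>R g x\<bar> \<le> \<bar>B\<bar> * \<bar>indicator K x *\<^sub>R g x\<bar>"
        using B by (intro mult_right_mono) auto
      then show "norm ((indicator K x *\<^sub>R g x) * \<phi> x) \<le> norm (B * (indicator K x *\<^sub>R g x))"
        unfolding real_norm_def abs_mult[of B] abs_mult[of _ "\<phi> x"] by (simp only: mult.commute)
    qed
  qed
qed

lemma box_integral_nonneg:
  fixes g :: "'a::euclidean_space \<Rightarrow> real"
  assumes g: "locally_integrable \<Omega> g"
    and pos: "\<And>\<phi>. test_function \<Omega> \<phi> \<Longrightarrow> (\<And>x. 0 \<le> \<phi> x) \<Longrightarrow> 0 \<le> (LINT x:\<Omega>|lebesgue. g x * \<phi> x)"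
    and ab: "box a b \<noteq> {}" "cbox a b \<subseteq> \<Omega>"
  shows "0 \<le> (LINT x:box a b|lebesgue. g x)"
proof -
  have i: "integrable lebesgue (\<lambda>x. indicator (cbox a b) x *\<^sub>R g x)"
    using g ab(2) compact_cbox unfolding locally_integrable_def set_integrable_def by blast
  have eq: "indicator \<Omega> x *\<^sub>R (g x * box_bump n a b x) = (indicator (cbox a b) x *\<^sub>R g x) * box_bump n a b x" for n x
  proof (cases "x \<in> cbox a b")
    case True
    then show ?thesis using ab(2) by (auto simp: indicator_def)
  next
    case False
    then have "x \<notin> box a b" using box_subset_cbox by blast
    then show ?thesis by (simp add: box_bump_outside[OF ab(1)])
  qed
  have "(\<lambda>n. LINT x|lebesgue. (indicator (cbox a b) x *\<^sub>R g x) * box_bump n a b x)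
      \<longlonglongrightarrow> (LINT x|lebesgue. indicator (box a b) x *\<^sub>R g x)"
  proof (rule integral_dominated_convergence[where w="\<lambda>x. \<bar>indicator (cbox a b) x *\<^sub>R g x\<bar>"])
    show "integrable lebesgue (\<lambda>x. \<bar>indicator (cbox a b) x *\<^sub>R g x\<bar>)"
      using i by (rule integrable_abs)
    have e: "indicator (box a b) x *\<^sub>R g x = indicator (box a b) x * (indicator (cbox a b) x *\<^sub>R g x)" for x
      using box_subset_cbox[of a b] by (auto simp: indicator_def)
    show "(\<lambda>x. indicator (box a b) x *\<^sub>R g x) \<in> borel_measurable lebesgue"
      unfolding e by (intro borel_measurable_times borel_measurable_integrable[OF i] borel_measurable_indicator) simp
    show "(\<lambda>x. (indicator (cbox a b) x *\<^sub>R g x) * box_bump n a b x) \<in> borel_measurable lebesgue" for n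
      by (intro borel_measurable_times borel_measurable_integrable[OF i]
        test_function_measurable[OF test_function_box_bump[OF ab]])
    show "AE x in lebesgue. (\<lambda>n. (indicator (cbox a b) x *\<^sub>R g x) * box_bump n a b x)
        \<longlonglongrightarrow> indicator (box a b) x *\<^sub>R g x"
    proof (rule AE_I2)
      fix x
      show "(\<lambda>n. (indicator (cbox a b) x *\<^sub>R g x) * box_bump n a b x) \<longlonglongrightarrow> indicator (box a b) x *\<^sub>R g x"
      proof (cases "x \<in> box a b")
        case True
        then have "x \<in> cbox a b" using box_subset_cbox by blast
        then show ?thesis using tendsto_mult[OF tendsto_const[of "g x"] box_bump_tendsto[OF True]] True
          by simp
      next
        case False
        then show ?thesis by (simp add: box_bump_outside[OF ab(1)])
      qed
    qed
    show "AE x in lebesgue. norm ((indicator (cbox a b) x *\<^sub>R g x) * box_bump n a b x)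
        \<le> \<bar>indicator (cbox a b) x *\<^sub>R g x\<bar>" for n
    proof (rule AE_I2)
      fix x
      show "norm ((indicator (cbox a b) x *\<^sub>R g x) * box_bump n a b x) \<le> \<bar>indicator (cbox a b) x *\<^sub>R g x\<bar>"
        unfolding real_norm_def abs_mult using box_bump_bounds[of n a b x]
        by (intro mult_left_le) auto
    qed
  qed
  moreover have "0 \<le> (LINT x|lebesgue. (indicator (cbox a b) x *\<^sub>R g x) * box_bump n a b x)" for n
    using pos[OF test_function_box_bump[OF ab] box_bump_bounds(1)]
    unfolding set_lebesgue_integral_def eq .
  ultimately show ?thesis unfolding set_lebesgue_integral_def
    by (intro LIMSEQ_le_const) auto
qed

lemma cube_subset_ball:
  fixes x :: "'a::euclidean_space"
  assumes "x \<in> ball z R"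
  obtains d where "d > 0" "\<And>h. 0 < h \<Longrightarrow> h < d \<Longrightarrow> cbox x (x + h *\<^sub>R One) \<subseteq> ball z R"
proof -
  obtain e where e: "e > 0" "ball x e \<subseteq> ball z R"
    using assms open_contains_ball[of "ball z R"] open_ball by blast
  show thesis
  proof (rule that[of "e / DIM('a)"])
    fix h assume h: "0 < h" "h < e / DIM('a)"
    have "cbox x (x + h *\<^sub>R One) \<subseteq> ball x e"
    proof
      fix y assume y: "y \<in> cbox x (x + h *\<^sub>R One)"
      have "norm (y - x) \<le> (\<Sum>i\<in>Basis. \<bar>(y - x) \<bullet> i\<bar>)" by (rule norm_le_l1)
      also have "\<dots> \<le> (\<Sum>i\<in>(Basis::'a set). h)"
        using y by (intro sum_mono) (auto simp: mem_box inner_simps)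
      also have "\<dots> = DIM('a) * h" by simp
      also have "\<dots> < e" using h(2) by (simp add: pos_less_divide_eq mult.commute)
      finally show "y \<in> ball x e" by (simp add: dist_norm norm_minus_commute)
    qed
    with e(2) show "cbox x (x + h *\<^sub>R One) \<subseteq> ball z R" by blast
  qed (use e in simp)
qed

text \<open>Averages over boxes are nonnegative because boxes are limits of test functions; by Lebesgue
differentiation along cubes the function is a.e. the limit of such averages.\<close>

lemma AE_nonneg_ball:
  fixes g :: "'a::euclidean_space \<Rightarrow> real"
  assumes g: "locally_integrable \<Omega> g"
    and pos: "\<And>\<phi>. test_function \<Omega> \<phi> \<Longrightarrow> (\<And>x. 0 \<le> \<phi> x) \<Longrightarrow> 0 \<le> (LINT x:\<Omega>|lebesgue. g x * \<phi> x)"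
    and z: "cball z R \<subseteq> \<Omega>"
  shows "AE x in lebesgue. x \<in> ball z R \<longrightarrow> 0 \<le> g x"
proof -
  define f where "f x = indicator (cball z R) x *\<^sub>R g x" for x
  have i: "integrable lebesgue f"
    using g z compact_cball unfolding locally_integrable_def set_integrable_def f_def by blast
  have ai: "f absolutely_integrable_on S" if "S \<in> sets lebesgue" for S
    using integrable_mult_indicator[OF that i] unfolding set_integrable_def .
  have "f integrable_on cbox a b" for a b
    by (rule set_lebesgue_integral_eq_integral(1)[OF ai]) simp
  then obtain N where N: "negligible N" "\<And>x e. \<lbrakk>x \<notin> N; 0 < e\<rbrakk> \<Longrightarrow>
       \<exists>d>0. \<forall>h. 0 < h \<and> h < d \<longrightarrow> norm (integral (cbox x (x + h *\<^sub>R One)) f /\<^sub>R h ^ DIM('a) - f x) < e"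
    using integrable_ccontinuous_explicit[of f] by metis
  have "0 \<le> g x" if x: "x \<in> ball z R" "x \<notin> N" for x
  proof (rule ccontr)
    assume "\<not> 0 \<le> g x"
    have fx: "f x = g x" using x(1) by (simp add: f_def less_imp_le)
    obtain d where d: "d > 0" "\<And>h. 0 < h \<Longrightarrow> h < d \<Longrightarrow>
        norm (integral (cbox x (x + h *\<^sub>R One)) f /\<^sub>R h ^ DIM('a) - f x) < - g x"
      using N(2)[OF x(2), of "- g x"] \<open>\<not> 0 \<le> g x\<close> by auto
    obtain d' where d': "d' > 0" "\<And>h. 0 < h \<Longrightarrow> h < d' \<Longrightarrow> cbox x (x + h *\<^sub>R One) \<subseteq> ball z R"
      using cube_subset_ball[OF x(1)] by metis
    define h where "h = min d d' / 2"
    have h: "0 < h" "h < d" "h < d'" using d(1) d'(1) by (auto simp: h_def)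
    define C where "C = box x (x + h *\<^sub>R One)"
    have sub: "cbox x (x + h *\<^sub>R One) \<subseteq> cball z R" using d'(2)[OF h(1,3)] ball_subset_cball by blast
    have ne: "C \<noteq> {}" using h(1) by (auto simp: C_def box_ne_empty inner_simps)
    have "0 \<le> (LINT x:C|lebesgue. g x)"
      unfolding C_def by (rule box_integral_nonneg[OF g pos]) (use ne sub z in \<open>auto simp: C_def\<close>)
    also have "\<dots> = (LINT x:C|lebesgue. f x)"
    proof -
      have "C \<subseteq> cball z R" unfolding C_def using sub box_subset_cbox by blast
      then show ?thesis unfolding set_lebesgue_integral_def f_def
        by (intro Bochner_Integration.integral_cong) (auto simp: indicator_def)
    qed
    also have "\<dots> = integral C f"
      by (rule set_lebesgue_integral_eq_integral(2)[OF ai]) (simp add: C_def)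
    also have "\<dots> = integral (cbox x (x + h *\<^sub>R One)) f" unfolding C_def by (rule integral_open_interval)
    finally have "0 \<le> integral (cbox x (x + h *\<^sub>R One)) f /\<^sub>R h ^ DIM('a)" using h(1) by simp
    with d(2)[OF h(1,2)] \<open>\<not> 0 \<le> g x\<close> fx show False by simp
  qed
  then have "{x \<in> space lebesgue. \<not> (x \<in> ball z R \<longrightarrow> 0 \<le> g x)} \<subseteq> N" by blast
  with N(1)[unfolded negligible_iff_null_sets] show ?thesis by (rule AE_I')
qed

text \<open>The one-sided form of the fundamental lemma. It yields uniqueness of weak gradients as well as pointwise
bounds for them, by applying it to differences with constants and with other weak gradients.\<close>

lemma AE_nonneg_of_test:
  fixes g :: "'a::euclidean_space \<Rightarrow> real"
  assumes "open \<Omega>" and g: "locally_integrable \<Omega> g"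
    and pos: "\<And>\<phi>. test_function \<Omega> \<phi> \<Longrightarrow> (\<And>x. 0 \<le> \<phi> x) \<Longrightarrow> 0 \<le> (LINT x:\<Omega>|lebesgue. g x * \<phi> x)"
  shows "AE x in lebesgue. x \<in> \<Omega> \<longrightarrow> 0 \<le> g x"
proof -
  define F where "F = {B. \<exists>z R. cball z R \<subseteq> \<Omega> \<and> B = ball z R}"
  have "open S" if "S \<in> F" for S using that by (auto simp: F_def)
  then obtain F' where F': "F' \<subseteq> F" "countable F'" "\<Union>F' = \<Union>F"
    by (rule Lindelof)
  have "\<Omega> \<subseteq> \<Union>F"
  proof
    fix x assume "x \<in> \<Omega>"
    then obtain e where "e > 0" "cball x e \<subseteq> \<Omega>" using assms(1) open_contains_cball by blast
    then show "x \<in> \<Union>F" unfolding F_def by (intro UnionI[of "ball x e"]) auto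
  qed
  moreover have "AE x in lebesgue. \<forall>S\<in>F'. x \<in> S \<longrightarrow> 0 \<le> g x"
  proof (rule AE_ball_countable'[OF _ F'(2)])
    fix S assume "S \<in> F'"
    then obtain z R where "cball z R \<subseteq> \<Omega>" "S = ball z R" using F'(1) by (auto simp: F_def)
    then show "AE x in lebesgue. x \<in> S \<longrightarrow> 0 \<le> g x" using AE_nonneg_ball[OF g pos] by simp
  qed
  ultimately show ?thesis using F'(3) by (auto elim!: eventually_mono)
qed

section \<open>Weak gradients\<close>

lemma set_integral_of_support:
  fixes f :: "'a::euclidean_space \<Rightarrow> 'b::euclidean_space"
  assumes "\<And>x. x \<notin> \<Omega> \<Longrightarrow> f x = 0"
  shows "(LINT x:\<Omega>|lebesgue. f x) = (LINT x|lebesgue. f x)"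
    "set_integrable lebesgue \<Omega> f \<longleftrightarrow> integrable lebesgue f"
proof -
  have "(\<lambda>x. indicator \<Omega> x *\<^sub>R f x) = f" using assms by (auto simp: indicator_def fun_eq_iff)
  then show "(LINT x:\<Omega>|lebesgue. f x) = (LINT x|lebesgue. f x)"
    "set_integrable lebesgue \<Omega> f \<longleftrightarrow> integrable lebesgue f"
    by (simp_all only: set_lebesgue_integral_def set_integrable_def)
qed

lemma test_function_integrable:
  assumes "test_function \<Omega> \<phi>" "v \<in> borel_measurable lebesgue" "\<And>x. \<bar>v x\<bar> \<le> B"
  shows "integrable lebesgue (\<lambda>x. v x * \<phi> x)"
proof -
  obtain K where K: "compact K" "K \<subseteq> \<Omega>" "\<And>x. x \<notin> K \<Longrightarrow> \<phi> x = 0"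
    using test_functionE[OF assms(1)] by metis
  obtain C where C: "C > 0" "\<And>x. \<bar>\<phi> x\<bar> \<le> C" using test_function_bounded[OF assms(1)] by metis
  show ?thesis
  proof (rule integrable_bounded_support[OF _ compact_imp_bounded[OF K(1)]])
    show "(\<lambda>x. v x * \<phi> x) \<in> borel_measurable lebesgue"
      by (intro borel_measurable_times assms(2) test_function_measurable[OF assms(1)])
    show "\<bar>v x * \<phi> x\<bar> \<le> B * C" for x
      unfolding abs_mult by (rule mult_mono[OF assms(3) C(2)]) (use assms(3)[of x] in linarith)+
  qed (simp add: K(3))
qed

lemma test_function_integrable1: "test_function \<Omega> \<phi> \<Longrightarrow> integrable lebesgue \<phi>"
  using test_function_integrable[of \<Omega> \<phi> "\<lambda>_. 1" 1] by simp

lemma test_function_outside: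
  assumes "test_function \<Omega> \<phi>" "x \<notin> \<Omega>"
  shows "\<phi> x = 0 \<and> pd e \<phi> x = 0"
proof (rule test_functionE[OF assms(1)])
  fix K assume K: "K \<subseteq> \<Omega>" "\<And>x. x \<notin> K \<Longrightarrow> \<phi> x = 0" "\<And>e x. x \<notin> K \<Longrightarrow> pd e \<phi> x = 0"
  have x: "x \<notin> K" using K(1) assms(2) by blast
  have y: "\<phi> x = 0" by (rule K(2)[OF x])
  have z: "pd e \<phi> x = 0" by (rule K(3)[OF x])
  show ?thesis by (intro conjI y z)
qed

lemmas test_function_off = test_function_outside[THEN conjunct1] test_function_outside[THEN conjunct2]

lemma locally_integrable_measurable:
  fixes f :: "'a::euclidean_space \<Rightarrow> 'b::euclidean_space"
  assumes "open \<Omega>" "locally_integrable \<Omega> f"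
  shows "(\<lambda>x. indicator \<Omega> x *\<^sub>R f x) \<in> borel_measurable lebesgue"
proof -
  have "\<exists>C :: nat \<Rightarrow> 'a set. (\<forall>n. compact (C n) \<and> C n \<subseteq> \<Omega>) \<and>
     (\<forall>K. compact K \<and> K \<subseteq> \<Omega> \<longrightarrow> (\<exists>N. \<forall>n\<ge>N. K \<subseteq> C n))"
  proof (rule open_Union_compact_subsets[OF assms(1)], goal_cases)
    case (1 C)
    show ?case by (intro exI[of _ C] conjI allI impI) (use 1(1,2,5) in blast)+
  qed
  then obtain C :: "nat \<Rightarrow> 'a set" where C': "\<forall>n. compact (C n) \<and> C n \<subseteq> \<Omega>"
    "\<forall>K. compact K \<and> K \<subseteq> \<Omega> \<longrightarrow> (\<exists>N. \<forall>n\<ge>N. K \<subseteq> C n)" by (elim exE conjE) (rule that)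
  have C: "compact (C n)" "C n \<subseteq> \<Omega>" for n
    using spec[OF C'(1), of n] by simp_all
  have E: "\<exists>N. \<forall>n\<ge>N. K \<subseteq> C n" if "compact K" "K \<subseteq> \<Omega>" for K
    using spec[OF C'(2), of K] that by simp
  show ?thesis
  proof (rule borel_measurable_LIMSEQ_metric)
    show "(\<lambda>x. indicator (C n) x *\<^sub>R f x) \<in> borel_measurable lebesgue" for n
      using assms(2) C(1)[of n] C(2)[of n] borel_measurable_integrable
      unfolding locally_integrable_def set_integrable_def by blast
    show "(\<lambda>n. indicator (C n) x *\<^sub>R f x) \<longlonglongrightarrow> indicator \<Omega> x *\<^sub>R f x" for x
    proof (cases "x \<in> \<Omega>")
      case True
      then obtain N where N: "\<forall>n\<ge>N. {x} \<subseteq> C n" using E[of "{x}"] by auto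
      have "eventually (\<lambda>n. indicator (C n) x *\<^sub>R f x = indicator \<Omega> x *\<^sub>R f x) sequentially"
        unfolding eventually_sequentially using N True by (intro exI[of _ N]) auto
      then show ?thesis by (rule tendsto_eventually)
    next
      case False
      then have "x \<notin> C n" for n using C(2) by blast
      then show ?thesis using False by simp
    qed
  qed
qed

lemma locally_integrable_inner:
  "locally_integrable \<Omega> g \<Longrightarrow> locally_integrable \<Omega> (\<lambda>x. g x \<bullet> i)"
  unfolding locally_integrable_def set_integrable_def
proof (intro allI impI)
  fix K assume a: "\<forall>K. compact K \<and> K \<subseteq> \<Omega> \<longrightarrow> integrable lebesgue (\<lambda>x. indicat_real K x *\<^sub>R g x)"
    and K: "compact K \<and> K \<subseteq> \<Omega>"
  have "integrable lebesgue (\<lambda>x. (indicat_real K x *\<^sub>R g x) \<bullet> i)"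
    using a K by (intro integrable_inner_left) blast
  then show "integrable lebesgue (\<lambda>x. indicat_real K x *\<^sub>R (g x \<bullet> i))"
    by (simp only: inner_scaleR_left real_scaleR_def)
qed

lemma locally_integrable_lincomb:
  fixes f g :: "'a::euclidean_space \<Rightarrow> 'b::euclidean_space"
  assumes "locally_integrable \<Omega> f" "locally_integrable \<Omega> g"
  shows "locally_integrable \<Omega> (\<lambda>x. a *\<^sub>R f x + b *\<^sub>R g x)"
  unfolding locally_integrable_def
proof (intro allI impI)
  fix K assume "compact K \<and> K \<subseteq> \<Omega>"
  then have "set_integrable lebesgue K f" "set_integrable lebesgue K g"
    using assms by (auto simp: locally_integrable_def)
  then show "set_integrable lebesgue K (\<lambda>x. a *\<^sub>R f x + b *\<^sub>R g x)"
    by (intro set_integral_add(1) set_integrable_scaleR_right)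
qed

lemma locally_integrable_continuous:
  fixes f :: "'a::euclidean_space \<Rightarrow> 'b::euclidean_space"
  assumes "continuous_on \<Omega> f"
  shows "locally_integrable \<Omega> f"
  unfolding locally_integrable_def
proof (intro allI impI)
  fix K assume "compact K \<and> K \<subseteq> \<Omega>"
  then have "set_integrable lborel K f"
    using assms borel_integrable_compact[of K f] continuous_on_subset unfolding set_integrable_def by blast
  moreover have "(\<lambda>x. indicator K x *\<^sub>R f x) \<in> borel_measurable lborel"
    using calculation unfolding set_integrable_def by (rule borel_measurable_integrable)
  ultimately show "set_integrable lebesgue K f"
    unfolding set_integrable_def by (subst integrable_completion)
qed

lemma has_weak_gradientD:
  "has_weak_gradient \<Omega> v g \<Longrightarrow> test_function \<Omega> \<phi> \<Longrightarrow> i \<in> Basis \<Longrightarrow>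
   (LINT x:\<Omega>|lebesgue. (g x \<bullet> i) * \<phi> x) = - (LINT x:\<Omega>|lebesgue. v x * pd i \<phi> x)"
  by (simp add: has_weak_gradient_def)

lemma has_weak_gradient_unique:
  assumes "open \<Omega>" "has_weak_gradient \<Omega> v g" "has_weak_gradient \<Omega> v h"
  shows "AE x in lebesgue. x \<in> \<Omega> \<longrightarrow> g x = h x"
proof -
  have le: "AE x in lebesgue. x \<in> \<Omega> \<longrightarrow> 0 \<le> g x \<bullet> i - h x \<bullet> i"
    if wg: "has_weak_gradient \<Omega> v g" and wh: "has_weak_gradient \<Omega> v h" and iB: "i \<in> Basis" for g h i
  proof (rule AE_nonneg_of_test[OF assms(1)])
    have lg: "locally_integrable \<Omega> (\<lambda>x. g x \<bullet> i)" and lh: "locally_integrable \<Omega> (\<lambda>x. h x \<bullet> i)"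
      using wg wh by (auto simp: has_weak_gradient_def intro: locally_integrable_inner)
    show "locally_integrable \<Omega> (\<lambda>x. g x \<bullet> i - h x \<bullet> i)"
      using locally_integrable_lincomb[OF lg lh, of 1 "-1"] by simp
    show "0 \<le> (LINT x:\<Omega>|lebesgue. (g x \<bullet> i - h x \<bullet> i) * \<phi> x)" if t: "test_function \<Omega> \<phi>" for \<phi>
    proof -
      have "(LINT x:\<Omega>|lebesgue. (g x \<bullet> i) * \<phi> x) = (LINT x:\<Omega>|lebesgue. (h x \<bullet> i) * \<phi> x)"
        using has_weak_gradientD[OF wg t] has_weak_gradientD[OF wh t] iB by simp

      then show ?thesis
        using set_integral_diff(2)[OF integrable_times_test[OF lg t] integrable_times_test[OF lh t]]
        by (simp add: left_diff_distrib)
    qed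
  qed
  have "AE x in lebesgue. \<forall>i\<in>Basis. x \<in> \<Omega> \<longrightarrow> g x \<bullet> i = h x \<bullet> i"
  proof (rule AE_finite_allI[OF finite_Basis])
    fix i :: 'a assume i: "i \<in> Basis"
    show "AE x in lebesgue. x \<in> \<Omega> \<longrightarrow> g x \<bullet> i = h x \<bullet> i"
      using le[OF assms(2,3) i] le[OF assms(3,2) i] by eventually_elim auto
  qed
  then show ?thesis by eventually_elim (auto intro: euclidean_eqI)
qed

lemma weak_grad_has:
  "v \<in> H1 \<Omega> \<Longrightarrow> has_weak_gradient \<Omega> v (weak_grad \<Omega> v)"
  unfolding weak_grad_def by (rule someI_ex[of "has_weak_gradient \<Omega> v"]) (auto simp: H1_def)

text \<open>In \<open>\<integral> u \<partial>\<phi>\<close> the derivative of \<open>\<phi>\<close> is replaced by a difference quotient, which a translation moves to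
\<open>u\<close>, where it is bounded by the Lipschitz constant.\<close>

lemma weak_gradient_le_lipschitz:
  fixes u :: "'a::euclidean_space \<Rightarrow> real"
  assumes "open \<Omega>" and g: "has_weak_gradient \<Omega> u g"
    and lip: "\<And>x y. x \<in> \<Omega> \<Longrightarrow> y \<in> \<Omega> \<Longrightarrow> \<bar>u x - u y\<bar> \<le> L * norm (x - y)"
    and bd: "\<And>x. x \<in> \<Omega> \<Longrightarrow> \<bar>u x\<bar> \<le> B" "B \<ge> 0"
    and cont: "continuous_on \<Omega> u" and i: "i \<in> Basis"
  shows "AE x in lebesgue. x \<in> \<Omega> \<longrightarrow> \<bar>g x \<bullet> i\<bar> \<le> L"
proof -
  define ub where "ub x = indicator \<Omega> x *\<^sub>R u x" for x
  have ubm: "ub \<in> borel_measurable borel"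
    unfolding ub_def[abs_def] using assms(1) cont by (intro borel_measurable_continuous_on_indicator) auto
  have ubb: "\<bar>ub x\<bar> \<le> B" for x using bd by (simp add: ub_def indicator_def)
  have key: "\<bar>LINT x:\<Omega>|lebesgue. (g x \<bullet> i) * \<phi> x\<bar> \<le> L * (LINT x:\<Omega>|lebesgue. \<phi> x)"
    if t: "test_function \<Omega> \<phi>" and pos: "\<And>x. 0 \<le> \<phi> x" for \<phi>
  proof -
    obtain K where K: "compact K" "K \<subseteq> \<Omega>" "\<And>x. x \<notin> K \<Longrightarrow> \<phi> x = 0"
      using test_functionE[OF t] by metis
    obtain d where d: "d > 0" "(\<Union>x\<in>K. cball x d) \<subseteq> \<Omega>"
      using compact_subset_open_imp_cball_epsilon_subset[OF K(1) assms(1) K(2)] by metis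
    define h where "h n = d * inverse (real (Suc n))" for n
    have h: "0 < h n" "h n \<le> d" for n
      using d(1) by (auto simp: h_def field_simps)
    have "(\<lambda>n. d * inverse (real (Suc n))) \<longlonglongrightarrow> d * 0"
      by (intro tendsto_mult tendsto_const LIMSEQ_inverse_real_of_nat)
    then have h0: "h \<longlonglongrightarrow> 0" unfolding h_def[abs_def] by simp
    have lim: "(\<lambda>n. LINT x|lebesgue. ub x * ((\<phi> (x + h n *\<^sub>R i) - \<phi> x) / h n))
      \<longlonglongrightarrow> (LINT x|lebesgue. ub x * pd i \<phi> x)"
      by (rule difference_quotient_limit[OF test_function_C_on[OF t] K(1,3)
            borel_imp_lebesgue_measurable[OF ubm] ubb h0]) (use h(1) in \<open>auto simp: less_le\<close>)
    have est: "\<bar>LINT x|lebesgue. ub x * ((\<phi> (x + h n *\<^sub>R i) - \<phi> x) / h n)\<bar> \<le> L * (LINT x|lebesgue. \<phi> x)" for n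
    proof -
      have ts: "test_function UNIV (\<lambda>x. \<phi> (x + h n *\<^sub>R i))"
      proof (rule test_functionI[of _ "(\<lambda>x. x - h n *\<^sub>R i) ` K"])
        show "compact ((\<lambda>x. x - h n *\<^sub>R i) ` K)" using K(1) compact_translation_subtract by blast
        show "\<phi> (x + h n *\<^sub>R i) = 0" if "x \<notin> (\<lambda>x. x - h n *\<^sub>R i) ` K" for x
          using that by (intro K(3)) (force simp: image_iff)
        show "C_on k UNIV (\<lambda>x. \<phi> (x + h n *\<^sub>R i))" for k
          using C_on_affine[OF test_function_C_on[OF t], of k 1 "h n *\<^sub>R i"] by simp
      qed simp
      define ubs where "ubs x = ub (x - h n *\<^sub>R i)" for x
      have ubsm: "ubs \<in> borel_measurable borel" unfolding ubs_def[abs_def] using ubm by measurable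
      have ubsb: "\<bar>ubs x\<bar> \<le> B" for x by (simp add: ubs_def ubb)
      have i1: "integrable lebesgue (\<lambda>x. ub x * \<phi> (x + h n *\<^sub>R i))"
        by (rule test_function_integrable[OF ts borel_imp_lebesgue_measurable[OF ubm] ubb])
      have i2: "integrable lebesgue (\<lambda>x. ub x * \<phi> x)"
        by (rule test_function_integrable[OF t borel_imp_lebesgue_measurable[OF ubm] ubb])
      have i3: "integrable lebesgue (\<lambda>x. ubs x * \<phi> x)"
        by (rule test_function_integrable[OF t borel_imp_lebesgue_measurable[OF ubsm] ubsb])
      have m3: "(\<lambda>x. ubs x * \<phi> x) \<in> borel_measurable borel"
        using ubsm test_function_borel[OF t] by measurable
      have "(LINT x|lebesgue. ub x * ((\<phi> (x + h n *\<^sub>R i) - \<phi> x) / h n)) =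
         (LINT x|lebesgue. (ub x * \<phi> (x + h n *\<^sub>R i) - ub x * \<phi> x) / h n)"
        by (simp add: right_diff_distrib)
      also have "\<dots> = ((LINT x|lebesgue. ub x * \<phi> (x + h n *\<^sub>R i)) - (LINT x|lebesgue. ub x * \<phi> x)) / h n"
        using i1 i2 by simp
      also have "(LINT x|lebesgue. ub x * \<phi> (x + h n *\<^sub>R i)) = (LINT x|lebesgue. ubs x * \<phi> x)"
        using lebesgue_integral_shift[OF m3, of "h n *\<^sub>R i"] by (simp add: ubs_def)
      also have "((LINT x|lebesgue. ubs x * \<phi> x) - (LINT x|lebesgue. ub x * \<phi> x)) / h n =
         (LINT x|lebesgue. (ubs x * \<phi> x - ub x * \<phi> x) / h n)"
        using i2 i3 by simp
      also have "\<bar>\<dots>\<bar> \<le> (LINT x|lebesgue. L * \<phi> x)"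
      proof (rule integral_abs_bound[THEN order_trans], rule integral_mono)
        show "integrable lebesgue (\<lambda>x. \<bar>(ubs x * \<phi> x - ub x * \<phi> x) / h n\<bar>)"
          using i2 i3 by (intro integrable_abs integrable_divide_zero Bochner_Integration.integrable_diff)
        show "integrable lebesgue (\<lambda>x. L * \<phi> x)"
          using test_function_integrable1[OF t] by simp
        fix x
        show "\<bar>(ubs x * \<phi> x - ub x * \<phi> x) / h n\<bar> \<le> L * \<phi> x"
        proof (cases "x \<in> K")
          case True
          have "x - h n *\<^sub>R i \<in> cball x d" using h(1)[of n] h(2)[of n] i by (simp add: dist_norm)
          then have m: "x - h n *\<^sub>R i \<in> \<Omega>" "x \<in> \<Omega>" using d(2) True K(2) by blast+
          have "\<bar>ubs x - ub x\<bar> \<le> L * norm ((x - h n *\<^sub>R i) - x)"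
            using lip[OF m] unfolding ubs_def ub_def by (simp only: indicator_simps(1)[OF m(1)] indicator_simps(1)[OF m(2)] scaleR_one)
          also have "\<dots> = L * h n" using h(1)[of n] i by simp
          finally have "\<bar>ubs x - ub x\<bar> / h n \<le> L" using h(1)[of n] by (simp add: pos_divide_le_eq)
          then have "(\<bar>ubs x - ub x\<bar> / h n) * \<phi> x \<le> L * \<phi> x" using pos by (rule mult_right_mono)
          moreover have "\<bar>(ubs x * \<phi> x - ub x * \<phi> x) / h n\<bar> = (\<bar>ubs x - ub x\<bar> / h n) * \<phi> x"
            using h(1)[of n] pos[of x] by (simp add: abs_mult left_diff_distrib[symmetric])
          ultimately show ?thesis by simp
        qed (simp add: K(3))
      qed
      finally show ?thesis by simp
    qed
    have "\<bar>LINT x|lebesgue. ub x * pd i \<phi> x\<bar> \<le> L * (LINT x|lebesgue. \<phi> x)"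
      by (rule tendsto_upperbound[OF tendsto_rabs[OF lim]]) (use est in auto)
    moreover have "(LINT x:\<Omega>|lebesgue. \<phi> x) = (LINT x|lebesgue. \<phi> x)"
      by (rule set_integral_of_support(1)) (rule test_function_off(1)[OF t])
    moreover have "(LINT x:\<Omega>|lebesgue. u x * pd i \<phi> x) = (LINT x|lebesgue. ub x * pd i \<phi> x)"
      by (simp add: set_lebesgue_integral_def ub_def mult.assoc)
    ultimately show ?thesis using g t i by (simp add: has_weak_gradient_def)
  qed
  have lg: "locally_integrable \<Omega> (\<lambda>x. g x \<bullet> i)"
    using g by (auto simp: has_weak_gradient_def intro: locally_integrable_inner)
  have lc: "locally_integrable \<Omega> (\<lambda>x. L)" by (rule locally_integrable_continuous) simp
  have pm: "AE x in lebesgue. x \<in> \<Omega> \<longrightarrow> 0 \<le> L + s * (g x \<bullet> i)" if s: "s = 1 \<or> s = -1" for s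
  proof (rule AE_nonneg_of_test[OF assms(1)])
    show "locally_integrable \<Omega> (\<lambda>x. L + s * (g x \<bullet> i))"
      using locally_integrable_lincomb[OF lc lg, of 1 s] by simp
    fix \<phi> assume t: "test_function \<Omega> \<phi>" and pos: "\<And>x. 0 \<le> \<phi> x"
    have "(LINT x:\<Omega>|lebesgue. (L + s * (g x \<bullet> i)) * \<phi> x) =
        (LINT x:\<Omega>|lebesgue. L * \<phi> x) + (LINT x:\<Omega>|lebesgue. s * ((g x \<bullet> i) * \<phi> x))"
      using integrable_times_test[OF lc t] integrable_times_test[OF lg t]
      by (subst set_integral_add(2)[symmetric]) (auto simp: algebra_simps)
    also have "\<dots> = L * (LINT x:\<Omega>|lebesgue. \<phi> x) + s * (LINT x:\<Omega>|lebesgue. (g x \<bullet> i) * \<phi> x)"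
      by simp
    also have "\<dots> \<ge> 0" using key[OF t pos] s by (auto simp: abs_le_iff)
    finally show "0 \<le> (LINT x:\<Omega>|lebesgue. (L + s * (g x \<bullet> i)) * \<phi> x)" .
  qed
  have "AE x in lebesgue. x \<in> \<Omega> \<longrightarrow> 0 \<le> L + 1 * (g x \<bullet> i)" by (rule pm) simp
  moreover have "AE x in lebesgue. x \<in> \<Omega> \<longrightarrow> 0 \<le> L + (-1) * (g x \<bullet> i)" by (rule pm) simp
  ultimately show ?thesis by eventually_elim auto
qed

section \<open>Square integrable functions and adding a test function\<close>

lemma grad_inner: "i \<in> Basis \<Longrightarrow> grad f x \<bullet> i = pd i f x"
  unfolding grad_def by (rule inner_sum_left_Basis)

lemma norm_grad_power2: "(norm (grad f x))\<^sup>2 = (\<Sum>i\<in>Basis. (pd i f x)\<^sup>2)"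
  unfolding power2_norm_eq_inner
  by (subst euclidean_inner) (simp add: grad_inner power2_eq_square)

lemma inner_grad: "v \<bullet> grad f x = (\<Sum>i\<in>Basis. (v \<bullet> i) * pd i f x)"
  by (subst euclidean_inner) (simp add: grad_inner)

lemma grad_test_continuous:
  assumes "test_function \<Omega> \<phi>"
  shows "continuous_on S (grad \<phi>)"
  unfolding grad_def[abs_def]
  by (intro continuous_on_sum continuous_on_scaleR continuous_on_const
      continuous_on_subset[OF C_on_pd_vector_continuous[OF test_function_C_on[OF assms]]]) simp

lemma grad_test_measurable: "test_function \<Omega> \<phi> \<Longrightarrow> grad \<phi> \<in> borel_measurable lebesgue"
  by (rule measurable_completion) (simp add: borel_measurable_continuous_onI grad_test_continuous)

lemma grad_test_square_integrable:
  assumes "test_function \<Omega> \<phi>"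
  shows "integrable lebesgue (\<lambda>x. (norm (grad \<phi> x))\<^sup>2)"
  unfolding norm_grad_power2
proof (rule Bochner_Integration.integrable_sum)
  fix i :: 'a assume i: "i \<in> Basis"
  have t: "test_function \<Omega> (pd i \<phi>)" by (rule test_function_pd[OF assms i])
  obtain B where B: "B > 0" "\<And>x. \<bar>pd i \<phi> x\<bar> \<le> B"
    using test_function_bounded[OF t] by metis
  show "integrable lebesgue (\<lambda>x. (pd i \<phi> x)\<^sup>2)"
    unfolding power2_eq_square by (rule test_function_integrable[OF t test_function_measurable[OF t] B(2)])
qed

lemma test_square_integrable:
  assumes "test_function \<Omega> \<phi>"
  shows "integrable lebesgue (\<lambda>x. (\<phi> x)\<^sup>2)"
proof -
  obtain B where B: "B > 0" "\<And>x. \<bar>\<phi> x\<bar> \<le> B"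
    using test_function_bounded[OF assms] by metis
  show ?thesis
    unfolding power2_eq_square by (rule test_function_integrable[OF assms test_function_measurable[OF assms] B(2)])
qed

lemma set_integral_lebesgue_on:
  fixes f :: "'a::euclidean_space \<Rightarrow> 'b::euclidean_space"
  assumes "\<Omega> \<in> sets lebesgue"
  shows "(LINT x:\<Omega>|lebesgue. f x) = integral\<^sup>L (lebesgue_on \<Omega>) f"
  unfolding set_lebesgue_integral_def using assms by (subst integral_restrict_space) auto

lemma integrable_on_subset_measure:
  fixes f :: "'a::euclidean_space \<Rightarrow> 'b::euclidean_space"
  assumes "\<Omega> \<in> sets lebesgue" "integrable lebesgue f"
  shows "integrable (lebesgue_on \<Omega>) f"
  using assms integrable_mult_indicator by (subst integrable_restrict_space) auto

lemma L2_test: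
  assumes "\<Omega> \<in> sets lebesgue" "test_function \<Omega>' \<phi>"
  shows "\<phi> \<in> L2 \<Omega>" "grad \<phi> \<in> L2 \<Omega>"
  unfolding L2_def
  using integrable_on_subset_measure[OF assms(1) grad_test_square_integrable[OF assms(2)]]
    integrable_on_subset_measure[OF assms(1) test_square_integrable[OF assms(2)]]
    measurable_restrict_space1[OF grad_test_measurable[OF assms(2)]]
    measurable_restrict_space1[OF test_function_measurable[OF assms(2)]]
  by simp_all

lemma L2_add:
  fixes f h :: "'a::euclidean_space \<Rightarrow> 'b::euclidean_space"
  assumes "f \<in> L2 \<Omega>" "h \<in> L2 \<Omega>"
  shows "(\<lambda>x. f x + h x) \<in> L2 \<Omega>"
proof -
  have m: "f \<in> borel_measurable (lebesgue_on \<Omega>)" "h \<in> borel_measurable (lebesgue_on \<Omega>)"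
    and i: "integrable (lebesgue_on \<Omega>) (\<lambda>x. (norm (f x))\<^sup>2)" "integrable (lebesgue_on \<Omega>) (\<lambda>x. (norm (h x))\<^sup>2)"
    using assms by (auto simp: L2_def)
  have "integrable (lebesgue_on \<Omega>) (\<lambda>x. (norm (f x + h x))\<^sup>2)"
  proof (rule Bochner_Integration.integrable_bound)
    show "integrable (lebesgue_on \<Omega>) (\<lambda>x. 2 * (norm (f x))\<^sup>2 + 2 * (norm (h x))\<^sup>2)"
      using i by (intro Bochner_Integration.integrable_add integrable_mult_right)
    show "(\<lambda>x. (norm (f x + h x))\<^sup>2) \<in> borel_measurable (lebesgue_on \<Omega>)" using m by measurable
    show "AE x in lebesgue_on \<Omega>. norm ((norm (f x + h x))\<^sup>2) \<le> norm (2 * (norm (f x))\<^sup>2 + 2 * (norm (h x))\<^sup>2)"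
    proof (rule AE_I2)
      fix x
      have "(norm (f x + h x))\<^sup>2 \<le> (norm (f x) + norm (h x))\<^sup>2"
        by (intro power_mono norm_triangle_ineq) simp
      also have "\<dots> \<le> 2 * (norm (f x))\<^sup>2 + 2 * (norm (h x))\<^sup>2"
        using sum_squares_bound[of "norm (f x)" "norm (h x)"] by (simp add: power2_sum)
      finally show "norm ((norm (f x + h x))\<^sup>2) \<le> norm (2 * (norm (f x))\<^sup>2 + 2 * (norm (h x))\<^sup>2)" by simp
    qed
  qed
  moreover have "(\<lambda>x. f x + h x) \<in> borel_measurable (lebesgue_on \<Omega>)" using m by measurable
  ultimately show ?thesis by (simp add: L2_def)
qed

lemma L2_uminus: "f \<in> L2 \<Omega> \<Longrightarrow> (\<lambda>x. - f x) \<in> L2 \<Omega>"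
  by (auto simp: L2_def)

lemma L2_diff:
  fixes f h :: "'a::euclidean_space \<Rightarrow> 'b::euclidean_space"
  shows "f \<in> L2 \<Omega> \<Longrightarrow> h \<in> L2 \<Omega> \<Longrightarrow> (\<lambda>x. f x - h x) \<in> L2 \<Omega>"
  using L2_add[OF _ L2_uminus] by fastforce

lemma weak_gradient_measurable:
  assumes "open \<Omega>" "has_weak_gradient \<Omega> v g"
  shows "g \<in> borel_measurable (lebesgue_on \<Omega>)"
proof -
  have "\<Omega> \<inter> space lebesgue \<in> sets lebesgue" using assms(1) by simp
  then show ?thesis
    using locally_integrable_measurable[OF assms(1), of g] assms(2) borel_measurable_restrict_space_iff[of \<Omega> lebesgue g]
    by (simp add: has_weak_gradient_def)
qed

lemma weak_grad_L2:
  assumes "open \<Omega>" "v \<in> H1 \<Omega>"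
  shows "weak_grad \<Omega> v \<in> L2 \<Omega>"
proof -
  obtain g where g: "g \<in> L2 \<Omega>" "has_weak_gradient \<Omega> v g" using assms(2) by (auto simp: H1_def)
  have w: "has_weak_gradient \<Omega> v (weak_grad \<Omega> v)" by (rule weak_grad_has[OF assms(2)])
  have m: "weak_grad \<Omega> v \<in> borel_measurable (lebesgue_on \<Omega>)" by (rule weak_gradient_measurable[OF assms(1) w])
  have ae: "AE x in lebesgue_on \<Omega>. g x = weak_grad \<Omega> v x"
    using has_weak_gradient_unique[OF assms(1) g(2) w] assms(1) by (subst AE_restrict_space_iff) auto
  have "integrable (lebesgue_on \<Omega>) (\<lambda>x. (norm (weak_grad \<Omega> v x))\<^sup>2)"
  proof (rule integrable_cong_AE_imp)
    show "integrable (lebesgue_on \<Omega>) (\<lambda>x. (norm (g x))\<^sup>2)" using g(1) by (simp add: L2_def)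
    show "(\<lambda>x. (norm (weak_grad \<Omega> v x))\<^sup>2) \<in> borel_measurable (lebesgue_on \<Omega>)" using m by measurable
    show "AE x in lebesgue_on \<Omega>. (norm (g x))\<^sup>2 = (norm (weak_grad \<Omega> v x))\<^sup>2" using ae by eventually_elim simp
  qed
  with m show ?thesis by (simp add: L2_def)
qed

lemma integral_test_parts:
  assumes "test_function \<Omega> \<phi>" "test_function \<Omega>' \<psi>" "i \<in> Basis"
  shows "(LINT x|lebesgue. \<phi> x * pd i \<psi> x) = - (LINT x|lebesgue. pd i \<phi> x * \<psi> x)"
proof -
  have t: "test_function \<Omega> (\<lambda>x. \<phi> x * \<psi> x)"
    by (rule test_function_mult[OF assms(1) test_function_C_on[OF assms(2)]])
  obtain K where K: "compact K" "K \<subseteq> \<Omega>" "\<And>x. x \<notin> K \<Longrightarrow> \<phi> x * \<psi> x = 0"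
    using test_functionE[OF t] by metis
  have p1: "test_function \<Omega> (pd i \<phi>)" "test_function \<Omega>' (pd i \<psi>)"
    using test_function_pd assms by blast+
  have "0 = (LINT x|lebesgue. pd i (\<lambda>x. \<phi> x * \<psi> x) x)"
    by (rule integral_pd_eq_zero[symmetric, OF test_function_C_on[OF t] K(1,3)])
  also have "\<dots> = (LINT x|lebesgue. \<phi> x * pd i \<psi> x + pd i \<phi> x * \<psi> x)"
    by (simp only: pd_mult[OF assms(1,2)])
  also have "\<dots> = (LINT x|lebesgue. \<phi> x * pd i \<psi> x) + (LINT x|lebesgue. pd i \<phi> x * \<psi> x)"
  proof (rule Bochner_Integration.integral_add)
    obtain B where B: "\<And>x. \<bar>\<phi> x\<bar> \<le> B" using test_function_bounded[OF assms(1)] by metis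
    show "integrable lebesgue (\<lambda>x. \<phi> x * pd i \<psi> x)"
      by (rule test_function_integrable[OF p1(2) test_function_measurable[OF assms(1)] B])
    obtain B where B: "\<And>x. \<bar>pd i \<phi> x\<bar> \<le> B" using test_function_bounded[OF p1(1)] by metis
    show "integrable lebesgue (\<lambda>x. pd i \<phi> x * \<psi> x)"
      by (rule test_function_integrable[OF assms(2) test_function_measurable[OF p1(1)] B])
  qed
  finally show ?thesis by simp
qed

lemma has_weak_gradient_add_test:
  assumes "has_weak_gradient \<Omega> u g" "test_function \<Omega> \<theta>"
  shows "has_weak_gradient \<Omega> (\<lambda>x. u x + \<theta> x) (\<lambda>x. g x + grad \<theta> x)"
proof -
  have lu: "locally_integrable \<Omega> u" and lg: "locally_integrable \<Omega> g"
    using assms(1) by (auto simp: has_weak_gradient_def)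
  have lt: "locally_integrable \<Omega> \<theta>" "locally_integrable \<Omega> (grad \<theta>)"
    using test_function_continuous[OF assms(2)] grad_test_continuous[OF assms(2)]
    by (auto intro: locally_integrable_continuous)
  have "(LINT x:\<Omega>|lebesgue. (u x + \<theta> x) * pd i \<phi> x) = - (LINT x:\<Omega>|lebesgue. ((g x + grad \<theta> x) \<bullet> i) * \<phi> x)"
    if t: "test_function \<Omega> \<phi>" and i: "i \<in> Basis" for \<phi> i
  proof -
    have ti: "test_function \<Omega> (pd i \<phi>)" by (rule test_function_pd[OF t i])
    have "(LINT x:\<Omega>|lebesgue. (u x + \<theta> x) * pd i \<phi> x) =
        (LINT x:\<Omega>|lebesgue. u x * pd i \<phi> x) + (LINT x:\<Omega>|lebesgue. \<theta> x * pd i \<phi> x)"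
      unfolding distrib_right
      by (rule set_integral_add(2)[OF integrable_times_test[OF lu ti] integrable_times_test[OF lt(1) ti]])
    also have "(LINT x:\<Omega>|lebesgue. u x * pd i \<phi> x) = - (LINT x:\<Omega>|lebesgue. (g x \<bullet> i) * \<phi> x)"
      using has_weak_gradientD[OF assms(1) t i] by simp
    also have "(LINT x:\<Omega>|lebesgue. \<theta> x * pd i \<phi> x) = (LINT x|lebesgue. \<theta> x * pd i \<phi> x)"
      by (rule set_integral_of_support(1)) (simp add: test_function_off(1)[OF assms(2)])
    also have "\<dots> = - (LINT x|lebesgue. pd i \<theta> x * \<phi> x)"
      by (rule integral_test_parts[OF assms(2) t i])
    also have "(LINT x|lebesgue. pd i \<theta> x * \<phi> x) = (LINT x:\<Omega>|lebesgue. pd i \<theta> x * \<phi> x)"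
      by (rule set_integral_of_support(1)[symmetric]) (simp add: test_function_off(1)[OF t])
    also have "\<dots> = (LINT x:\<Omega>|lebesgue. (grad \<theta> x \<bullet> i) * \<phi> x)"
      by (simp only: grad_inner[OF i])
    also have "- (LINT x:\<Omega>|lebesgue. (g x \<bullet> i) * \<phi> x) + - (LINT x:\<Omega>|lebesgue. (grad \<theta> x \<bullet> i) * \<phi> x) =
       - (LINT x:\<Omega>|lebesgue. ((g x + grad \<theta> x) \<bullet> i) * \<phi> x)"
      unfolding inner_add_left distrib_right
      by (subst set_integral_add(2)[OF integrable_times_test[OF locally_integrable_inner[OF lg] t]
            integrable_times_test[OF locally_integrable_inner[OF lt(2)] t]]) simp
    finally show ?thesis .
  qed
  moreover have "locally_integrable \<Omega> (\<lambda>x. u x + \<theta> x)"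
    using locally_integrable_lincomb[OF lu lt(1), of 1 1] by simp
  moreover have "locally_integrable \<Omega> (\<lambda>x. g x + grad \<theta> x)"
    using locally_integrable_lincomb[OF lg lt(2), of 1 1] by simp
  ultimately show ?thesis by (simp add: has_weak_gradient_def)
qed

lemma grad_lincomb:
  assumes "test_function \<Omega> \<phi>" "test_function \<Omega> \<psi>"
  shows "grad (\<lambda>x. a * \<phi> x + b * \<psi> x) x = a *\<^sub>R grad \<phi> x + b *\<^sub>R grad \<psi> x"
  unfolding grad_def pd_lincomb[OF assms]
  by (simp add: scaleR_add_left sum.distrib scaleR_sum_right)

text \<open>The approximating test functions of \<open>u\<close>, shifted by \<open>\<theta>\<close>, approximate \<open>u + \<theta>\<close>: the errors are the same
functions up to a null set.\<close>

lemma H10_add_test: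
  assumes "open \<Omega>" and u: "u \<in> H10 \<Omega>" and t: "test_function \<Omega> \<theta>"
  shows "(\<lambda>x. u x + \<theta> x) \<in> H10 \<Omega>"
    and "AE x in lebesgue_on \<Omega>. weak_grad \<Omega> (\<lambda>x. u x + \<theta> x) x = weak_grad \<Omega> u x + grad \<theta> x"
proof -
  let ?v = "\<lambda>x. u x + \<theta> x"
  have ms: "\<Omega> \<in> sets lebesgue" using assms(1) by simp
  have uH1: "u \<in> H1 \<Omega>" using u by (simp add: H10_def)
  have gu: "has_weak_gradient \<Omega> u (weak_grad \<Omega> u)" by (rule weak_grad_has[OF uH1])
  have gv: "has_weak_gradient \<Omega> ?v (\<lambda>x. weak_grad \<Omega> u x + grad \<theta> x)"
    by (rule has_weak_gradient_add_test[OF gu t])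
  have "?v \<in> L2 \<Omega>" using uH1 by (intro L2_add L2_test[OF ms t]) (simp add: H1_def)
  moreover have "(\<lambda>x. weak_grad \<Omega> u x + grad \<theta> x) \<in> L2 \<Omega>"
    by (intro L2_add weak_grad_L2[OF assms(1) uH1] L2_test[OF ms t])
  ultimately have vH1: "?v \<in> H1 \<Omega>" using gv unfolding H1_def by blast
  have wv: "has_weak_gradient \<Omega> ?v (weak_grad \<Omega> ?v)" by (rule weak_grad_has[OF vH1])
  show ae: "AE x in lebesgue_on \<Omega>. weak_grad \<Omega> ?v x = weak_grad \<Omega> u x + grad \<theta> x"
    using has_weak_gradient_unique[OF assms(1) wv gv] assms(1) by (subst AE_restrict_space_iff) auto
  obtain \<phi> :: "nat \<Rightarrow> 'a \<Rightarrow> real" where \<phi>: "\<And>n. test_function \<Omega> (\<phi> n)"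
    "(\<lambda>n. (LINT x:\<Omega>|lebesgue. (\<phi> n x - u x)\<^sup>2) +
          (LINT x:\<Omega>|lebesgue. (norm (grad (\<phi> n) x - weak_grad \<Omega> u x))\<^sup>2)) \<longlonglongrightarrow> 0"
    using u unfolding H10_def by blast
  have tn: "test_function \<Omega> (\<lambda>x. \<phi> n x + \<theta> x)" for n
    using test_function_lincomb[OF \<phi>(1)[of n] t, of 1 1] by simp
  have "(LINT x:\<Omega>|lebesgue. (norm (grad (\<lambda>x. \<phi> n x + \<theta> x) x - weak_grad \<Omega> ?v x))\<^sup>2) =
      (LINT x:\<Omega>|lebesgue. (norm (grad (\<phi> n) x - weak_grad \<Omega> u x))\<^sup>2)" for n
    unfolding set_integral_lebesgue_on[OF ms]
  proof (rule integral_cong_AE)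
    have g: "grad (\<lambda>x. \<phi> n x + \<theta> x) x = grad (\<phi> n) x + grad \<theta> x" for x
      using grad_lincomb[OF \<phi>(1)[of n] t, of 1 1] by simp
    have m1: "grad (\<phi> n) \<in> borel_measurable (lebesgue_on \<Omega>)"
      "grad (\<lambda>x. \<phi> n x + \<theta> x) \<in> borel_measurable (lebesgue_on \<Omega>)"
      using grad_test_measurable[OF \<phi>(1)] grad_test_measurable[OF tn] measurable_restrict_space1 by blast+
    have m2: "weak_grad \<Omega> ?v \<in> borel_measurable (lebesgue_on \<Omega>)" "weak_grad \<Omega> u \<in> borel_measurable (lebesgue_on \<Omega>)"
      by (rule weak_gradient_measurable[OF assms(1) wv], rule weak_gradient_measurable[OF assms(1) gu])
    show "(\<lambda>x. (norm (grad (\<lambda>x. \<phi> n x + \<theta> x) x - weak_grad \<Omega> ?v x))\<^sup>2) \<in> borel_measurable (lebesgue_on \<Omega>)"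
      "(\<lambda>x. (norm (grad (\<phi> n) x - weak_grad \<Omega> u x))\<^sup>2) \<in> borel_measurable (lebesgue_on \<Omega>)"
      using m1 m2 by measurable
    show "AE x in lebesgue_on \<Omega>. (norm (grad (\<lambda>x. \<phi> n x + \<theta> x) x - weak_grad \<Omega> ?v x))\<^sup>2 =
        (norm (grad (\<phi> n) x - weak_grad \<Omega> u x))\<^sup>2"
      using ae by eventually_elim (simp add: g)
  qed
  with \<phi>(2) have lim: "(\<lambda>n. (LINT x:\<Omega>|lebesgue. ((\<phi> n x + \<theta> x) - (u x + \<theta> x))\<^sup>2) +
     (LINT x:\<Omega>|lebesgue. (norm (grad (\<lambda>x. \<phi> n x + \<theta> x) x - weak_grad \<Omega> ?v x))\<^sup>2)) \<longlonglongrightarrow> 0"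
    by simp
  show "?v \<in> H10 \<Omega>" unfolding H10_def
    by (rule CollectI, rule conjI[OF vH1], rule exI[of _ "\<lambda>n x. \<phi> n x + \<theta> x"], rule conjI[OF allI[OF tn] lim])
qed

text \<open>The weighted inequality \<open>\<bar>f h\<bar> \<le> f\<^sup>2 / (2 l) + l h\<^sup>2 / 2\<close> takes the place of the Cauchy-Schwarz inequality; the
weight \<open>l\<close> is chosen from the tolerance before \<open>n\<close>.\<close>

lemma L2_product_tendsto:
  fixes f :: "nat \<Rightarrow> 'a \<Rightarrow> real"
  assumes f: "\<And>n. f n \<in> borel_measurable M" "\<And>n. integrable M (\<lambda>x. (f n x)\<^sup>2)"
    and h: "h \<in> borel_measurable M" "integrable M (\<lambda>x. (h x)\<^sup>2)"
    and lim: "(\<lambda>n. integral\<^sup>L M (\<lambda>x. (f n x)\<^sup>2)) \<longlonglongrightarrow> 0"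
  shows "(\<lambda>n. integral\<^sup>L M (\<lambda>x. f n x * h x)) \<longlonglongrightarrow> 0"
proof (rule LIMSEQ_I)
  fix e :: real assume e: "e > 0"
  define C where "C = integral\<^sup>L M (\<lambda>x. (h x)\<^sup>2)"
  have C: "C \<ge> 0" unfolding C_def by (intro Bochner_Integration.integral_nonneg) simp
  define l where "l = e / (C + 1)"
  have l: "l > 0" using e C by (simp add: l_def)
  have "l * e > 0" using l e by simp
  from LIMSEQ_D[OF lim this]
  obtain N where N: "\<And>n. n \<ge> N \<Longrightarrow> \<bar>integral\<^sup>L M (\<lambda>x. (f n x)\<^sup>2)\<bar> < l * e" by auto
  have "\<bar>integral\<^sup>L M (\<lambda>x. f n x * h x)\<bar> < e" if n: "n \<ge> N" for n
  proof -
    have pw: "\<bar>f n x * h x\<bar> \<le> (f n x)\<^sup>2 / (2 * l) + l * (h x)\<^sup>2 / 2" for x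
    proof -
      have "2 * (l * (\<bar>f n x\<bar> * \<bar>h x\<bar>)) \<le> (f n x)\<^sup>2 + (l * h x)\<^sup>2"
        using sum_squares_bound[of "\<bar>f n x\<bar>" "l * \<bar>h x\<bar>"] by (simp add: power_mult_distrib mult_ac)
      then have "\<bar>f n x\<bar> * \<bar>h x\<bar> \<le> ((f n x)\<^sup>2 + (l * h x)\<^sup>2) / (2 * l)"
        using l by (simp add: pos_le_divide_eq mult_ac)
      also have "\<dots> = (f n x)\<^sup>2 / (2 * l) + l * (h x)\<^sup>2 / 2"
        using l by (simp add: add_divide_distrib power2_eq_square)
      finally show ?thesis by (simp add: abs_mult)
    qed
    have ib: "integrable M (\<lambda>x. (f n x)\<^sup>2 / (2 * l) + l * (h x)\<^sup>2 / 2)"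
      using f(2) h(2) by (intro Bochner_Integration.integrable_add integrable_divide_zero integrable_mult_right) auto
    have ifh: "integrable M (\<lambda>x. f n x * h x)"
      by (rule Bochner_Integration.integrable_bound[OF ib]) (use f(1) h(1) pw in \<open>auto intro!: AE_I2 order_trans[OF pw]\<close>)
    have "\<bar>integral\<^sup>L M (\<lambda>x. f n x * h x)\<bar> \<le> integral\<^sup>L M (\<lambda>x. \<bar>f n x * h x\<bar>)"
      by (rule integral_abs_bound)
    also have "\<dots> \<le> integral\<^sup>L M (\<lambda>x. (f n x)\<^sup>2 / (2 * l) + l * (h x)\<^sup>2 / 2)"
      by (rule integral_mono[OF integrable_abs[OF ifh] ib pw])
    also have "\<dots> = integral\<^sup>L M (\<lambda>x. (f n x)\<^sup>2) / (2 * l) + l * C / 2"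
      unfolding C_def using f(2) h(2) by (subst Bochner_Integration.integral_add) auto
    also have "\<dots> < (l * e) / (2 * l) + e / 2"
    proof (rule add_less_le_mono)
      show "integral\<^sup>L M (\<lambda>x. (f n x)\<^sup>2) / (2 * l) < (l * e) / (2 * l)"
        using N[OF n] l by (intro divide_strict_right_mono) auto
      show "l * C / 2 \<le> e / 2" using C e by (simp add: l_def field_simps)
    qed
    also have "\<dots> = e" using l by (simp add: field_simps)
    finally show ?thesis .
  qed
  then show "\<exists>N. \<forall>n\<ge>N. norm (integral\<^sup>L M (\<lambda>x. f n x * h x) - 0) < e" by auto
qed

text \<open>A weak form of vanishing boundary values: the integration by parts holds against test functions \<open>\<psi>\<close> of
the whole space, since it does so for the approximating test functions of \<open>\<Omega>\<close>.\<close>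

lemma H10_zero_extension:
  assumes "open \<Omega>" and u: "u \<in> H10 \<Omega>" and t: "test_function UNIV \<psi>" and i: "i \<in> Basis"
  shows "(LINT x:\<Omega>|lebesgue. u x * pd i \<psi> x) = - (LINT x:\<Omega>|lebesgue. (weak_grad \<Omega> u x \<bullet> i) * \<psi> x)"
proof -
  let ?M = "lebesgue_on \<Omega>" and ?g = "weak_grad \<Omega> u"
  have ms: "\<Omega> \<in> sets lebesgue" using assms(1) by simp
  have uH1: "u \<in> H1 \<Omega>" using u by (simp add: H10_def)
  have uL2: "u \<in> L2 \<Omega>" using uH1 by (simp add: H1_def)
  have gL2: "?g \<in> L2 \<Omega>" by (rule weak_grad_L2[OF assms(1) uH1])
  obtain \<phi> :: "nat \<Rightarrow> 'a \<Rightarrow> real" where \<phi>: "\<And>n. test_function \<Omega> (\<phi> n)"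
    and lim: "(\<lambda>n. (LINT x:\<Omega>|lebesgue. (\<phi> n x - u x)\<^sup>2) +
          (LINT x:\<Omega>|lebesgue. (norm (grad (\<phi> n) x - ?g x))\<^sup>2)) \<longlonglongrightarrow> 0"
    using u unfolding H10_def by blast
  define A where "A n = integral\<^sup>L ?M (\<lambda>x. (\<phi> n x - u x)\<^sup>2)" for n
  define B where "B n = integral\<^sup>L ?M (\<lambda>x. (norm (grad (\<phi> n) x - ?g x))\<^sup>2)" for n
  have AB: "A n \<ge> 0" "B n \<ge> 0" for n
    unfolding A_def B_def by (intro Bochner_Integration.integral_nonneg; simp)+
  have limAB: "(\<lambda>n. A n + B n) \<longlonglongrightarrow> 0" using lim unfolding set_integral_lebesgue_on[OF ms] A_def B_def .
  have limA: "A \<longlonglongrightarrow> 0"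
    by (rule tendsto_sandwich[OF _ _ tendsto_const limAB]) (use AB in auto)
  have limB: "B \<longlonglongrightarrow> 0"
    by (rule tendsto_sandwich[OF _ _ tendsto_const limAB]) (use AB in auto)
  have ti: "test_function UNIV (pd i \<psi>)" by (rule test_function_pd[OF t i])
  have d1: "(\<lambda>x. \<phi> n x - u x) \<in> L2 \<Omega>" for n by (intro L2_diff uL2 L2_test[OF ms \<phi>])
  have d2: "(\<lambda>x. grad (\<phi> n) x - ?g x) \<in> L2 \<Omega>" for n by (intro L2_diff gL2 L2_test[OF ms \<phi>])
  have \<psi>2: "\<psi> \<in> L2 \<Omega>" "pd i \<psi> \<in> L2 \<Omega>" by (rule L2_test[OF ms t], rule L2_test[OF ms ti])
  have l1: "(\<lambda>n. integral\<^sup>L ?M (\<lambda>x. (\<phi> n x - u x) * pd i \<psi> x)) \<longlonglongrightarrow> 0"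
    by (rule L2_product_tendsto) (use d1 \<psi>2(2) limA in \<open>auto simp: L2_def A_def[abs_def]\<close>)
  have q: "((grad (\<phi> n) x - ?g x) \<bullet> i)\<^sup>2 \<le> (norm (grad (\<phi> n) x - ?g x))\<^sup>2" for n x
    using Basis_le_norm[OF i, of "grad (\<phi> n) x - ?g x"] by (simp add: abs_le_square_iff[symmetric])
  have m2: "(\<lambda>x. (grad (\<phi> n) x - ?g x) \<bullet> i) \<in> borel_measurable ?M" for n
    using d2[of n] by (intro borel_measurable_inner borel_measurable_const) (simp add: L2_def)
  have i2: "integrable ?M (\<lambda>x. ((grad (\<phi> n) x - ?g x) \<bullet> i)\<^sup>2)" for n
  proof (rule Bochner_Integration.integrable_bound)
    show "integrable ?M (\<lambda>x. (norm (grad (\<phi> n) x - ?g x))\<^sup>2)" using d2[of n] by (simp add: L2_def)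
    show "(\<lambda>x. ((grad (\<phi> n) x - ?g x) \<bullet> i)\<^sup>2) \<in> borel_measurable ?M" using m2 by measurable
    show "AE x in ?M. norm (((grad (\<phi> n) x - ?g x) \<bullet> i)\<^sup>2) \<le> norm ((norm (grad (\<phi> n) x - ?g x))\<^sup>2)"
      using q by (intro AE_I2) simp
  qed
  have l2: "(\<lambda>n. integral\<^sup>L ?M (\<lambda>x. ((grad (\<phi> n) x - ?g x) \<bullet> i) * \<psi> x)) \<longlonglongrightarrow> 0"
  proof (rule L2_product_tendsto[OF m2 i2])
    have "0 \<le> integral\<^sup>L ?M (\<lambda>x. ((grad (\<phi> n) x - ?g x) \<bullet> i)\<^sup>2)" for n
      by (intro Bochner_Integration.integral_nonneg) simp
    moreover have "integral\<^sup>L ?M (\<lambda>x. ((grad (\<phi> n) x - ?g x) \<bullet> i)\<^sup>2) \<le> B n" for n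
      unfolding B_def by (rule integral_mono[OF i2 _ q]) (use d2[of n] in \<open>simp add: L2_def\<close>)
    ultimately show "(\<lambda>n. integral\<^sup>L ?M (\<lambda>x. ((grad (\<phi> n) x - ?g x) \<bullet> i)\<^sup>2)) \<longlonglongrightarrow> 0"
      by (intro tendsto_sandwich[OF _ _ tendsto_const limB]) auto
  qed (use \<psi>2(1) in \<open>simp_all add: L2_def\<close>)
  have bt: "integrable ?M (\<lambda>x. f x * h x)" if "f \<in> L2 \<Omega>" "h \<in> L2 \<Omega>" for f h :: "'a \<Rightarrow> real"
  proof (rule Bochner_Integration.integrable_bound)
    show "integrable ?M (\<lambda>x. (f x)\<^sup>2 + (h x)\<^sup>2)"
      using that by (intro Bochner_Integration.integrable_add) (auto simp: L2_def)
    show "(\<lambda>x. f x * h x) \<in> borel_measurable ?M"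
      using that by (intro borel_measurable_times) (auto simp: L2_def)
    show "AE x in ?M. norm (f x * h x) \<le> norm ((f x)\<^sup>2 + (h x)\<^sup>2)"
    proof (rule AE_I2)
      fix x
      have "2 * (\<bar>f x\<bar> * \<bar>h x\<bar>) \<le> (f x)\<^sup>2 + (h x)\<^sup>2" "0 \<le> \<bar>f x\<bar> * \<bar>h x\<bar>"
        using sum_squares_bound[of "\<bar>f x\<bar>" "\<bar>h x\<bar>"] by (simp_all add: mult.assoc)
      then have "\<bar>f x\<bar> * \<bar>h x\<bar> \<le> (f x)\<^sup>2 + (h x)\<^sup>2" by linarith
      then show "norm (f x * h x) \<le> norm ((f x)\<^sup>2 + (h x)\<^sup>2)" by (simp add: abs_mult)
    qed
  qed
  have giL2: "(\<lambda>x. ?g x \<bullet> i) \<in> L2 \<Omega>"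
  proof -
    have m: "(\<lambda>x. ?g x \<bullet> i) \<in> borel_measurable ?M"
      using gL2 by (intro borel_measurable_inner borel_measurable_const) (simp add: L2_def)
    have "integrable ?M (\<lambda>x. (?g x \<bullet> i)\<^sup>2)"
    proof (rule Bochner_Integration.integrable_bound)
      show "integrable ?M (\<lambda>x. (norm (?g x))\<^sup>2)" using gL2 by (simp add: L2_def)
      show "(\<lambda>x. (?g x \<bullet> i)\<^sup>2) \<in> borel_measurable ?M" using m by measurable
      show "AE x in ?M. norm ((?g x \<bullet> i)\<^sup>2) \<le> norm ((norm (?g x))\<^sup>2)"
        using Basis_le_norm[OF i] by (intro AE_I2) (simp add: abs_le_square_iff[symmetric])
    qed
    with m show ?thesis by (simp add: L2_def)
  qed
  have e1: "integral\<^sup>L ?M (\<lambda>x. (\<phi> n x - u x) * pd i \<psi> x) =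
      integral\<^sup>L ?M (\<lambda>x. \<phi> n x * pd i \<psi> x) - integral\<^sup>L ?M (\<lambda>x. u x * pd i \<psi> x)" for n
    unfolding left_diff_distrib
    by (rule Bochner_Integration.integral_diff[OF bt[OF L2_test(1)[OF ms \<phi>] \<psi>2(2)] bt[OF uL2 \<psi>2(2)]])
  have e2: "integral\<^sup>L ?M (\<lambda>x. ((grad (\<phi> n) x - ?g x) \<bullet> i) * \<psi> x) =
      integral\<^sup>L ?M (\<lambda>x. pd i (\<phi> n) x * \<psi> x) - integral\<^sup>L ?M (\<lambda>x. (?g x \<bullet> i) * \<psi> x)" for n
    unfolding inner_diff_left left_diff_distrib grad_inner[OF i]
    by (rule Bochner_Integration.integral_diff[OF bt[OF L2_test(1)[OF ms test_function_pd[OF \<phi> i]] \<psi>2(1)] bt[OF giL2 \<psi>2(1)]])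
  have e3: "integral\<^sup>L ?M (\<lambda>x. \<phi> n x * pd i \<psi> x) = - integral\<^sup>L ?M (\<lambda>x. pd i (\<phi> n) x * \<psi> x)" for n
  proof -
    have "(LINT x:\<Omega>|lebesgue. \<phi> n x * pd i \<psi> x) = (LINT x|lebesgue. \<phi> n x * pd i \<psi> x)"
      by (rule set_integral_of_support(1)) (simp add: test_function_off(1)[OF \<phi>])
    moreover have "(LINT x:\<Omega>|lebesgue. pd i (\<phi> n) x * \<psi> x) = (LINT x|lebesgue. pd i (\<phi> n) x * \<psi> x)"
      by (rule set_integral_of_support(1)) (simp add: test_function_off(2)[OF \<phi>])
    ultimately show ?thesis
      using integral_test_parts[OF \<phi> t i, of n] by (simp add: set_integral_lebesgue_on[OF ms])
  qed
  have "(\<lambda>n. integral\<^sup>L ?M (\<lambda>x. (\<phi> n x - u x) * pd i \<psi> x) + integral\<^sup>L ?M (\<lambda>x. ((grad (\<phi> n) x - ?g x) \<bullet> i) * \<psi> x)) \<longlonglongrightarrow> 0 + 0"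
    by (rule tendsto_add[OF l1 l2])
  then have "(\<lambda>n. - integral\<^sup>L ?M (\<lambda>x. u x * pd i \<psi> x) - integral\<^sup>L ?M (\<lambda>x. (?g x \<bullet> i) * \<psi> x)) \<longlonglongrightarrow> 0"
    unfolding e1 e2 e3 by simp
  then have "- integral\<^sup>L ?M (\<lambda>x. u x * pd i \<psi> x) - integral\<^sup>L ?M (\<lambda>x. (?g x \<bullet> i) * \<psi> x) = 0"
    unfolding LIMSEQ_const_iff .
  then show ?thesis unfolding set_integral_lebesgue_on[OF ms] by simp
qed

section \<open>Integration by parts\<close>

lemma set_integral_sum_finite:
  fixes f :: "'b \<Rightarrow> 'a::euclidean_space \<Rightarrow> real"
  assumes "\<And>i. i \<in> I \<Longrightarrow> set_integrable lebesgue \<Omega> (f i)"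
  shows "(LINT x:\<Omega>|lebesgue. (\<Sum>i\<in>I. f i x)) = (\<Sum>i\<in>I. LINT x:\<Omega>|lebesgue. f i x)"
    and "set_integrable lebesgue \<Omega> (\<lambda>x. \<Sum>i\<in>I. f i x)"
  using assms unfolding set_lebesgue_integral_def set_integrable_def scaleR_sum_right
  by (auto intro: Bochner_Integration.integral_sum Bochner_Integration.integrable_sum)

lemma weak_gradient_laplacian:
  assumes "has_weak_gradient \<Omega> u g" "test_function \<Omega> \<phi>"
  shows "(LINT x:\<Omega>|lebesgue. g x \<bullet> grad \<phi> x) = - (LINT x:\<Omega>|lebesgue. u x * laplacian \<phi> x)"
    and "set_integrable lebesgue \<Omega> (\<lambda>x. u x * laplacian \<phi> x)"
    and "set_integrable lebesgue \<Omega> (\<lambda>x. g x \<bullet> grad \<phi> x)"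
proof -
  have lu: "locally_integrable \<Omega> u" and lg: "locally_integrable \<Omega> g"
    using assms(1) by (auto simp: has_weak_gradient_def)
  have ti: "test_function \<Omega> (pd i \<phi>)" if "i \<in> Basis" for i by (rule test_function_pd[OF assms(2) that])
  have i1: "set_integrable lebesgue \<Omega> (\<lambda>x. (g x \<bullet> i) * pd i \<phi> x)" if "i \<in> Basis" for i
    by (rule integrable_times_test[OF locally_integrable_inner[OF lg] ti[OF that]])
  have i2: "set_integrable lebesgue \<Omega> (\<lambda>x. u x * pd i (pd i \<phi>) x)" if "i \<in> Basis" for i
    by (rule integrable_times_test[OF lu test_function_pd[OF ti[OF that] that]])
  have "(LINT x:\<Omega>|lebesgue. g x \<bullet> grad \<phi> x) = (\<Sum>i\<in>Basis. LINT x:\<Omega>|lebesgue. (g x \<bullet> i) * pd i \<phi> x)"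
    unfolding inner_grad by (rule set_integral_sum_finite(1)[OF i1])
  also have "\<dots> = (\<Sum>i\<in>Basis. - (LINT x:\<Omega>|lebesgue. u x * pd i (pd i \<phi>) x))"
    by (rule sum.cong[OF refl]) (rule has_weak_gradientD[OF assms(1) ti])
  also have "\<dots> = - (LINT x:\<Omega>|lebesgue. u x * laplacian \<phi> x)"
    unfolding laplacian_def sum_distrib_left sum_negf
    by (subst set_integral_sum_finite(1), rule i2, assumption, rule refl)
  finally show "(LINT x:\<Omega>|lebesgue. g x \<bullet> grad \<phi> x) = - (LINT x:\<Omega>|lebesgue. u x * laplacian \<phi> x)" .
  show "set_integrable lebesgue \<Omega> (\<lambda>x. u x * laplacian \<phi> x)"
    unfolding laplacian_def sum_distrib_left by (rule set_integral_sum_finite(2)[OF i2])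
  show "set_integrable lebesgue \<Omega> (\<lambda>x. g x \<bullet> grad \<phi> x)"
    unfolding inner_grad by (rule set_integral_sum_finite(2)[OF i1])
qed

text \<open>The field \<open>u \<nabla>\<psi> - \<psi> \<nabla>u\<close>, extended by zero, is continuously differentiable with compact support, so its
divergence has integral zero.\<close>

lemma green_test:
  assumes U: "open U" and u: "C_on 2 U u" and t: "test_function U \<psi>"
  shows "(LINT x:U|lebesgue. u x * laplacian \<psi> x) = (LINT x:U|lebesgue. \<psi> x * laplacian u x)"
proof -
  obtain K where K: "compact K" "K \<subseteq> U" "\<And>x. x \<notin> K \<Longrightarrow> \<psi> x = 0" "\<And>e x. x \<notin> K \<Longrightarrow> pd e \<psi> x = 0"
    using test_functionE[OF t] by metis
  have u2: "C_on (Suc (Suc 0)) U u" using u by (simp only: numeral_2_eq_2)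
  have u1: "C_on (Suc 0) U u" by (rule C_on_SucD[OF u2])
  have du: "C_on (Suc 0) U (pd i u)" "C_on 0 U (pd i (pd i u))" if "i \<in> Basis" for i
    using C_on_Suc_pd[OF u2 that] C_on_Suc_pd[OF C_on_Suc_pd[OF u2 that] that] by blast+
  have lu: "locally_integrable U u" by (rule locally_integrable_continuous[OF C_on_imp_continuous_on[OF u1]])
  have ldu: "locally_integrable U (pd i (pd i u))" if "i \<in> Basis" for i
    by (rule locally_integrable_continuous[OF C_on_imp_continuous_on[OF du(2)[OF that]]])
  have ti: "test_function U (pd i \<psi>)" if "i \<in> Basis" for i by (rule test_function_pd[OF t that])
  have i1: "set_integrable lebesgue U (\<lambda>x. u x * pd i (pd i \<psi>) x)" if "i \<in> Basis" for i
    by (rule integrable_times_test[OF lu test_function_pd[OF ti[OF that] that]])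
  have i2: "set_integrable lebesgue U (\<lambda>x. \<psi> x * pd i (pd i u) x)" if "i \<in> Basis" for i
    using integrable_times_test[OF ldu[OF that] t] by (simp only: mult.commute)
  have eq: "(LINT x:U|lebesgue. u x * pd i (pd i \<psi>) x) = (LINT x:U|lebesgue. \<psi> x * pd i (pd i u) x)"
    if i: "i \<in> Basis" for i
  proof -
    define P where "P x = (if x \<in> U then u x * pd i \<psi> x - \<psi> x * pd i u x else 0)" for x
    have PK: "P x = 0" if "x \<notin> K" for x unfolding P_def using K(3,4)[OF that] by simp
    have CU: "C_on (Suc 0) U P"
    proof -
      have "C_on (Suc 0) U (\<lambda>x. u x * pd i \<psi> x - \<psi> x * pd i u x)"
        by (intro C_on_diff[OF U] C_on_mult[OF U] u1 du(1)[OF i]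
            C_on_subset[OF test_function_C_on[OF ti[OF i]] subset_UNIV]
            C_on_subset[OF test_function_C_on[OF t] subset_UNIV])
      moreover have "C_on (Suc 0) U P \<longleftrightarrow> C_on (Suc 0) U (\<lambda>x. u x * pd i \<psi> x - \<psi> x * pd i u x)"
        by (rule C_on_cong_open[OF U]) (simp add: P_def)
      ultimately show ?thesis by blast
    qed
    have C: "C_on 1 UNIV P"
      using C_on_extend_by_zero[OF U CU compact_imp_closed[OF K(1)] K(2) PK] by simp
    have pdP: "pd i P x = indicator U x *\<^sub>R (u x * pd i (pd i \<psi>) x - \<psi> x * pd i (pd i u) x)" for x
    proof (cases "x \<in> U")
      case True
      have "pd i P x = pd i (\<lambda>x. u x * pd i \<psi> x - \<psi> x * pd i u x) x"
        by (rule pd_cong_open[OF U True]) (simp add: P_def)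
      also have "\<dots> = (u x * pd i (pd i \<psi>) x + pd i u x * pd i \<psi> x)
          - (\<psi> x * pd i (pd i u) x + pd i \<psi> x * pd i u x)"
        by (rule pd_eqI[where f'="\<lambda>e. (u x * pd e (pd i \<psi>) x + pd e u x * pd i \<psi> x)
          - (\<psi> x * pd e (pd i u) x + pd e \<psi> x * pd i u x)"])
          (intro has_derivative_diff has_derivative_mult C_on_Suc_derivative[OF u1 True]
            C_on_Suc_derivative[OF du(1)[OF i] True] test_function_derivative[OF t]
            test_function_derivative[OF ti[OF i]])
      finally show ?thesis using True by simp
    next
      case False
      then have "x \<notin> K" using K(2) by blast
      then show ?thesis
        using pd_zero_off_closed[of K P x i] compact_imp_closed[OF K(1)] PK False by simp
    qed
    have "0 = (LINT x:U|lebesgue. u x * pd i (pd i \<psi>) x - \<psi> x * pd i (pd i u) x)"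
      using integral_pd_eq_zero[OF C K(1) PK, of i] unfolding pdP set_lebesgue_integral_def by simp
    also have "\<dots> = (LINT x:U|lebesgue. u x * pd i (pd i \<psi>) x) - (LINT x:U|lebesgue. \<psi> x * pd i (pd i u) x)"
      by (rule set_integral_diff(2)[OF i1[OF i] i2[OF i]])
    finally show ?thesis by simp
  qed
  show ?thesis
    unfolding laplacian_def sum_distrib_left
    by (subst set_integral_sum_finite(1), rule i1, assumption,
        subst set_integral_sum_finite(1), rule i2, assumption, rule sum.cong[OF refl eq])
qed

lemma integral_laplacian_test:
  assumes t: "test_function \<Omega> \<phi>"
  shows "(LINT x|lebesgue. laplacian \<phi> x) = 0" "integrable lebesgue (laplacian \<phi>)"
proof -
  have tU: "test_function UNIV \<phi>" by (rule test_function_mono[OF t]) simp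
  have "(LINT x:UNIV|lebesgue. 1 * laplacian \<phi> x) = (LINT x:UNIV|lebesgue. \<phi> x * laplacian (\<lambda>_. 1) x)"
    by (rule green_test[OF open_UNIV C_on_const[OF open_UNIV] tU])
  moreover have "laplacian (\<lambda>_::'a. 1) x = 0" for x by (simp add: laplacian_def)
  ultimately show "(LINT x|lebesgue. laplacian \<phi> x) = 0" by (simp add: set_lebesgue_integral_def)
  show "integrable lebesgue (laplacian \<phi>)"
    unfolding laplacian_def[abs_def]
    by (intro Bochner_Integration.integrable_sum test_function_integrable1[OF test_function_pd[OF test_function_pd[OF t]]])
qed

section \<open>Boundary values of Lipschitz functions in \<open>H10\<close>\<close>

lemma test_function_affine:
  assumes "test_function UNIV \<phi>" "c \<noteq> 0"
  shows "test_function UNIV (\<lambda>x. \<phi> (c *\<^sub>R x + a))"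
proof -
  obtain K where K: "compact K" "\<And>x. x \<notin> K \<Longrightarrow> \<phi> x = 0"
    using test_functionE[OF assms(1)] by metis
  let ?h = "\<lambda>y. inverse c *\<^sub>R (y - a)"
  show ?thesis
  proof (rule test_functionI[of _ "?h ` K"])
    show "C_on k UNIV (\<lambda>x. \<phi> (c *\<^sub>R x + a))" for k
      by (rule C_on_affine[OF test_function_C_on[OF assms(1)]])
    show "compact (?h ` K)"
      by (intro compact_continuous_image K(1) continuous_intros)
    show "\<phi> (c *\<^sub>R x + a) = 0" if "x \<notin> ?h ` K" for x
    proof (rule K(2), rule notI)
      assume "c *\<^sub>R x + a \<in> K"
      then have "?h (c *\<^sub>R x + a) \<in> ?h ` K" by (rule imageI)
      moreover have "?h (c *\<^sub>R x + a) = x" using assms(2) by simp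
      ultimately show False using that by simp
    qed
  qed simp
qed

text \<open>For a test function \<open>\<phi>\<close>, the function \<open>s \<mapsto> \<integral> ub x \<phi>(x - s y) dx\<close> has as derivative an integral of \<open>\<phi>(x - s y)\<close>
against the bounded weak gradient of the zero extension. The mean value theorem bounds the increments
of \<open>ub\<close> tested with \<open>\<phi>\<close>, and the fundamental lemma makes the bound pointwise.\<close>

lemma H10_zero_extension_lipschitz:
  fixes L B :: real and \<Omega> :: "'a::euclidean_space set" and y :: 'a
  assumes "open \<Omega>" and u: "u \<in> H10 \<Omega>"
    and ub: "ub = (\<lambda>x. indicator \<Omega> x *\<^sub>R u x)" "ub \<in> borel_measurable borel" "\<And>x. \<bar>ub x\<bar> \<le> B"
    and g: "\<And>i. i \<in> Basis \<Longrightarrow> AE x in lebesgue. x \<in> \<Omega> \<longrightarrow> \<bar>weak_grad \<Omega> u x \<bullet> i\<bar> \<le> L"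
    and L: "L \<ge> 0"
  shows "AE x in lebesgue. \<bar>ub (x + y) - ub x\<bar> \<le> DIM('a) * L * norm y"
proof -
  let ?g = "weak_grad \<Omega> u"
  define C where "C = DIM('a) * L * norm y"
  have uH1: "u \<in> H1 \<Omega>" using u by (simp add: H10_def)
  have lg: "locally_integrable \<Omega> (\<lambda>x. ?g x \<bullet> i)" for i
    using weak_grad_has[OF uH1] by (auto simp: has_weak_gradient_def intro: locally_integrable_inner)
  have gL2: "?g \<in> L2 \<Omega>" by (rule weak_grad_L2[OF assms(1) uH1])
  have mg: "(\<lambda>x. indicator \<Omega> x *\<^sub>R (?g x \<bullet> i)) \<in> borel_measurable lebesgue" for i
    by (rule locally_integrable_measurable[OF assms(1) lg])
  have lm: "ub \<in> borel_measurable lebesgue" by (rule borel_imp_lebesgue_measurable[OF ub(2)])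
  have key: "\<bar>LINT x|lebesgue. (ub (x + y) - ub x) * \<phi> x\<bar> \<le> C * (LINT x|lebesgue. \<phi> x)"
    if t: "test_function UNIV \<phi>" and pos: "\<And>x. 0 \<le> \<phi> x" for \<phi>
  proof -
    define F where "F s = (LINT x|lebesgue. ub x * \<phi> (x - s *\<^sub>R y))" for s
    define f where "f s x = \<phi> (x - s *\<^sub>R y)" for s x
    have ft: "test_function UNIV (f s)" for s
      using test_function_affine[OF t, of 1 "- (s *\<^sub>R y)"] by (simp add: f_def[abs_def])
    have fint: "(LINT x|lebesgue. f s x) = (LINT x|lebesgue. \<phi> x)" for s
      using lebesgue_integral_shift[OF test_function_borel[OF t], of "- (s *\<^sub>R y)"] by (simp add: f_def)
    define D where "D s = (LINT x|lebesgue. ub x * pd (- y) (f s) x)" for s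
    have der: "(F has_real_derivative D s) (at s)" for s
    proof -
      obtain K where K: "compact K" "\<And>x. x \<notin> K \<Longrightarrow> f s x = 0"
        using test_functionE[OF ft[of s]] by metis
      have "(\<lambda>n. (F (s + h n) - F s) / h n) \<longlonglongrightarrow> D s" if h: "\<And>n. h n \<noteq> 0" "h \<longlonglongrightarrow> 0" for h
      proof -
        have "(\<lambda>n. LINT x|lebesgue. ub x * ((f s (x + h n *\<^sub>R (- y)) - f s x) / h n)) \<longlonglongrightarrow> D s"
          unfolding D_def by (rule difference_quotient_limit[OF test_function_C_on[OF ft] K lm ub(3) h(2,1)])
        moreover have "(LINT x|lebesgue. ub x * ((f s (x + h n *\<^sub>R (- y)) - f s x) / h n)) = (F (s + h n) - F s) / h n" for n
        proof -
          have e: "f s (x + h n *\<^sub>R (- y)) = f (s + h n) x" for x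
            by (simp add: f_def algebra_simps)
          have "ub x * ((f (s + h n) x - f s x) / h n) = (ub x * f (s + h n) x - ub x * f s x) / h n" for x
            by (simp add: right_diff_distrib)
          then have "(LINT x|lebesgue. ub x * ((f (s + h n) x - f s x) / h n)) =
             (LINT x|lebesgue. (ub x * f (s + h n) x - ub x * f s x) / h n)" by presburger
          also have "\<dots> = ((LINT x|lebesgue. ub x * f (s + h n) x) - (LINT x|lebesgue. ub x * f s x)) / h n"
            using test_function_integrable[OF ft lm ub(3)] by simp
          finally show ?thesis unfolding e by (simp add: F_def f_def)
        qed
        ultimately show ?thesis by (simp only:)
      qed
      then have "((\<lambda>h. (F (s + h) - F s) / h) \<longlongrightarrow> D s) (at 0)"
        unfolding tendsto_at_iff_sequentially comp_def by auto
      then show ?thesis by (simp add: DERIV_def)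
    qed
    have Dle: "\<bar>D s\<bar> \<le> C * (LINT x|lebesgue. \<phi> x)" for s
    proof -
      have l: "linear (frechet_derivative (f s) (at x))" for x
        by (rule has_derivative_linear[OF test_function_derivative[OF ft]])
      have "pd (- y) (f s) x = (\<Sum>i\<in>Basis. (- (y \<bullet> i)) * pd i (f s) x)" for x
      proof -
        have "pd (- y) (f s) x = pd (\<Sum>i\<in>Basis. ((- y) \<bullet> i) *\<^sub>R i) (f s) x" by (simp only: euclidean_representation)
        then show ?thesis by (simp only: linear_sum[OF l] linear_scale[OF l] real_scaleR_def inner_minus_left)
      qed
      then have "D s = (LINT x|lebesgue. (\<Sum>i\<in>Basis. (- (y \<bullet> i)) * (ub x * pd i (f s) x)))"
        unfolding D_def by (simp only: sum_distrib_left mult.left_commute)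
      also have "\<dots> = (\<Sum>i\<in>Basis. (- (y \<bullet> i)) * (LINT x|lebesgue. ub x * pd i (f s) x))"
        by (subst Bochner_Integration.integral_sum)
          (auto intro!: test_function_integrable[OF _ lm ub(3)] test_function_pd[OF ft])
      finally have Ds: "D s = (\<Sum>i\<in>Basis. (- (y \<bullet> i)) * (LINT x|lebesgue. ub x * pd i (f s) x))" .
      have "\<bar>D s\<bar> \<le> (\<Sum>i\<in>(Basis::'a set). norm y * (L * (LINT x|lebesgue. \<phi> x)))"
        unfolding Ds
      proof (rule order_trans[OF sum_abs], rule sum_mono)
        fix i :: 'a assume i: "i \<in> Basis"
        have "(LINT x|lebesgue. ub x * pd i (f s) x) = (LINT x:\<Omega>|lebesgue. u x * pd i (f s) x)"
          by (simp add: set_lebesgue_integral_def ub(1) mult.assoc)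
        also have "\<dots> = - (LINT x:\<Omega>|lebesgue. (?g x \<bullet> i) * f s x)"
          by (rule H10_zero_extension[OF assms(1) u ft i])
        finally have "\<bar>LINT x|lebesgue. ub x * pd i (f s) x\<bar> = \<bar>LINT x:\<Omega>|lebesgue. (?g x \<bullet> i) * f s x\<bar>" by simp
        also have "\<dots> \<le> (LINT x|lebesgue. L * f s x)"
          unfolding set_lebesgue_integral_def
        proof (rule order_trans[OF integral_abs_bound])
          have m: "(\<lambda>x. indicator \<Omega> x *\<^sub>R ((?g x \<bullet> i) * f s x)) \<in> borel_measurable lebesgue"
            using borel_measurable_times[OF mg[of i] test_function_measurable[OF ft[of s]]] by (simp add: mult.assoc)
          have iL: "integrable lebesgue (\<lambda>x. L * f s x)" using test_function_integrable1[OF ft] by simp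
          have fp: "0 \<le> f s x" for x using pos by (simp add: f_def)
          have b: "AE x in lebesgue. \<bar>indicator \<Omega> x *\<^sub>R ((?g x \<bullet> i) * f s x)\<bar> \<le> L * f s x"
            using g[OF i]
          proof eventually_elim
            case (elim x)
            show ?case
            proof (cases "x \<in> \<Omega>")
              case True
              with elim have "\<bar>?g x \<bullet> i\<bar> * f s x \<le> L * f s x" using fp[of x] by (intro mult_right_mono) auto
              then show ?thesis using True fp[of x] by (simp add: abs_mult)
            qed (simp add: L fp)
          qed
          have bi: "integrable lebesgue (\<lambda>x. indicator \<Omega> x *\<^sub>R ((?g x \<bullet> i) * f s x))"
            by (rule Bochner_Integration.integrable_bound[OF iL m]) (use b L fp in \<open>auto elim!: eventually_mono\<close>)
          show "(LINT x|lebesgue. \<bar>indicator \<Omega> x *\<^sub>R ((?g x \<bullet> i) * f s x)\<bar>) \<le> (LINT x|lebesgue. L * f s x)"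
            by (rule integral_mono_AE[OF integrable_abs[OF bi] iL b])
        qed
        also have "\<dots> = L * (LINT x|lebesgue. \<phi> x)" by (simp add: fint)
        finally have "\<bar>LINT x|lebesgue. ub x * pd i (f s) x\<bar> \<le> L * (LINT x|lebesgue. \<phi> x)" .
        then show "\<bar>- (y \<bullet> i) * (LINT x|lebesgue. ub x * pd i (f s) x)\<bar> \<le> norm y * (L * (LINT x|lebesgue. \<phi> x))"
          unfolding abs_mult abs_minus_cancel using Basis_le_norm[OF i] by (intro mult_mono) auto
      qed
      then show ?thesis by (simp add: C_def mult_ac)
    qed
    have "norm (F 1 - F 0) \<le> (C * (LINT x|lebesgue. \<phi> x)) * norm (1 - 0 :: real)"
      by (rule field_differentiable_bound[where S=UNIV and f'=D])
        (use Dle der in \<open>auto intro: has_field_derivative_at_within\<close>)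
    moreover have "F 1 - F 0 = (LINT x|lebesgue. (ub (x + y) - ub x) * \<phi> x)"
    proof -
      have m: "(\<lambda>x. ub (x + y) * \<phi> x) \<in> borel_measurable borel"
        using ub(2) test_function_borel[OF t] by measurable
      have m1: "(\<lambda>x. ub (x + y)) \<in> borel_measurable lebesgue"
        by (rule borel_imp_lebesgue_measurable) (use ub(2) in measurable)
      have "F 1 = (LINT x|lebesgue. ub (x + y) * \<phi> x)"
        using lebesgue_integral_shift[OF m, of "- y"] by (simp add: F_def)
      moreover have "F 0 = (LINT x|lebesgue. ub x * \<phi> x)" by (simp add: F_def)
      ultimately show ?thesis
        using test_function_integrable[OF t m1, of B] test_function_integrable[OF t lm, of B] ub(3)
        by (simp add: left_diff_distrib)
    qed
    ultimately show ?thesis by simp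
  qed
  have m1: "(\<lambda>x. ub (x + y)) \<in> borel_measurable lebesgue"
    by (rule borel_imp_lebesgue_measurable) (use ub(2) in measurable)
  have i1: "integrable lebesgue (\<lambda>x. (ub (x + y) - ub x) * \<phi> x)" if "test_function UNIV \<phi>" for \<phi>
  proof (rule test_function_integrable[OF that])
    show "(\<lambda>x. ub (x + y) - ub x) \<in> borel_measurable lebesgue" using m1 lm by measurable
    show "\<bar>ub (x + y) - ub x\<bar> \<le> 2 * B" for x using ub(3)[of x] ub(3)[of "x + y"] by linarith
  qed
  have "AE x in lebesgue. x \<in> UNIV \<longrightarrow> 0 \<le> C + s * (ub (x + y) - ub x)" if s: "s = 1 \<or> s = -1" for s
  proof (rule AE_nonneg_of_test[OF open_UNIV])
    show "locally_integrable UNIV (\<lambda>x. C + s * (ub (x + y) - ub x))"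
      unfolding locally_integrable_def set_integrable_def
    proof (intro allI impI)
      fix K :: "'a set" assume K: "compact K \<and> K \<subseteq> UNIV"
      show "integrable lebesgue (\<lambda>x. indicat_real K x *\<^sub>R (C + s * (ub (x + y) - ub x)))"
      proof (rule integrable_bounded_support[where S=K and B="\<bar>C\<bar> + 2 * B"])
        have "K \<in> sets lebesgue" using K by (simp add: borel_compact)
        then show "(\<lambda>x. indicat_real K x *\<^sub>R (C + s * (ub (x + y) - ub x))) \<in> borel_measurable lebesgue"
          using m1 lm by measurable
        show "\<bar>indicat_real K x *\<^sub>R (C + s * (ub (x + y) - ub x))\<bar> \<le> \<bar>C\<bar> + 2 * B" for x
          using ub(3)[of x] ub(3)[of "x + y"] s by (auto simp: indicator_def)
      qed (use K compact_imp_bounded in auto)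
    qed
    fix \<phi> :: "'a \<Rightarrow> real" assume t: "test_function UNIV \<phi>" and pos: "\<And>x. 0 \<le> \<phi> x"
    have "(C + s * (ub (x + y) - ub x)) * \<phi> x = C * \<phi> x + s * ((ub (x + y) - ub x) * \<phi> x)" for x
      by (simp add: algebra_simps)
    then have "(LINT x:UNIV|lebesgue. (C + s * (ub (x + y) - ub x)) * \<phi> x) =
       C * (LINT x|lebesgue. \<phi> x) + s * (LINT x|lebesgue. (ub (x + y) - ub x) * \<phi> x)"
      using i1[OF t] test_function_integrable1[OF t]
      unfolding set_lebesgue_integral_def by (simp del: left_diff_distrib)
    then show "0 \<le> (LINT x:UNIV|lebesgue. (C + s * (ub (x + y) - ub x)) * \<phi> x)"
      using key[OF t pos] s by (auto simp: abs_le_iff)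
  qed note pm = this
  have "AE x in lebesgue. x \<in> UNIV \<longrightarrow> 0 \<le> C + 1 * (ub (x + y) - ub x)" by (rule pm) simp
  moreover have "AE x in lebesgue. x \<in> UNIV \<longrightarrow> 0 \<le> C + (-1) * (ub (x + y) - ub x)" by (rule pm) simp
  ultimately have "AE x in lebesgue. \<bar>ub (x + y) - ub x\<bar> \<le> C"
    by eventually_elim (simp add: abs_le_iff)
  then show ?thesis by (simp only: C_def)
qed

text \<open>Below a boundary point, in the direction opposite to \<open>e\<close>, one is strictly below the graph, and by
continuity so is a whole neighbourhood.\<close>

lemma smooth_boundary_exterior_ball:
  assumes "open \<Omega>" "smooth_boundary \<Omega>" "x0 \<in> frontier \<Omega>" "\<epsilon> > 0"
  obtains z \<eta> where "\<eta> > 0" "dist z x0 < \<epsilon>" "ball z \<eta> \<inter> \<Omega> = {}"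
proof -
  obtain r e \<gamma> where r: "r > 0" and e: "norm e = 1" and \<gamma>: "smooth_on UNIV \<gamma>"
    and eq: "\<Omega> \<inter> ball x0 r = {x \<in> ball x0 r. \<gamma> (x - (x \<bullet> e) *\<^sub>R e) < x \<bullet> e}"
    using bspec[OF assms(2)[unfolded smooth_boundary_def] assms(3)] by (elim exE conjE) (rule that)
  have ee: "e \<bullet> e = 1" using e by (simp add: power2_norm_eq_inner[symmetric])
  define p where "p x = x - (x \<bullet> e) *\<^sub>R e" for x
  define s where "s = min \<epsilon> r / 2"
  have s: "0 < s" "s < \<epsilon>" "s < r" using assms(4) r by (auto simp: s_def)
  define z where "z = x0 - s *\<^sub>R e"
  have "x0 \<notin> \<Omega>" using assms(1,3) frontier_disjoint_eq by (auto simp: frontier_def interior_open)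
  moreover have "x0 \<in> ball x0 r" using r by simp
  ultimately have le: "x0 \<bullet> e \<le> \<gamma> (p x0)" 
    using eq[unfolded set_eq_iff, THEN spec, of x0] unfolding p_def by simp
  have zp: "p z = p x0" by (simp add: p_def z_def inner_diff_left ee algebra_simps)
  have ze: "z \<bullet> e = x0 \<bullet> e - s" by (simp add: z_def inner_diff_left ee)
  have c\<gamma>: "continuous_on UNIV \<gamma>" by (rule smooth_on_continuous[OF \<gamma>])
  have cp: "continuous_on UNIV (\<lambda>x. \<gamma> (p x))"
    by (rule continuous_on_compose2[OF c\<gamma>]) (auto simp: p_def intro!: continuous_intros)
  define W where "W = ball x0 r \<inter> {x. x \<bullet> e < \<gamma> (p x)}"
  have "open W" unfolding W_def
    by (intro open_Int open_ball open_Collect_less cp continuous_intros)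
  moreover have "z \<in> W" using le s e ze zp by (simp add: W_def z_def dist_norm)
  ultimately obtain \<eta> where \<eta>: "\<eta> > 0" "ball z \<eta> \<subseteq> W" using open_contains_ball by blast
  have "x \<notin> \<Omega>" if "x \<in> W" for x
  proof
    assume "x \<in> \<Omega>"
    with that have "x \<in> \<Omega> \<inter> ball x0 r" by (simp add: W_def)
    then have "\<gamma> (p x) < x \<bullet> e" unfolding eq p_def by simp
    with that show False by (simp add: W_def)
  qed
  then have "ball z \<eta> \<inter> \<Omega> = {}" using \<eta>(2) by blast
  then show thesis by (rule that[OF \<eta>(1), rotated]) (use s e in \<open>simp add: z_def dist_norm\<close>)
qed

text \<open>If \<open>u x0\<close> were not zero, translating a small exterior ball near \<open>x0\<close> by a short vector into \<open>\<Omega>\<close> would make the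
zero extension jump by at least half of \<open>\<bar>u x0\<bar>\<close> on a set of positive measure, although the zero extension
is Lipschitz up to null sets.\<close>

lemma H10_lipschitz_zero_on_boundary:
  fixes \<Omega> :: "'a::euclidean_space set"
  assumes "smooth_bounded_domain \<Omega>" "u \<in> H10 \<Omega>" "L-lipschitz_on (closure \<Omega>) u" "x0 \<in> frontier \<Omega>"
  shows "u x0 = 0"
proof (rule ccontr)
  assume nz: "u x0 \<noteq> 0"
  have op: "open \<Omega>" and bd: "bounded \<Omega>" and sb: "smooth_boundary \<Omega>"
    using assms(1) by (auto simp: smooth_bounded_domain_def)
  have L: "L \<ge> 0" by (rule lipschitz_on_nonneg[OF assms(3)])
  have lip: "\<bar>u x - u y\<bar> \<le> L * norm (x - y)" if "x \<in> closure \<Omega>" "y \<in> closure \<Omega>" for x y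
    using lipschitz_onD[OF assms(3) that] by (simp add: dist_norm)
  have cc: "continuous_on (closure \<Omega>) u" by (rule lipschitz_on_continuous_on[OF assms(3)])
  have "compact (u ` closure \<Omega>)" using bd cc by (intro compact_continuous_image) auto
  then obtain B where B: "B > 0" "\<forall>y\<in>u ` closure \<Omega>. norm y \<le> B"
    using bounded_pos[THEN iffD1, OF compact_imp_bounded] by blast
  then have B0: "B \<ge> 0" and B: "\<And>x. x \<in> closure \<Omega> \<Longrightarrow> \<bar>u x\<bar> \<le> B" by auto
  define ub where "ub = (\<lambda>x. indicator \<Omega> x *\<^sub>R u x)"
  have c\<Omega>: "continuous_on \<Omega> u" using cc closure_subset continuous_on_subset by blast
  have m: "ub \<in> borel_measurable borel"
    unfolding ub_def using op c\<Omega> by (intro borel_measurable_continuous_on_indicator) auto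
  have b: "\<bar>ub x\<bar> \<le> B" for x
  proof (cases "x \<in> \<Omega>")
    case True
    then show ?thesis using B[of x] closure_subset[of \<Omega>] by (simp add: ub_def subsetD)
  qed (simp add: ub_def B0)
  have uH1: "u \<in> H1 \<Omega>" using assms(2) by (simp add: H10_def)
  have g: "AE x in lebesgue. x \<in> \<Omega> \<longrightarrow> \<bar>weak_grad \<Omega> u x \<bullet> i\<bar> \<le> L" if "i \<in> Basis" for i
  proof (rule weak_gradient_le_lipschitz[OF op weak_grad_has[OF uH1] _ _ B0 c\<Omega> that])
    show "\<bar>u x - u y\<bar> \<le> L * norm (x - y)" if "x \<in> \<Omega>" "y \<in> \<Omega>" for x y
      by (rule lip) (use that closure_subset in blast)+
    show "\<bar>u x\<bar> \<le> B" if "x \<in> \<Omega>" for x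
      by (rule B) (use that closure_subset in blast)
  qed
  have ext: "AE x in lebesgue. \<bar>ub (x + y) - ub x\<bar> \<le> DIM('a) * L * norm y" for y
    by (rule H10_zero_extension_lipschitz[OF op assms(2) ub_def m b g L])
  define a where "a = \<bar>u x0\<bar>"
  define C where "C = DIM('a) * L"
  have a: "a > 0" using nz by (simp add: a_def)
  have C: "C \<ge> 0" using L by (simp add: C_def)
  define \<epsilon> where "\<epsilon> = a / (4 * (C + L + 1))"
  have \<epsilon>: "\<epsilon> > 0" using a C L by (simp add: \<epsilon>_def)
  have \<epsilon>C: "4 * (C + L + 1) * \<epsilon> = a" using C L by (simp add: \<epsilon>_def)
  have ex: "4 * (C * \<epsilon>) + 4 * (L * \<epsilon>) + 4 * \<epsilon> = a" using \<epsilon>C by (simp only: distrib_left distrib_right mult.assoc mult_1_left)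
  have nn: "0 \<le> C * \<epsilon>" "0 \<le> L * \<epsilon>" using C L \<epsilon> by simp_all
  have L\<epsilon>: "L * \<epsilon> \<le> a / 4" "2 * (C * \<epsilon>) < a / 2" using ex nn \<epsilon> by linarith+
  obtain z \<eta> where z: "\<eta> > 0" "dist z x0 < \<epsilon>" "ball z \<eta> \<inter> \<Omega> = {}"
    by (rule smooth_boundary_exterior_ball[OF op sb assms(4) \<epsilon>])
  have x0c: "x0 \<in> closure \<Omega>" using assms(4) by (simp add: frontier_def)
  then obtain y where y: "y \<in> \<Omega>" "dist y x0 < \<epsilon>" using \<epsilon> closure_approachable by blast
  have "open (\<Omega> \<inter> ball x0 \<epsilon>)" "y \<in> \<Omega> \<inter> ball x0 \<epsilon>" using op y by (auto simp: dist_commute)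
  then obtain \<eta>' where \<eta>': "\<eta>' > 0" "ball y \<eta>' \<subseteq> \<Omega> \<inter> ball x0 \<epsilon>" using open_contains_ball by blast
  define \<rho> where "\<rho> = min \<eta> \<eta>'"
  have \<rho>: "\<rho> > 0" "\<rho> \<le> \<eta>" "\<rho> \<le> \<eta>'" using z(1) \<eta>'(1) by (auto simp: \<rho>_def)
  have "dist y z < 2 * \<epsilon>" using dist_triangle_less_add[OF y(2), of z \<epsilon>] z(2) by (simp add: dist_commute)
  then have nyz: "norm (y - z) \<le> 2 * \<epsilon>" by (simp add: dist_norm)
  have "AE x in lebesgue. x \<notin> ball z \<rho>"
    using ext[of "y - z"]
  proof eventually_elim
    case (elim x)
    show ?case
    proof
      assume x: "x \<in> ball z \<rho>"
      have "x \<in> ball z \<eta>" using x \<rho>(2) by simp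
      then have "x \<notin> \<Omega>" using z(3) by blast
      then have ux: "ub x = 0" by (simp add: ub_def)
      have "dist y (x + (y - z)) = dist z x" by (simp add: dist_norm algebra_simps)
      then have "x + (y - z) \<in> ball y \<eta>'" using x \<rho>(3) by simp
      then have w: "x + (y - z) \<in> \<Omega>" "dist x0 (x + (y - z)) < \<epsilon>" using \<eta>'(2) by auto
      have "\<bar>u (x + (y - z)) - u x0\<bar> \<le> L * norm (x + (y - z) - x0)"
        using w(1) closure_subset x0c by (intro lip) auto
      also have "\<dots> \<le> L * \<epsilon>" using w(2) L by (intro mult_left_mono) (auto simp: dist_norm norm_minus_commute)
      finally have "\<bar>u (x + (y - z)) - u x0\<bar> \<le> a / 4" using L\<epsilon>(1) by linarith
      then have "\<bar>u (x + (y - z))\<bar> \<ge> a / 2" unfolding a_def by linarith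
      moreover have "ub (x + (y - z)) = u (x + (y - z))" using w(1) by (simp add: ub_def)
      ultimately have "\<bar>ub (x + (y - z)) - ub x\<bar> \<ge> a / 2" using ux by simp
      moreover have "\<bar>ub (x + (y - z)) - ub x\<bar> \<le> C * (2 * \<epsilon>)"
        using elim mult_left_mono[OF nyz C] unfolding C_def by linarith
      moreover have "C * (2 * \<epsilon>) = 2 * (C * \<epsilon>)" by simp
      ultimately show False using L\<epsilon>(2) by linarith
    qed
  qed
  then obtain N where N: "N \<in> null_sets lebesgue" "{x \<in> space lebesgue. \<not> x \<notin> ball z \<rho>} \<subseteq> N"
    by (auto simp: eventually_ae_filter)
  have "ball z \<rho> \<subseteq> N" using N(2) by force
  then have "negligible (ball z \<rho>)"
    by (rule negligible_subset[OF N(1)[folded negligible_iff_null_sets]])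
  then show False using open_not_negligible[OF open_ball, of z \<rho>] \<rho>(1) by simp
qed

section \<open>A nearly subharmonic test function\<close>

lemma flat_exp_Suc_ge: "s0 > 0 \<Longrightarrow> s0 \<le> s \<Longrightarrow> exp (- 1 / s0) \<le> flat_exp 0 s + flat_exp 1 s"
proof -
  assume s: "s0 > 0" "s0 \<le> s"
  have "- 1 / s0 \<le> - 1 / s" using s by (simp add: field_simps)
  then have "exp (- 1 / s0) \<le> exp (- 1 / s)" by simp
  also have "\<dots> = flat_exp 0 s" using s by (simp add: flat_exp_def)
  also have "\<dots> \<le> flat_exp 0 s + flat_exp 1 s" using flat_exp_nonneg[of 1 s] by linarith
  finally show ?thesis .
qed

lemma laplacian_radial:
  fixes y :: "'a::euclidean_space" and F F1 F2 :: "real \<Rightarrow> real"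
  assumes "\<And>q. q \<ge> 0 \<Longrightarrow> (F has_real_derivative F1 q) (at q)"
    and "\<And>q. q \<ge> 0 \<Longrightarrow> (F1 has_real_derivative F2 q) (at q)"
  shows "laplacian (\<lambda>x::'a. F ((norm x)\<^sup>2)) y
    = 4 * F2 ((norm y)\<^sup>2) * (norm y)\<^sup>2 + 2 * DIM('a) * F1 ((norm y)\<^sup>2)"
proof -
  have n: "((\<lambda>x::'a. (norm x)\<^sup>2) has_derivative (\<lambda>h. 2 * (x \<bullet> h))) (at x)" for x
    unfolding power2_norm_eq_inner
    by (auto intro!: derivative_eq_intros simp: inner_commute)
  have c: "((\<lambda>x::'a. G ((norm x)\<^sup>2)) has_derivative (\<lambda>h. G' * (2 * (x \<bullet> h)))) (at x)"
    if "(G has_real_derivative G') (at ((norm x)\<^sup>2))" for G G' x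
    by (rule has_derivative_compose[OF n that[unfolded has_field_derivative_def]])
  have p1: "pd i (\<lambda>x::'a. F ((norm x)\<^sup>2)) x = F1 ((norm x)\<^sup>2) * (2 * (x \<bullet> i))" for i x
    by (rule pd_eqI[where f'="\<lambda>h. F1 ((norm x)\<^sup>2) * (2 * (x \<bullet> h))"], rule c[OF assms(1)]) simp
  have p2: "pd i (\<lambda>x::'a. F1 ((norm x)\<^sup>2) * (2 * (x \<bullet> i))) y
      = F1 ((norm y)\<^sup>2) * (2 * (i \<bullet> i)) + (F2 ((norm y)\<^sup>2) * (2 * (y \<bullet> i))) * (2 * (y \<bullet> i))" for i
  proof (rule pd_eqI[where f'="\<lambda>h. F1 ((norm y)\<^sup>2) * (2 * (h \<bullet> i)) + (F2 ((norm y)\<^sup>2) * (2 * (y \<bullet> h))) * (2 * (y \<bullet> i))"])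
    have lin: "((\<lambda>x. 2 * (x \<bullet> i)) has_derivative (\<lambda>h. 2 * (h \<bullet> i))) (at y)"
      by (auto intro!: derivative_eq_intros)
    show "((\<lambda>x. F1 ((norm x)\<^sup>2) * (2 * (x \<bullet> i))) has_derivative
       (\<lambda>h. F1 ((norm y)\<^sup>2) * (2 * (h \<bullet> i)) + (F2 ((norm y)\<^sup>2) * (2 * (y \<bullet> h))) * (2 * (y \<bullet> i)))) (at y)"
      by (rule has_derivative_mult[OF c[OF assms(2)] lin]) simp
  qed
  have "laplacian (\<lambda>x::'a. F ((norm x)\<^sup>2)) y = (\<Sum>i\<in>(Basis::'a set).
     F1 ((norm y)\<^sup>2) * (2 * (i \<bullet> i)) + (F2 ((norm y)\<^sup>2) * (2 * (y \<bullet> i))) * (2 * (y \<bullet> i)))"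
    unfolding laplacian_def p1 p2 by (rule refl)
  also have "\<dots> = (\<Sum>i\<in>(Basis::'a set). 2 * F1 ((norm y)\<^sup>2)) + (\<Sum>i\<in>(Basis::'a set). 4 * F2 ((norm y)\<^sup>2) * ((y \<bullet> i) * (y \<bullet> i)))"
    unfolding sum.distrib[symmetric] by (rule sum.cong) (auto simp: inner_Basis algebra_simps)
  also have "\<dots> = 2 * DIM('a) * F1 ((norm y)\<^sup>2) + 4 * F2 ((norm y)\<^sup>2) * (\<Sum>i\<in>(Basis::'a set). (y \<bullet> i) * (y \<bullet> i))"
    by (simp add: sum_distrib_left)
  also have "(\<Sum>i\<in>(Basis::'a set). (y \<bullet> i) * (y \<bullet> i)) = (norm y)\<^sup>2"
    unfolding power2_norm_eq_inner by (rule euclidean_inner[symmetric])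
  finally show ?thesis by simp
qed

text \<open>The last factor is the point of the choice of \<open>a\<close>: the radial computation produces
\<open>(2 a + 2 - N) q - N d\<close>, and \<open>2 a + 2 - N = 1 / 2\<close> is positive, so that only the ball \<open>q < 2 N d\<close> can
contribute negatively.\<close>

lemma laplacian_truncated_power:
  fixes y :: "'a::euclidean_space" and a d :: real
  assumes "d > 0"
  defines "q \<equiv> (norm y)\<^sup>2" and "s \<equiv> (((norm y)\<^sup>2 + d) powr (- a) - 1)"
  assumes aeq: "a = DIM('a) / 2 - 3 / 4"
  shows "laplacian (\<lambda>x::'a. ramp (((norm x)\<^sup>2 + d) powr (- a) - 1)) y =
     4 * q * (flat_exp 3 s * (a * (q + d) powr (- a - 1))\<^sup>2)
     + (flat_exp 0 s + flat_exp 1 s) * (2 * a * (q + d) powr (- a - 2) * (q / 2 - DIM('a) * d))"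
proof -
  define S where "S q = (q + d) powr (- a) - 1" for q :: real
  define S1 where "S1 q = - a * (q + d) powr (- a - 1)" for q :: real
  define S2 where "S2 q = - a * ((- a - 1) * (q + d) powr (- a - 2))" for q :: real
  define r where "r s = flat_exp 0 s + flat_exp 1 s" for s :: real
  have pw: "((\<lambda>q. (q + d) powr c) has_real_derivative c * (q + d) powr (c - 1)) (at q)" if "q \<ge> 0" for q c
  proof -
    have "((\<lambda>q. q + d) has_real_derivative 1) (at q)" by (auto intro!: derivative_eq_intros)
    from DERIV_chain2[OF has_real_derivative_powr this, of c] show ?thesis using that assms(1) by simp
  qed
  have dS: "(S has_real_derivative S1 q) (at q)" if "q \<ge> 0" for q
    unfolding S_def[abs_def] S1_def using DERIV_diff[OF pw[OF that, of "- a"] DERIV_const[of 1]] by simp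
  have dS1: "(S1 has_real_derivative S2 q) (at q)" if "q \<ge> 0" for q
  proof -
    have "((\<lambda>q. - a * (q + d) powr (- a - 1)) has_real_derivative - a * ((- a - 1) * (q + d) powr (- a - 1 - 1))) (at q)"
      by (rule DERIV_cmult[OF pw[OF that]])
    moreover have "- a - 1 - 1 = - a - 2" by simp
    ultimately show ?thesis unfolding S1_def[abs_def] S2_def by (simp only:)
  qed
  have d1: "((\<lambda>q. ramp (S q)) has_real_derivative r (S q) * S1 q) (at q)" if "q \<ge> 0" for q
    unfolding r_def by (rule DERIV_chain2[OF ramp_derivative dS[OF that]])
  have d2: "((\<lambda>q. r (S q) * S1 q) has_real_derivative
      (flat_exp 3 (S q) * S1 q) * S1 q + S2 q * r (S q)) (at q)" if "q \<ge> 0" for q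
    unfolding r_def
    by (intro DERIV_mult DERIV_chain2[OF ramp_derivative2 dS[OF that]] dS1[OF that])
  have q0: "q \<ge> 0" "q + d > 0" using assms(1) by (simp_all add: q_def add_nonneg_pos)
  have "laplacian (\<lambda>x::'a. ramp (((norm x)\<^sup>2 + d) powr (- a) - 1)) y = laplacian (\<lambda>x::'a. ramp (S ((norm x)\<^sup>2))) y"
    by (simp add: S_def)
  also have "\<dots> = 4 * ((flat_exp 3 (S q) * S1 q) * S1 q + S2 q * r (S q)) * q + 2 * DIM('a) * (r (S q) * S1 q)"
    unfolding q_def by (rule laplacian_radial[OF d1 d2])
  also have "\<dots> = 4 * q * (flat_exp 3 (S q) * (S1 q)\<^sup>2) + r (S q) * (4 * q * S2 q + 2 * DIM('a) * S1 q)"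
    by (simp add: power2_eq_square algebra_simps)
  also have "4 * q * S2 q + 2 * DIM('a) * S1 q = 2 * a * (q + d) powr (- a - 2) * (q / 2 - DIM('a) * d)"
  proof -
    have "(q + d) powr (- a - 1) = (q + d) powr (- a - 2) * (q + d)"
    proof -
      have "- a - 1 = (- a - 2) + 1" by simp
      then show ?thesis using powr_add[of "q + d" "- a - 2" 1] q0 by (simp only: powr_one less_imp_le)
    qed
    then have "4 * q * S2 q + 2 * DIM('a) * S1 q =
        2 * a * (q + d) powr (- a - 2) * (2 * q * (a + 1) - DIM('a) * (q + d))"
      by (simp add: S1_def S2_def algebra_simps)
    also have "2 * q * (a + 1) - DIM('a) * (q + d) = q / 2 - DIM('a) * d"
      by (simp add: aeq algebra_simps)
    finally show ?thesis .
  qed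
  also have "S q = s" by (simp add: S_def s_def q_def)
  also have "(S1 q)\<^sup>2 = (a * (q + d) powr (- a - 1))\<^sup>2" by (simp add: S1_def)
  finally show ?thesis by (simp only: r_def)
qed

text \<open>With smoothing parameter \<open>d\<close> the negative part of the Laplacian has size \<open>A = O(d powr (- a - 1))\<close> and lives in
the ball of radius \<open>\<rho> = O(d powr (1 / 2))\<close>. In the last inequality the left-hand side is thus
\<open>O(d powr (1 / 4))\<close>, whereas \<open>b\<close> depends on \<open>\<kappa>\<close> alone.\<close>

lemma subharmonic_profile:
  fixes \<kappa> \<Lambda> :: real and ty :: "'a::euclidean_space itself"
  assumes dim: "DIM('a) \<ge> 2" and \<kappa>: "0 < \<kappa>" "\<kappa> < 1 / 2" and \<Lambda>: "\<Lambda> \<ge> 0"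
  obtains \<Phi> :: "'a \<Rightarrow> real" and b A \<rho> :: real
  where "test_function (ball 0 1) \<Phi>" "\<And>y. 0 \<le> \<Phi> y" "b > 0" "A \<ge> 0" "0 < \<rho>" "\<rho> \<le> \<kappa>"
    "\<And>y. \<rho> \<le> norm y \<Longrightarrow> 0 \<le> laplacian \<Phi> y" "\<And>y. - A \<le> laplacian \<Phi> y"
    "\<And>y. \<kappa> \<le> norm y \<Longrightarrow> norm y \<le> 1 - \<kappa> \<Longrightarrow> b \<le> laplacian \<Phi> y"
    "A * \<Lambda> * \<rho> ^ (DIM('a) + 1) \<le> b * \<kappa> ^ (DIM('a) + 1) / 2"
proof -
  define n where "n = real DIM('a)"
  have n2: "n \<ge> 2" using dim by (simp add: n_def)
  define a where "a = n / 2 - 3 / 4"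
  have a: "a > 0" using n2 by (simp add: a_def)
  \<comment> \<open>a lower bound for the argument of \<open>ramp\<close> on the annulus, where \<open>(norm y)\<^sup>2 + d \<le> 1 - \<kappa>\<close>\<close>
  define s0 where "s0 = (1 - \<kappa>) powr (- a) - 1"
  have s0: "s0 > 0"
  proof -
    have "1 < (1 - \<kappa>) powr (- a)" 
      using powr_less_mono2_neg[of "- a" "1 - \<kappa>" 1] \<kappa> a by simp
    then show ?thesis by (simp add: s0_def)
  qed
  define b where "b = exp (- 1 / s0) * (2 * a * (\<kappa>\<^sup>2 / 4))"
  have b: "b > 0" using a \<kappa> by (simp add: b_def)
  define D where "D = 2 * a * n * \<Lambda> * (2 * n) powr ((n + 1) / 2)"
  have D: "D \<ge> 0" using a n2 \<Lambda> by (simp add: D_def)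
  define \<beta> where "\<beta> = b * \<kappa> ^ (DIM('a) + 1) / 2"
  have \<beta>: "\<beta> > 0" using b \<kappa> by (simp add: \<beta>_def)
  \<comment> \<open>the first bound puts the negative ball inside radius \<open>\<kappa>\<close>, the second gives \<open>(norm y)\<^sup>2 + d \<le> 1 - \<kappa>\<close> on the annulus, the third the final inequality\<close>
  define d where "d = min (min (\<kappa>\<^sup>2 / (4 * n)) (\<kappa> * (1 - \<kappa>))) ((\<beta> / (D + 1)) powr 4)"
  have d: "d > 0" using \<kappa> n2 \<beta> D by (simp add: d_def)
  have d1: "4 * n * d \<le> \<kappa>\<^sup>2"
  proof -
    have "d \<le> \<kappa>\<^sup>2 / (4 * n)" by (simp add: d_def)
    then show ?thesis using n2 by (simp add: field_simps)
  qed
  have d2: "d \<le> \<kappa> * (1 - \<kappa>)" by (simp add: d_def)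
  have d3: "D * d powr (1 / 4) \<le> \<beta>"
  proof -
    have "d powr (1 / 4) \<le> ((\<beta> / (D + 1)) powr 4) powr (1 / 4)"
      using d by (intro powr_mono2) (auto simp: d_def)
    also have "\<dots> = \<beta> / (D + 1)" unfolding powr_powr using \<beta> D by simp
    finally have "D * d powr (1 / 4) \<le> D * (\<beta> / (D + 1))" using D by (rule mult_left_mono)
    also have "\<dots> \<le> \<beta>" using D \<beta> by (simp add: field_simps)
    finally show ?thesis .
  qed
  define \<Phi> :: "'a \<Rightarrow> real" where "\<Phi> x = ramp (((norm x)\<^sup>2 + d) powr (- a) - 1)" for x
  define \<rho> where "\<rho> = sqrt (2 * n * d)"
  have \<rho>: "\<rho> > 0" "\<rho>\<^sup>2 = 2 * n * d" using n2 d by (simp_all add: \<rho>_def)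
  define A where "A = 2 * a * n * d powr (- a - 1)"
  have pos: "(norm x)\<^sup>2 + d > 0" for x :: 'a using d by (simp add: add_nonneg_pos)
  have lap: "laplacian \<Phi> y = 4 * (norm y)\<^sup>2 * (flat_exp 3 (((norm y)\<^sup>2 + d) powr (- a) - 1) * (a * ((norm y)\<^sup>2 + d) powr (- a - 1))\<^sup>2)
     + (flat_exp 0 (((norm y)\<^sup>2 + d) powr (- a) - 1) + flat_exp 1 (((norm y)\<^sup>2 + d) powr (- a) - 1)) *
       (2 * a * ((norm y)\<^sup>2 + d) powr (- a - 2) * ((norm y)\<^sup>2 / 2 - n * d))" for y
    unfolding \<Phi>_def[abs_def] n_def by (rule laplacian_truncated_power[OF d]) (simp add: a_def n_def)
  have first: "0 \<le> 4 * (norm y)\<^sup>2 * (flat_exp 3 t * (a * ((norm y)\<^sup>2 + d) powr (- a - 1))\<^sup>2)" for y :: 'a and t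
    by (simp add: flat_exp_nonneg)
  have W: "0 \<le> 2 * a * ((norm y)\<^sup>2 + d) powr (- a - 2)" for y :: 'a using a by simp
  show thesis
  proof (rule that[of \<Phi> b A \<rho>])
    show "test_function (ball 0 1) \<Phi>"
    proof (rule test_functionI[of _ "cball 0 (sqrt (1 - d))"])
      have "C_on k UNIV (\<lambda>x::'a. (norm (x - 0))\<^sup>2 + d)" for k
        by (intro C_on_add[OF open_UNIV] C_on_const[OF open_UNIV] C_on_dist_power2[OF open_UNIV])
      then have c1: "C_on k UNIV (\<lambda>x::'a. (norm x)\<^sup>2 + d)" for k by simp
      have c2: "C_on k UNIV (\<lambda>x::'a. ((norm x)\<^sup>2 + d) powr (- a))" for k
        by (rule C_on_compose[OF open_UNIV open_greaterThan C_on_powr c1]) (use pos in simp)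
      have c3: "C_on k UNIV (\<lambda>x::'a. ((norm x)\<^sup>2 + d) powr (- a) - 1)" for k
        by (rule C_on_diff[OF open_UNIV c2 C_on_const[OF open_UNIV]])
      show "C_on k UNIV \<Phi>" for k
        unfolding \<Phi>_def[abs_def] by (rule C_on_compose[OF open_UNIV open_UNIV C_on_ramp c3]) simp
      have lt: "sqrt (1 - d) < 1" using d by simp
      show "cball 0 (sqrt (1 - d)) \<subseteq> ball (0::'a) 1"
      proof
        fix x :: 'a assume "x \<in> cball 0 (sqrt (1 - d))"
        then have "norm x \<le> sqrt (1 - d)" by simp
        also note lt
        finally show "x \<in> ball 0 1" by simp
      qed
      show "\<Phi> x = 0" if "x \<notin> cball 0 (sqrt (1 - d))" for x
      proof -
        have "sqrt (1 - d) < norm x" using that by simp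
        then have "1 - d < (norm x)\<^sup>2" using real_le_rsqrt[of "norm x" "1 - d"] by linarith
        then have "((norm x)\<^sup>2 + d) powr (- a) \<le> 1" using a powr_mono2'[of "- a" 1 "(norm x)\<^sup>2 + d"] by simp
        then show ?thesis by (simp add: \<Phi>_def ramp_def flat_exp_def)
      qed
    qed simp
    have "0 \<le> ramp t" for t by (simp add: ramp_def flat_exp_def)
    then show "0 \<le> \<Phi> y" for y unfolding \<Phi>_def by blast
    show "b > 0" by (rule b)
    show "A \<ge> 0" using a n2 by (simp add: A_def)
    show "0 < \<rho>" by (rule \<rho>(1))
    have "0 \<le> n * d" using n2 d by simp
    then have "\<rho>\<^sup>2 \<le> \<kappa>\<^sup>2" unfolding \<rho>(2) using d1 by linarith
    then show "\<rho> \<le> \<kappa>" by (rule power2_le_imp_le) (use \<kappa> in simp)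
    show "0 \<le> laplacian \<Phi> y" if "\<rho> \<le> norm y" for y
    proof -
      have "\<rho>\<^sup>2 \<le> (norm y)\<^sup>2" using that \<rho>(1) by (intro power_mono) auto
      then have "0 \<le> (norm y)\<^sup>2 / 2 - n * d" unfolding \<rho>(2) by simp
      then show ?thesis unfolding lap
        by (intro add_nonneg_nonneg first mult_nonneg_nonneg W ramp_derivative_bounds(1))
    qed
    show "- A \<le> laplacian \<Phi> y" for y
    proof -
      define r where "r = flat_exp 0 (((norm y)\<^sup>2 + d) powr (- a) - 1) + flat_exp 1 (((norm y)\<^sup>2 + d) powr (- a) - 1)"
      have r: "0 \<le> r" "r \<le> 1" unfolding r_def by (rule ramp_derivative_bounds)+
      have "((norm y)\<^sup>2 + d) powr (- a - 2) \<le> d powr (- a - 2)"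
        using a d by (intro powr_mono2') auto
      then have "r * (2 * a * ((norm y)\<^sup>2 + d) powr (- a - 2)) \<le> 1 * (2 * a * d powr (- a - 2))"
        using r a by (intro mult_mono mult_left_mono) auto
      then have "(r * (2 * a * ((norm y)\<^sup>2 + d) powr (- a - 2))) * (n * d) \<le> (1 * (2 * a * d powr (- a - 2))) * (n * d)"
        using n2 d by (intro mult_right_mono) auto
      also have "(1 * (2 * a * d powr (- a - 2))) * (n * d) = A"
      proof -
        have "- a - 1 = (- a - 2) + 1" by simp
        then have "d powr (- a - 1) = d powr (- a - 2) * d"
          using powr_add[of d "- a - 2" 1] d by (simp only: powr_one less_imp_le)
        then show ?thesis by (simp only: A_def mult_ac mult_1_left)
      qed
      finally have "- A \<le> (r * (2 * a * ((norm y)\<^sup>2 + d) powr (- a - 2))) * (- (n * d))" by simp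
      also have "\<dots> \<le> (r * (2 * a * ((norm y)\<^sup>2 + d) powr (- a - 2))) * ((norm y)\<^sup>2 / 2 - n * d)"
        by (rule mult_left_mono[OF _ mult_nonneg_nonneg[OF r(1) W]]) simp
      also have "\<dots> \<le> laplacian \<Phi> y"
        unfolding lap r_def[symmetric] mult.assoc[of r] by (rule add_increasing[OF first order_refl])
      finally show ?thesis .
    qed
    show "b \<le> laplacian \<Phi> y" if y: "\<kappa> \<le> norm y" "norm y \<le> 1 - \<kappa>" for y
    proof -
      have q1: "\<kappa>\<^sup>2 \<le> (norm y)\<^sup>2" using y(1) \<kappa> by (intro power_mono) auto
      have q2: "(norm y)\<^sup>2 \<le> (1 - \<kappa>)\<^sup>2" using y(2) by (intro power_mono) auto
      have le: "(norm y)\<^sup>2 + d \<le> 1 - \<kappa>" using q2 d2 by (simp add: power2_eq_square algebra_simps)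
      have s: "s0 \<le> ((norm y)\<^sup>2 + d) powr (- a) - 1"
        unfolding s0_def using le a pos[of y] by (intro diff_right_mono powr_mono2') auto
      have "1 powr (- a - 2) \<le> ((norm y)\<^sup>2 + d) powr (- a - 2)"
        using le a \<kappa> pos[of y] by (intro powr_mono2') auto
      then have p: "1 \<le> ((norm y)\<^sup>2 + d) powr (- a - 2)" by simp
      have k: "\<kappa>\<^sup>2 / 4 \<le> (norm y)\<^sup>2 / 2 - n * d" using q1 d1 by linarith
      have "b \<le> (flat_exp 0 (((norm y)\<^sup>2 + d) powr (- a) - 1) + flat_exp 1 (((norm y)\<^sup>2 + d) powr (- a) - 1)) *
       (2 * a * ((norm y)\<^sup>2 + d) powr (- a - 2) * ((norm y)\<^sup>2 / 2 - n * d))"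
        unfolding b_def
      proof (rule mult_mono[OF flat_exp_Suc_ge[OF s0 s]])
        have "2 * a * 1 * (\<kappa>\<^sup>2 / 4) \<le> 2 * a * ((norm y)\<^sup>2 + d) powr (- a - 2) * ((norm y)\<^sup>2 / 2 - n * d)"
          using k p a by (intro mult_mono mult_left_mono) auto
        then show "2 * a * (\<kappa>\<^sup>2 / 4) \<le> 2 * a * ((norm y)\<^sup>2 + d) powr (- a - 2) * ((norm y)\<^sup>2 / 2 - n * d)" by simp
      qed (use a ramp_derivative_bounds in auto)
      then show ?thesis unfolding lap by (rule add_increasing[OF first])
    qed
    show "A * \<Lambda> * \<rho> ^ (DIM('a) + 1) \<le> b * \<kappa> ^ (DIM('a) + 1) / 2"
    proof -
      have "\<rho> ^ (DIM('a) + 1) = \<rho> powr (n + 1)"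
        using powr_realpow[OF \<rho>(1), of "DIM('a) + 1"] by (simp add: n_def add.commute)
      also have "\<dots> = (2 * n * d) powr ((n + 1) / 2)"
        using n2 d by (simp add: \<rho>_def powr_half_sqrt[symmetric] powr_powr)
      also have "\<dots> = (2 * n) powr ((n + 1) / 2) * d powr ((n + 1) / 2)"
        using n2 d by (simp add: powr_mult)
      finally have "A * \<Lambda> * \<rho> ^ (DIM('a) + 1) = D * (d powr (- a - 1) * d powr ((n + 1) / 2))"
        by (simp add: A_def D_def mult_ac)
      also have "d powr (- a - 1) * d powr ((n + 1) / 2) = d powr (1 / 4)"
        using d by (simp add: powr_add[symmetric] a_def field_simps)
      finally show ?thesis using d3 by (simp add: \<beta>_def)
    qed
  qed
qed

lemma scaled_test_function:
  fixes \<Phi> :: "'a::euclidean_space \<Rightarrow> real" and x0 :: 'a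
  assumes t: "test_function (ball 0 1) \<Phi>" and r: "r > 0"
  defines "\<phi> \<equiv> \<lambda>x. r * \<Phi> ((x - x0) /\<^sub>R r)"
  shows "test_function (ball x0 r) \<phi>" "pd e \<phi> x = pd e \<Phi> ((x - x0) /\<^sub>R r)"
    "grad \<phi> x = grad \<Phi> ((x - x0) /\<^sub>R r)" "laplacian \<phi> x = laplacian \<Phi> ((x - x0) /\<^sub>R r) / r"
proof -
  have aff: "(x - x0) /\<^sub>R r = inverse r *\<^sub>R x + (- (inverse r *\<^sub>R x0))" for x
    by (simp add: scaleR_diff_right)
  have tU: "test_function UNIV \<Phi>" by (rule test_function_mono[OF t]) simp
  have tsU: "test_function UNIV (\<lambda>x. \<Phi> ((x - x0) /\<^sub>R r))"
    unfolding aff by (rule test_function_affine[OF tU]) (use r in simp)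
  obtain K where K: "compact K" "K \<subseteq> ball 0 1" "\<And>x. x \<notin> K \<Longrightarrow> \<Phi> x = 0"
    using test_functionE[OF t] by metis
  let ?h = "\<lambda>y. r *\<^sub>R y + x0"
  have hinv: "?h ((x - x0) /\<^sub>R r) = x" for x using r by simp
  show 1: "test_function (ball x0 r) \<phi>"
  proof (rule test_functionI[of _ "?h ` K"])
    show "C_on k UNIV \<phi>" for k
      unfolding \<phi>_def by (intro C_on_mult[OF open_UNIV] C_on_const[OF open_UNIV] test_function_C_on[OF tsU])
    show "compact (?h ` K)" by (intro compact_continuous_image K(1) continuous_intros)
    show "?h ` K \<subseteq> ball x0 r"
    proof
      fix x assume "x \<in> ?h ` K"
      then obtain y where y: "y \<in> K" "x = ?h y" by blast
      then have "norm y < 1" using K(2) by auto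
      then show "x \<in> ball x0 r" using r y(2) by (simp add: dist_norm)
    qed
    show "\<phi> x = 0" if "x \<notin> ?h ` K" for x
    proof -
      have "(x - x0) /\<^sub>R r \<notin> K"
      proof
        assume "(x - x0) /\<^sub>R r \<in> K"
        then have "?h ((x - x0) /\<^sub>R r) \<in> ?h ` K" by (rule imageI)
        with that show False by (simp only: hinv)
      qed
      then show ?thesis by (simp add: \<phi>_def K(3))
    qed
  qed
  have scale: "pd e (\<lambda>x. f ((x - x0) /\<^sub>R r)) x = inverse r * pd e f ((x - x0) /\<^sub>R r)"
    if "C_on 1 UNIV f" for e f x
    unfolding aff by (rule pd_affine[OF that])
  have dd: "((\<lambda>x. \<Phi> ((x - x0) /\<^sub>R r)) has_derivative frechet_derivative (\<lambda>x. \<Phi> ((x - x0) /\<^sub>R r)) (at x)) (at x)" for x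
    by (rule test_function_derivative[OF tsU])
  have p: "pd e \<phi> x = pd e \<Phi> ((x - x0) /\<^sub>R r)" for e x
  proof -
    have "pd e \<phi> x = r * pd e (\<lambda>x. \<Phi> ((x - x0) /\<^sub>R r)) x"
      unfolding \<phi>_def by (rule pd_eqI[OF has_derivative_mult_right[OF dd]])
    also have "\<dots> = pd e \<Phi> ((x - x0) /\<^sub>R r)"
      unfolding scale[OF test_function_C_on[OF t]] using r by simp
    finally show ?thesis .
  qed
  then show "pd e \<phi> x = pd e \<Phi> ((x - x0) /\<^sub>R r)" .
  show "grad \<phi> x = grad \<Phi> ((x - x0) /\<^sub>R r)" unfolding grad_def p by (rule refl)
  have "pd i (pd i \<phi>) x = inverse r * pd i (pd i \<Phi>) ((x - x0) /\<^sub>R r)" if "i \<in> Basis" for i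
  proof -
    have "pd i \<phi> = (\<lambda>x. pd i \<Phi> ((x - x0) /\<^sub>R r))" using p by (rule ext)
    then show ?thesis
      using scale[OF test_function_C_on[OF test_function_pd[OF t that]], of x i] by (simp only:)
  qed
  then show "laplacian \<phi> x = laplacian \<Phi> ((x - x0) /\<^sub>R r) / r"
    unfolding laplacian_def by (simp add: sum_distrib_left[symmetric] divide_inverse mult.commute)
qed

lemma test_function_laplacian: "test_function \<Omega> \<phi> \<Longrightarrow> test_function \<Omega> (laplacian \<phi>)"
proof -
  assume t: "test_function \<Omega> \<phi>"
  obtain K where K: "compact K" "K \<subseteq> \<Omega>" "\<And>x. x \<notin> K \<Longrightarrow> \<phi> x = 0" "\<And>e x. x \<notin> K \<Longrightarrow> pd e \<phi> x = 0"
    using test_functionE[OF t] by metis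
  show ?thesis
  proof (rule test_functionI[OF _ K(1,2)])
    show "C_on k UNIV (laplacian \<phi>)" for k
      unfolding laplacian_def[abs_def]
      by (intro C_on_sum finite_Basis open_UNIV test_function_C_on[OF test_function_pd[OF test_function_pd[OF t]]])
    show "laplacian \<phi> x = 0" if "x \<notin> K" for x
    proof -
      have "pd i (pd i \<phi>) x = 0" for i
        by (rule pd_zero_off_closed[OF compact_imp_closed[OF K(1)], where f="pd i \<phi>"]) (use K(4) that in auto)
      then show ?thesis by (simp add: laplacian_def)
    qed
  qed
qed

lemma measure_ball:
  fixes x :: "'a::euclidean_space"
  assumes "r \<ge> 0"
  shows "measure lebesgue (ball x r) = unit_ball_vol DIM('a) * r ^ DIM('a)"
  using content_ball[OF assms, of x] by (simp add: measure_completion)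

text \<open>A test function \<open>\<phi>\<close> at scale \<open>r\<close> about \<open>x0\<close> that detects growth: if \<open>f\<close> is nonnegative, almost vanishes at
\<open>x0\<close> (up to \<open>\<sigma>\<close>, and grows at most linearly from there), but is of size \<open>r\<close> on a ball of comparable radius, then
integrating \<open>f\<close> against the Laplacian of \<open>\<phi>\<close> gives a definite amount.\<close>

definition concentrated ::
  "real \<Rightarrow> real \<Rightarrow> real \<Rightarrow> real \<Rightarrow> 'a::euclidean_space \<Rightarrow> real \<Rightarrow> ('a \<Rightarrow> real) \<Rightarrow> bool" where
  "concentrated \<kappa> \<Lambda> c C x0 r \<phi> \<longleftrightarrow> test_function (ball x0 r) \<phi> \<and>
       (\<forall>x. 0 \<le> \<phi> x \<and> \<phi> x \<le> C * r \<and> norm (grad \<phi> x) \<le> C \<and> \<bar>laplacian \<phi> x\<bar> \<le> C / r) \<and>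
       (\<forall>f \<sigma> x1. \<sigma> \<ge> 0 \<and> integrable lebesgue (\<lambda>x. f x * laplacian \<phi> x) \<and>
          (\<forall>x\<in>ball x0 r. 0 \<le> f x \<and> f x \<le> \<Lambda> * norm (x - x0) + \<sigma>) \<and>
          (\<forall>x\<in>ball x1 (\<kappa> * r). \<kappa> * r \<le> f x \<and> \<kappa> * r \<le> norm (x - x0) \<and> norm (x - x0) \<le> (1 - \<kappa>) * r)
        \<longrightarrow> c * r ^ DIM('a) - C * \<sigma> * r ^ (DIM('a) - 1) \<le> (LINT x|lebesgue. f x * laplacian \<phi> x))"

lemma concentratedD:
  fixes x0 :: "'a::euclidean_space"
  assumes "concentrated \<kappa> \<Lambda> c C x0 r \<phi>"
  shows "test_function (ball x0 r) \<phi>" "0 \<le> \<phi> x" "\<phi> x \<le> C * r" "norm (grad \<phi> x) \<le> C"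
    "\<bar>laplacian \<phi> x\<bar> \<le> C / r"
    "\<sigma> \<ge> 0 \<Longrightarrow> integrable lebesgue (\<lambda>x. f x * laplacian \<phi> x) \<Longrightarrow>
     (\<And>x. x \<in> ball x0 r \<Longrightarrow> 0 \<le> f x \<and> f x \<le> \<Lambda> * norm (x - x0) + \<sigma>) \<Longrightarrow>
     (\<And>x. x \<in> ball x1 (\<kappa> * r) \<Longrightarrow> \<kappa> * r \<le> f x \<and> \<kappa> * r \<le> norm (x - x0) \<and> norm (x - x0) \<le> (1 - \<kappa>) * r) \<Longrightarrow>
     c * r ^ DIM('a) - C * \<sigma> * r ^ (DIM('a) - 1) \<le> (LINT x|lebesgue. f x * laplacian \<phi> x)"
  using assms unfolding concentrated_def by blast+

text \<open>On the ball about \<open>x1\<close> the integrand is at least \<open>\<kappa> b\<close>. A negative contribution arises only where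
\<open>\<bar>x - x0\<bar> < \<rho> r\<close>, and there \<open>f\<close> is at most \<open>\<Lambda> \<rho> r + \<sigma>\<close>; the choice of the profile makes the part with \<open>\<Lambda>\<close>
at most half of the positive contribution.\<close>

lemma concentrated_test_functions:
  fixes \<kappa> \<Lambda> :: real and ty :: "'a::euclidean_space itself"
  assumes dim: "DIM('a) \<ge> 2" and \<kappa>: "0 < \<kappa>" "\<kappa> < 1 / 2" and \<Lambda>: "\<Lambda> \<ge> 0"
  obtains c C where "c > 0" "C > 0"
    "\<And>(x0::'a) r. r > 0 \<Longrightarrow> \<exists>\<phi>. concentrated \<kappa> \<Lambda> c C x0 r \<phi>"
proof -
  obtain \<Phi> :: "'a \<Rightarrow> real" and b A \<rho> :: real
    where t: "test_function (ball 0 1) \<Phi>" and pos: "\<And>y. 0 \<le> \<Phi> y" and b: "b > 0" and A: "A \<ge> 0"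
    and \<rho>: "0 < \<rho>" "\<rho> \<le> \<kappa>"
    and l1: "\<And>y. \<rho> \<le> norm y \<Longrightarrow> 0 \<le> laplacian \<Phi> y" and l2: "\<And>y. - A \<le> laplacian \<Phi> y"
    and l3: "\<And>y. \<kappa> \<le> norm y \<Longrightarrow> norm y \<le> 1 - \<kappa> \<Longrightarrow> b \<le> laplacian \<Phi> y"
    and sm: "A * \<Lambda> * \<rho> ^ (DIM('a) + 1) \<le> b * \<kappa> ^ (DIM('a) + 1) / 2"
    using subharmonic_profile[where 'a='a, OF dim \<kappa> \<Lambda>] by metis
  obtain B1 where B1: "B1 > 0" "\<And>x. \<bar>\<Phi> x\<bar> \<le> B1" using test_function_bounded[OF t] by metis
  obtain B2 where B2: "B2 > 0" "\<And>x. \<bar>laplacian \<Phi> x\<bar> \<le> B2"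
    using test_function_bounded[OF test_function_laplacian[OF t]] by metis
  obtain K where K: "compact K" "\<And>e x. x \<notin> K \<Longrightarrow> pd e \<Phi> x = 0" using test_functionE[OF t] by metis
  have "continuous_on UNIV (\<lambda>x. norm (grad \<Phi> x))" by (intro continuous_on_norm grad_test_continuous[OF t])
  then obtain B3 where B3: "B3 > 0" "\<And>x. \<bar>norm (grad \<Phi> x)\<bar> \<le> B3"
    using bounded_range_if_compact_support[of "\<lambda>x. norm (grad \<Phi> x)" K] K by (auto simp: grad_def)
  define V where "V = unit_ball_vol DIM('a)"
  have V: "V > 0" by (simp add: V_def)
  define c where "c = V * b * \<kappa> ^ (DIM('a) + 1) / 2"
  define C where "C = B1 + B2 + B3 + V * A * \<rho> ^ DIM('a)"
  have VA: "0 \<le> V * A * \<rho> ^ DIM('a)" using V A \<rho> by simp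
  show thesis
  proof (rule that[of c C])
    show "c > 0" using V b \<kappa> by (simp add: c_def)
    show "C > 0" using B1 B2 B3 VA by (simp add: C_def add_pos_nonneg)
    fix x0 :: 'a and r :: real assume r: "r > 0"
    define \<phi> where "\<phi> x = r * \<Phi> ((x - x0) /\<^sub>R r)" for x
    note sc = scaled_test_function[OF t r, of x0, folded \<phi>_def[abs_def]]
    have nrm: "norm ((x - x0) /\<^sub>R r) = norm (x - x0) / r" for x using r by (simp add: divide_inverse mult.commute)
    have bd: "0 \<le> \<phi> x \<and> \<phi> x \<le> C * r \<and> norm (grad \<phi> x) \<le> C \<and> \<bar>laplacian \<phi> x\<bar> \<le> C / r" for x
    proof (intro conjI)
      show "0 \<le> \<phi> x" using pos r by (simp add: \<phi>_def)
      have "\<Phi> ((x - x0) /\<^sub>R r) \<le> C"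
        using B1(2)[of "(x - x0) /\<^sub>R r"] B2(1) B3(1) VA unfolding C_def by linarith
      then show "\<phi> x \<le> C * r" using r by (simp add: \<phi>_def mult.commute)
      show "norm (grad \<phi> x) \<le> C"
        using B3(2)[of "(x - x0) /\<^sub>R r"] B2(1) B1(1) VA unfolding C_def sc(3) by linarith
      have "\<bar>laplacian \<Phi> ((x - x0) /\<^sub>R r)\<bar> \<le> C"
        using B2(2)[of "(x - x0) /\<^sub>R r"] B3(1) B1(1) VA unfolding C_def by linarith
      then show "\<bar>laplacian \<phi> x\<bar> \<le> C / r" unfolding sc(4) using r by (simp add: abs_divide divide_right_mono)
    qed
    have "c * r ^ DIM('a) - C * \<sigma> * r ^ (DIM('a) - 1) \<le> (LINT x|lebesgue. f x * laplacian \<phi> x)"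
      if \<sigma>: "\<sigma> \<ge> 0" and int: "integrable lebesgue (\<lambda>x. f x * laplacian \<phi> x)"
        and f: "\<forall>x\<in>ball x0 r. 0 \<le> f x \<and> f x \<le> \<Lambda> * norm (x - x0) + \<sigma>"
        and x1: "\<forall>x\<in>ball x1 (\<kappa> * r). \<kappa> * r \<le> f x \<and> \<kappa> * r \<le> norm (x - x0) \<and> norm (x - x0) \<le> (1 - \<kappa>) * r"
      for f \<sigma> x1
    proof -
      define S where "S = ball x1 (\<kappa> * r)"
      define T where "T = ball x0 (\<rho> * r)"
      define m where "m = (\<Lambda> * (\<rho> * r) + \<sigma>) * (A / r)"
      have m0: "m \<ge> 0" unfolding m_def using \<Lambda> \<rho> r \<sigma> A by simp
      have pw: "\<kappa> * b * indicat_real S x - m * indicat_real T x \<le> f x * laplacian \<phi> x" for x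
      proof (cases "x \<in> ball x0 r")
        case False
        have "laplacian \<phi> x = 0" by (rule test_function_off(1)[OF test_function_laplacian[OF sc(1)] False])
        moreover have "x \<notin> S"
        proof
          assume "x \<in> S"
          then have "norm (x - x0) \<le> (1 - \<kappa>) * r" using x1 unfolding S_def by blast
          also have "\<dots> < 1 * r" using \<kappa> r by (intro mult_strict_right_mono) auto
          finally show False using False by (simp add: dist_norm norm_minus_commute)
        qed
        ultimately show ?thesis using m0 by (simp add: indicator_def)
      next
        case True
        have fx: "0 \<le> f x" "f x \<le> \<Lambda> * norm (x - x0) + \<sigma>" using f True by blast+
        show ?thesis
        proof (cases "x \<in> T")
          case xT: True
          then have n: "norm (x - x0) < \<rho> * r" by (simp add: T_def dist_norm norm_minus_commute)
          have "\<rho> * r \<le> \<kappa> * r" using \<rho> r by (intro mult_right_mono) auto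
          have "x \<notin> S"
          proof
            assume "x \<in> S"
            then have "\<kappa> * r \<le> norm (x - x0)" using x1 unfolding S_def by blast
            with n \<open>\<rho> * r \<le> \<kappa> * r\<close> show False by linarith
          qed
          have "f x \<le> \<Lambda> * (\<rho> * r) + \<sigma>" using fx(2) mult_left_mono[OF less_imp_le[OF n] \<Lambda>] by linarith
          then have "f x * (A / r) \<le> m" unfolding m_def using A r by (intro mult_right_mono) auto
          moreover have "- (A / r) \<le> laplacian \<phi> x"
            unfolding sc(4) using divide_right_mono[OF l2, of r] r by simp
          then have "f x * (- (A / r)) \<le> f x * laplacian \<phi> x" using fx(1) by (rule mult_left_mono)
          ultimately show ?thesis using xT \<open>x \<notin> S\<close> by simp
        next
          case xT: False
          then have n: "\<rho> * r \<le> norm (x - x0)" by (simp add: T_def dist_norm norm_minus_commute)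
          then have "\<rho> \<le> norm ((x - x0) /\<^sub>R r)" unfolding nrm using r by (simp add: pos_le_divide_eq)
          from l1[OF this] have lp: "0 \<le> laplacian \<phi> x" unfolding sc(4) using r by simp
          show ?thesis
          proof (cases "x \<in> S")
            case xS: True
            then have k: "\<kappa> * r \<le> f x" "\<kappa> * r \<le> norm (x - x0)" "norm (x - x0) \<le> (1 - \<kappa>) * r"
              using x1 unfolding S_def by blast+
            have "\<kappa> \<le> norm ((x - x0) /\<^sub>R r)" "norm ((x - x0) /\<^sub>R r) \<le> 1 - \<kappa>"
              unfolding nrm using k(2,3) r by (simp_all add: pos_le_divide_eq pos_divide_le_eq)
            from l3[OF this] have "b / r \<le> laplacian \<phi> x" unfolding sc(4) using r by (simp add: divide_right_mono)
            then have "(\<kappa> * r) * (b / r) \<le> f x * laplacian \<phi> x"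
              using k(1) \<kappa> r b fx(1) by (intro mult_mono) auto
            then show ?thesis using xT xS r by simp
          next
            case False
            then show ?thesis using xT fx(1) lp by simp
          qed
        qed
      qed
      have iS: "integrable lebesgue (indicat_real S)" "integrable lebesgue (indicat_real T)"
        unfolding S_def T_def by (simp_all add: integrable_indicator_iff emeasure_lborel_ball_finite[unfolded infinity_ennreal_def])
      have mS: "(LINT x|lebesgue. indicat_real S x) = V * (\<kappa> * r) ^ DIM('a)"
        "(LINT x|lebesgue. indicat_real T x) = V * (\<rho> * r) ^ DIM('a)"
        using measure_ball[of "\<kappa> * r" x1] measure_ball[of "\<rho> * r" x0] \<kappa> \<rho> r
        by (simp_all add: S_def T_def V_def)
      have "(LINT x|lebesgue. \<kappa> * b * indicat_real S x - m * indicat_real T x) \<le> (LINT x|lebesgue. f x * laplacian \<phi> x)"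
        using iS int pw by (intro integral_mono Bochner_Integration.integrable_diff integrable_mult_right) auto
      also have "(LINT x|lebesgue. \<kappa> * b * indicat_real S x - m * indicat_real T x) =
          \<kappa> * b * (V * (\<kappa> * r) ^ DIM('a)) - m * (V * (\<rho> * r) ^ DIM('a))"
        using iS by (simp only: Bochner_Integration.integral_diff integrable_mult_right integral_mult_right_zero mS)
      also have "c * r ^ DIM('a) - C * \<sigma> * r ^ (DIM('a) - 1) \<le> \<dots>"
      proof -
        define N where "N = DIM('a) - 1"
        have N: "DIM('a) = Suc N" using dim by (simp add: N_def)
        have m: "m * r = \<Lambda> * A * \<rho> * r + \<sigma> * A" unfolding m_def using r by (simp add: field_simps)
        have "m * (V * (\<rho> * r) ^ DIM('a)) = (m * r) * (V * \<rho> ^ DIM('a) * r ^ N)"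
          by (simp add: N power_mult_distrib mult_ac)
        also have "\<dots> = V * (A * \<Lambda> * \<rho> ^ (DIM('a) + 1)) * r ^ DIM('a) + \<sigma> * (V * A * \<rho> ^ DIM('a)) * r ^ N"
          unfolding m by (simp add: N algebra_simps)
        also have "\<dots> \<le> V * (b * \<kappa> ^ (DIM('a) + 1) / 2) * r ^ DIM('a) + \<sigma> * C * r ^ N"
        proof (intro add_mono mult_right_mono mult_left_mono sm)
          show "V * A * \<rho> ^ DIM('a) \<le> C" using B1 B2 B3 by (simp add: C_def)
        qed (use V r \<sigma> in auto)
        finally have "m * (V * (\<rho> * r) ^ DIM('a)) \<le> c * r ^ DIM('a) + C * \<sigma> * r ^ N"
          by (simp add: c_def mult_ac)
        moreover have "\<kappa> * b * (V * (\<kappa> * r) ^ DIM('a)) = 2 * (c * r ^ DIM('a))"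
          by (simp add: c_def power_mult_distrib mult_ac)
        ultimately show ?thesis unfolding N_def by linarith
      qed
      finally show ?thesis .
    qed
    then show "\<exists>\<phi>. concentrated \<kappa> \<Lambda> c C x0 r \<phi>"
      using bd unfolding concentrated_def by (intro exI[of _ \<phi>] conjI allI impI sc(1)) blast+
  qed
qed

section \<open>Linear growth away from the free boundary\<close>

locale free_boundary =
  fixes \<Omega> :: "'a::euclidean_space set" and u :: "'a \<Rightarrow> real" and p L :: real
  assumes dim: "DIM('a) \<ge> 2"
    and op: "open \<Omega>" and bd: "bounded \<Omega>" and p: "p > 2" and L: "L > 0"
    and lip: "\<And>x y. x \<in> closure \<Omega> \<Longrightarrow> y \<in> closure \<Omega> \<Longrightarrow> \<bar>u x - u y\<bar> \<le> L * norm (x - y)"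
    and bdry: "\<And>x. x \<in> frontier \<Omega> \<Longrightarrow> u x = 0"
    and solves: "solves_off_free_boundary \<Omega> p u"
begin

definition E :: "'a set" where "E = above1 \<Omega> u"
definition F :: "'a set" where "F = {x \<in> closure \<Omega>. u x \<le> 1}"

lemma E_subset: "E \<subseteq> \<Omega>" by (auto simp: E_def above1_def)

lemma u_gt1: "x \<in> E \<Longrightarrow> u x > 1" by (simp add: E_def above1_def)

lemma Omega_closure: "x \<in> \<Omega> \<Longrightarrow> x \<in> closure \<Omega>" using closure_subset by blast

lemma closure_cases: "x \<in> closure \<Omega> \<Longrightarrow> x \<in> \<Omega> \<or> x \<in> frontier \<Omega>"
  using op by (simp add: frontier_def interior_open)

lemma E_iff: "x \<in> E \<longleftrightarrow> x \<in> closure \<Omega> \<and> u x > 1"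
  using closure_cases[of x] Omega_closure[of x] bdry[of x] by (auto simp: E_def above1_def)

lemma continuous_u: "continuous_on (closure \<Omega>) u"
proof -
  have "L-lipschitz_on (closure \<Omega>) u"
    using lip L by (intro lipschitz_onI) (auto simp: dist_norm)
  then show ?thesis by (rule lipschitz_on_continuous_on)
qed

lemma continuous_u_Omega: "continuous_on \<Omega> u"
  using continuous_u closure_subset continuous_on_subset by blast

lemma open_E: "open E"
proof -
  have "E = \<Omega> \<inter> u -` {1<..}" by (auto simp: E_def above1_def)
  then show ?thesis using continuous_open_preimage[OF continuous_u_Omega op open_greaterThan] by simp
qed

lemma closed_F: "closed F"
proof -
  have "F = closure \<Omega> \<inter> u -` {..1}" by (auto simp: F_def)
  then show ?thesis using continuous_closed_preimage[OF continuous_u closed_closure closed_atMost] by simp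
qed

lemma closed_ge1: "closed {x \<in> closure \<Omega>. 1 \<le> u x}"
proof -
  have "{x \<in> closure \<Omega>. 1 \<le> u x} = closure \<Omega> \<inter> u -` {1..}" by auto
  then show ?thesis using continuous_closed_preimage[OF continuous_u closed_closure closed_atLeast] by simp
qed

lemma closure_E: "closure E \<subseteq> {x \<in> closure \<Omega>. 1 \<le> u x}"
  by (rule closure_minimal[OF _ closed_ge1]) (use E_iff in \<open>auto simp: less_imp_le\<close>)

lemma frontier_E:
  assumes "x \<in> frontier E"
  shows "x \<in> \<Omega>" "u x = 1" "x \<in> F" "x \<in> closure E"
proof -
  have c: "x \<in> closure E" "x \<notin> E" using assms open_E by (auto simp: frontier_def interior_open)
  then have "x \<in> closure \<Omega>" "1 \<le> u x" using closure_E by auto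
  then show "x \<in> \<Omega>" "u x = 1" "x \<in> F" "x \<in> closure E"
    using c E_iff[of x] closure_cases[of x] bdry[of x] by (auto simp: F_def)
qed

lemma setdist_pos:
  assumes "E \<noteq> {}"
  shows "setdist E (frontier \<Omega>) > 0"
proof -
  have ne: "\<Omega> \<noteq> {}" "\<Omega> \<noteq> UNIV" using assms E_subset bd not_bounded_UNIV by auto
  have fr: "frontier \<Omega> \<noteq> {}" using frontier_not_empty[OF ne] .
  have cl: "compact (closure E)"
    using bounded_subset[OF bd E_subset] by (simp add: compact_closure)
  have "closure E \<inter> frontier \<Omega> = {}"
  proof (rule equals0I)
    fix x assume "x \<in> closure E \<inter> frontier \<Omega>"
    then have "1 \<le> u x" "u x = 0" using closure_E bdry by auto
    then show False by simp
  qed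
  then have "setdist (closure E) (frontier \<Omega>) > 0"
    using setdist_gt_0_compact_closed[OF cl frontier_closed] assms fr by simp
  then show ?thesis by simp
qed

lemma ball_subset_Omega:
  assumes "x \<in> closure E" "r \<le> setdist E (frontier \<Omega>)"
  shows "ball x r \<subseteq> \<Omega>"
proof (cases "r > 0")
  case True
  have "x \<in> closure \<Omega>" "1 \<le> u x" using closure_E assms(1) by blast+
  then have x: "x \<in> \<Omega>" using closure_cases[of x] bdry[of x] by auto
  show ?thesis
  proof (rule ccontr)
    assume "\<not> ball x r \<subseteq> \<Omega>"
    then have "ball x r - \<Omega> \<noteq> {}" by blast
    moreover have "x \<in> ball x r \<inter> \<Omega>" using x True by simp
    then have "ball x r \<inter> \<Omega> \<noteq> {}" by blast
    ultimately have "ball x r \<inter> frontier \<Omega> \<noteq> {}" by (intro connected_Int_frontier connected_ball)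
    then obtain z where z: "z \<in> frontier \<Omega>" "dist x z < r" by auto
    have "setdist (closure E) (frontier \<Omega>) \<le> dist x z" by (rule setdist_le_dist[OF assms(1) z(1)])
    with z(2) assms(2) show False by simp
  qed
qed (simp add: ball_empty)

lemma off_frontier: "E \<subseteq> \<Omega> - frontier (above1 \<Omega> u)"
  using E_subset open_E by (auto simp: E_def frontier_def interior_open)

lemma C2_on_E: "C_on 2 E u"
  using solves off_frontier C_on_subset unfolding solves_off_free_boundary_def by blast

lemma laplacian_u: "x \<in> E \<Longrightarrow> laplacian u x = - ((u x - 1) powr (p - 1))"
proof -
  assume x: "x \<in> E"
  then have "- laplacian u x = (max (u x - 1) 0) powr (p - 1)"
    using solves off_frontier unfolding solves_off_free_boundary_def by blast
  moreover have "max (u x - 1) 0 = u x - 1" using u_gt1[OF x] by simp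
  ultimately show ?thesis by simp
qed

lemma test_equation:
  assumes "test_function E \<psi>"
  shows "(LINT x:E|lebesgue. u x * laplacian \<psi> x) = - (LINT x:E|lebesgue. (u x - 1) powr (p - 1) * \<psi> x)"
    "set_integrable lebesgue E (\<lambda>x. (u x - 1) powr (p - 1) * \<psi> x)"
    "set_integrable lebesgue E (\<lambda>x. u x * laplacian \<psi> x)"
proof -
  have cu: "continuous_on E u" by (rule C_on_imp_continuous_on[OF C2_on_E])
  then have "continuous_on E (\<lambda>x. (u x - 1) powr (p - 1))"
    by (intro continuous_on_powr' continuous_intros ballI) (use u_gt1 p in \<open>auto simp: less_imp_le\<close>)
  then show i: "set_integrable lebesgue E (\<lambda>x. (u x - 1) powr (p - 1) * \<psi> x)"
    by (rule integrable_times_test[OF locally_integrable_continuous assms])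
  show "set_integrable lebesgue E (\<lambda>x. u x * laplacian \<psi> x)"
    by (rule integrable_times_test[OF locally_integrable_continuous[OF cu] test_function_laplacian[OF assms]])
  have "(LINT x:E|lebesgue. u x * laplacian \<psi> x) = (LINT x:E|lebesgue. \<psi> x * laplacian u x)"
    by (rule green_test[OF open_E C2_on_E assms])
  also have "\<dots> = (LINT x:E|lebesgue. - ((u x - 1) powr (p - 1) * \<psi> x))"
    by (rule set_lebesgue_integral_cong) (use open_E laplacian_u in auto)
  also have "\<dots> = - (LINT x:E|lebesgue. (u x - 1) powr (p - 1) * \<psi> x)"
    by (rule set_integral_uminus[OF i])
  finally show "(LINT x:E|lebesgue. u x * laplacian \<psi> x) = - (LINT x:E|lebesgue. (u x - 1) powr (p - 1) * \<psi> x)" .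
qed

text \<open>Since \<open>F\<close> contains the boundary of \<open>\<Omega>\<close>, a ball that avoids \<open>F\<close> cannot leave \<open>\<Omega>\<close>.\<close>

lemma touching_ball:
  assumes x: "x \<in> E" and ne: "F \<noteq> {}"
  obtains y where "y \<in> F" "infdist x F = norm (x - y)" "infdist x F > 0"
    "ball x (infdist x F) \<subseteq> E"
proof -
  obtain y where y: "y \<in> F" "infdist x F = dist x y"
    using infdist_attains_inf[OF closed_F ne] by blast
  have xF: "x \<notin> F" using u_gt1[OF x] by (simp add: F_def)
  have d: "infdist x F > 0" using xF y by auto
  have nF: "z \<notin> F" if "z \<in> ball x (infdist x F)" for z
    using that infdist_le[of z F x] by auto
  have "ball x (infdist x F) \<subseteq> \<Omega>"
  proof (rule ccontr)
    assume "\<not> ball x (infdist x F) \<subseteq> \<Omega>"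
    then have "ball x (infdist x F) - \<Omega> \<noteq> {}" by blast
    moreover have "x \<in> ball x (infdist x F) \<inter> \<Omega>" using x d E_subset by auto
    then have "ball x (infdist x F) \<inter> \<Omega> \<noteq> {}" by blast
    ultimately have "ball x (infdist x F) \<inter> frontier \<Omega> \<noteq> {}" by (intro connected_Int_frontier connected_ball)
    then obtain z where z: "z \<in> frontier \<Omega>" "z \<in> ball x (infdist x F)" by blast
    have "z \<in> F" using z(1) bdry[OF z(1)] by (simp add: F_def frontier_def)
    with nF[OF z(2)] show False by simp
  qed
  then have "ball x (infdist x F) \<subseteq> E"
  proof (intro subsetI)
    fix z assume s: "ball x (infdist x F) \<subseteq> \<Omega>" and z: "z \<in> ball x (infdist x F)"
    have "z \<in> closure \<Omega>" using s z Omega_closure by blast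
    with nF[OF z] show "z \<in> E" unfolding E_iff by (simp add: F_def)
  qed
  with y d that show thesis by (simp add: dist_norm)
qed

text \<open>Suppose \<open>w = u - 1\<close> stays below \<open>M = (1 + \<delta>) w x\<close> in the ball of radius \<open>d\<close> about \<open>x\<close>. Then \<open>M - w\<close> is nonnegative,
at most \<open>\<delta> L d\<close> at the centre, and of size \<open>d\<close> near the point where the ball touches \<open>F\<close>. A concentrated
test function detects this with an integral of order \<open>d^N\<close>. By the equation the same integral equals
\<open>\<integral> w powr (p - 1) \<phi>\<close>, which is of order \<open>d^(N + 1)\<close> at most: a contradiction for small \<open>d\<close>.\<close>

lemma improvement:
  assumes c0: "c0 > 0" and r0: "r0 > 0" and ne: "F \<noteq> {}"
    and nd: "\<And>x. x \<in> E \<Longrightarrow> infdist x F \<le> r0 \<Longrightarrow> 1 + c0 * infdist x F \<le> u x"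
  obtains \<delta> r1 where "\<delta> > 0" "r1 > 0" "r1 \<le> r0"
    "\<And>x. x \<in> E \<Longrightarrow> infdist x F \<le> r1 \<Longrightarrow>
      \<exists>x2. norm (x2 - x) < infdist x F \<and> (1 + \<delta>) * (u x - 1) \<le> u x2 - 1"
proof -
  \<comment> \<open>within \<open>3 \<kappa> d\<close> of the touching point, \<open>u - 1\<close> is at most \<open>3 L \<kappa> d \<le> (c0 - \<kappa>) d\<close>\<close>
  define \<kappa> where "\<kappa> = min (1 / 8) (c0 / (3 * L + 1))"
  have \<kappa>: "0 < \<kappa>" "\<kappa> \<le> 1 / 8"
    using c0 L min.cobounded1[of "1 / 8" "c0 / (3 * L + 1)"] unfolding \<kappa>_def by (simp, blast)
  then have "\<kappa> < 1 / 2" by linarith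
  note \<kappa> = \<kappa> this
  have \<kappa>2: "\<kappa> * (3 * L + 1) \<le> c0"
  proof -
    have "\<kappa> \<le> c0 / (3 * L + 1)" by (simp add: \<kappa>_def)
    then show ?thesis using L by (simp add: pos_le_divide_eq)
  qed
  obtain c C where c: "c > 0" and C: "C > 0" and
    T: "\<And>(x0::'a) r. r > 0 \<Longrightarrow> \<exists>\<phi>. concentrated \<kappa> L c C x0 r \<phi>"
    using concentrated_test_functions[where 'a='a, OF dim \<kappa>(1,3) less_imp_le[OF L]] by metis
  define V where "V = unit_ball_vol DIM('a)"
  have V: "V > 0" by (simp add: V_def)
  \<comment> \<open>the error from \<open>\<sigma> = \<delta> L d\<close> then costs at most half of the detected amount\<close>
  define \<delta> where "\<delta> = min 1 (c / (2 * C * L))"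
  have \<delta>: "\<delta> > 0" "\<delta> \<le> 1" using c C L by (auto simp: \<delta>_def)
  have \<delta>2: "C * (\<delta> * L) \<le> c / 2"
  proof -
    have "\<delta> \<le> c / (2 * C * L)" by (simp add: \<delta>_def)
    then show ?thesis using C L by (simp add: pos_le_divide_eq mult_ac)
  qed
  \<comment> \<open>for \<open>d \<le> r1\<close> one has \<open>w \<le> 2 L d \<le> 1\<close>, and the right-hand side of the equation contributes at most a quarter\<close>
  define r1 where "r1 = min r0 (min (1 / (2 * L)) (c / (4 * C * V)))"
  have r1: "r1 > 0" "r1 \<le> r0" using r0 L c C V by (auto simp: r1_def)
  have r1L: "2 * L * r1 \<le> 1"
  proof -
    have "r1 \<le> 1 / (2 * L)" by (simp add: r1_def)
    then show ?thesis using L by (simp add: pos_le_divide_eq mult_ac)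
  qed
  have r1V: "C * V * r1 \<le> c / 4"
  proof -
    have "r1 \<le> c / (4 * C * V)" by (simp add: r1_def)
    then show ?thesis using C V by (simp add: pos_le_divide_eq mult_ac)
  qed
  show thesis
  proof (rule that[OF \<delta>(1) r1])
    fix x assume x: "x \<in> E" and xr: "infdist x F \<le> r1"
    define d where "d = infdist x F"
    obtain y where y: "y \<in> F" "d = norm (x - y)" "d > 0" "ball x d \<subseteq> E"
      unfolding d_def using touching_ball[OF x ne] by metis
    have dr: "d \<le> r1" using xr by (simp add: d_def)
    have wx: "c0 * d \<le> u x - 1" using nd[OF x] xr r1(2) by (simp add: d_def)
    have cl: "z \<in> closure \<Omega>" if "z \<in> E" for z using that E_iff by blast
    have ycl: "y \<in> closure \<Omega>" "u y \<le> 1" using y(1) by (auto simp: F_def)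
    have wL: "u x - 1 \<le> L * d" using lip[OF cl[OF x] ycl(1), folded y(2)] ycl(2) by linarith
    define M where "M = (1 + \<delta>) * (u x - 1)"
    show "\<exists>x2. norm (x2 - x) < infdist x F \<and> (1 + \<delta>) * (u x - 1) \<le> u x2 - 1"
    proof (rule ccontr)
      assume neg: "\<not> ?thesis"
      have small: "u z - 1 < M" if "z \<in> ball x d" for z
      proof -
        have "norm (z - x) < d" using that by (simp add: dist_norm norm_minus_commute)
        then show ?thesis using neg unfolding M_def d_def by (meson not_le)
      qed
      have wpos: "0 \<le> u x - 1" using u_gt1[OF x] by simp
      have M1: "u x - 1 \<le> M" unfolding M_def using \<delta>(1) wpos by (simp add: distrib_right)
      have M2: "M \<le> 2 * L * d"
      proof -
        have "M \<le> 2 * (u x - 1)" unfolding M_def using \<delta>(2) wpos by (intro mult_right_mono) auto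
        also have "\<dots> \<le> 2 * (L * d)" using wL by simp
        finally show ?thesis by simp
      qed
      have M3: "M \<le> u x - 1 + \<delta> * L * d"
        unfolding M_def using mult_left_mono[OF wL less_imp_le[OF \<delta>(1)]] by (simp add: algebra_simps)
      obtain \<phi> where conc: "concentrated \<kappa> L c C x d \<phi>" using T[OF y(3)] by blast
      note t = concentratedD(1)[OF conc]
      note \<phi> = concentratedD(2,3)[OF conc]
      have tE: "test_function E \<phi>" by (rule test_function_mono[OF t y(4)])
      have lz: "laplacian \<phi> z = 0" if "z \<notin> E" for z
        by (rule test_function_off(1)[OF test_function_laplacian[OF tE] that])
      have iu: "integrable lebesgue (\<lambda>z. u z * laplacian \<phi> z)"
        using test_equation(3)[OF tE] by (subst (asm) set_integral_of_support(2)) (simp_all add: lz)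
      have il: "integrable lebesgue (laplacian \<phi>)" by (rule integral_laplacian_test(2)[OF t])
      define f where "f z = (M + 1) - u z" for z
      have intf: "integrable lebesgue (\<lambda>z. f z * laplacian \<phi> z)"
        unfolding f_def left_diff_distrib using iu il by (intro Bochner_Integration.integrable_diff integrable_mult_right)
      have fval: "(LINT z|lebesgue. f z * laplacian \<phi> z) = (LINT z:E|lebesgue. (u z - 1) powr (p - 1) * \<phi> z)"
      proof -
        have "(LINT z|lebesgue. f z * laplacian \<phi> z) = (M + 1) * (LINT z|lebesgue. laplacian \<phi> z) - (LINT z|lebesgue. u z * laplacian \<phi> z)"
          unfolding f_def left_diff_distrib using iu il by simp
        also have "\<dots> = - (LINT z:E|lebesgue. u z * laplacian \<phi> z)"
          using integral_laplacian_test(1)[OF t] by (simp add: set_integral_of_support(1) lz)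
        finally show ?thesis by (simp add: test_equation(1)[OF tE])
      qed
      \<comment> \<open>a point on the segment to the touching point \<open>y\<close>, pulled back so that the ball of radius \<open>\<kappa> d\<close> fits\<close>
      define x1 where "x1 = x + (1 - 2 * \<kappa>) *\<^sub>R (y - x)"
      have x1x: "norm (x1 - x) = (1 - 2 * \<kappa>) * d" using \<kappa> y(2) by (simp add: x1_def norm_minus_commute)
      have "x1 - y = (2 * \<kappa>) *\<^sub>R (x - y)" by (simp add: x1_def algebra_simps)
      then have x1y: "norm (x1 - y) = 2 * \<kappa> * d" using \<kappa> y(2) by simp
      have lower: "c * d ^ DIM('a) - C * (\<delta> * L * d) * d ^ (DIM('a) - 1) \<le> (LINT z|lebesgue. f z * laplacian \<phi> z)"
      proof (rule concentratedD(6)[OF conc])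
        show "0 \<le> \<delta> * L * d" using \<delta> L y(3) by simp
        show "integrable lebesgue (\<lambda>z. f z * laplacian \<phi> z)" by (rule intf)
        show "0 \<le> f z \<and> f z \<le> L * norm (z - x) + \<delta> * L * d" if "z \<in> ball x d" for z
        proof
          show "0 \<le> f z" using small[OF that] by (simp add: f_def)
          have "z \<in> E" using that y(4) by blast
          then have "\<bar>u z - u x\<bar> \<le> L * norm (z - x)" by (rule lip[OF cl cl[OF x]])
          then show "f z \<le> L * norm (z - x) + \<delta> * L * d" using M3 unfolding f_def by linarith
        qed
        fix z assume z: "z \<in> ball x1 (\<kappa> * d)"
        then have zx1: "norm (z - x1) < \<kappa> * d" by (simp add: dist_norm norm_minus_commute)
        have up: "norm (z - x) \<le> norm (z - x1) + norm (x1 - x)"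
          using norm_triangle_ineq[of "z - x1" "x1 - x"] by simp
        have lo: "norm (x1 - x) \<le> norm (z - x) + norm (z - x1)"
          using norm_triangle_ineq[of "z - x" "x1 - z"] by (simp add: norm_minus_commute)
        have zy: "norm (z - y) \<le> norm (z - x1) + norm (x1 - y)"
          using norm_triangle_ineq[of "z - x1" "x1 - y"] by simp
        have kd: "\<kappa> * d \<le> d / 8" "0 < \<kappa> * d" using mult_right_mono[OF \<kappa>(2) less_imp_le[OF y(3)]] \<kappa>(1) y(3) by auto
        have klo: "\<kappa> * d \<le> norm (z - x)" using lo zx1 kd unfolding x1x left_diff_distrib by linarith
        have zle: "norm (z - x) \<le> (1 - \<kappa>) * d" using up zx1 unfolding x1x left_diff_distrib by linarith
        have "(1 - \<kappa>) * d < 1 * d" using \<kappa> y(3) by (intro mult_strict_right_mono) auto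
        with zle have "z \<in> ball x d" by (simp add: dist_norm norm_minus_commute)
        then have zE: "z \<in> E" using y(4) by blast
        have "norm (z - y) \<le> 3 * (\<kappa> * d)" using zy zx1 unfolding x1y by linarith
        then have "L * norm (z - y) \<le> L * (3 * (\<kappa> * d))" using L by (intro mult_left_mono) auto
        then have "u z - 1 \<le> 3 * L * \<kappa> * d" using lip[OF cl[OF zE] ycl(1)] ycl(2) by (simp add: mult_ac)
        moreover have "\<kappa> * (3 * L + 1) * d \<le> c0 * d" using \<kappa>2 y(3) by (intro mult_right_mono) auto
        then have "3 * L * \<kappa> * d + \<kappa> * d \<le> c0 * d" by (simp add: algebra_simps)
        ultimately have "\<kappa> * d \<le> f z" using wx M1 unfolding f_def by linarith
        with klo zle show "\<kappa> * d \<le> f z \<and> \<kappa> * d \<le> norm (z - x) \<and> norm (z - x) \<le> (1 - \<kappa>) * d" by blast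
      qed
      have upper: "(LINT z:E|lebesgue. (u z - 1) powr (p - 1) * \<phi> z) \<le> C * d * (V * d ^ DIM('a))"
      proof -
        have "(LINT z:E|lebesgue. (u z - 1) powr (p - 1) * \<phi> z) \<le> (LINT z|lebesgue. C * d * indicat_real (ball x d) z)"
          unfolding set_lebesgue_integral_def
        proof (rule integral_mono)
          show "integrable lebesgue (\<lambda>z. indicat_real E z *\<^sub>R ((u z - 1) powr (p - 1) * \<phi> z))"
            using test_equation(2)[OF tE] by (simp add: set_integrable_def)
          show "integrable lebesgue (\<lambda>z. C * d * indicat_real (ball x d) z)"
            by (intro integrable_mult_right)
              (simp add: integrable_indicator_iff emeasure_lborel_ball_finite[unfolded infinity_ennreal_def])
          fix z
          show "indicat_real E z *\<^sub>R ((u z - 1) powr (p - 1) * \<phi> z) \<le> C * d * indicat_real (ball x d) z"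
          proof (cases "z \<in> ball x d")
            case True
            then have zE: "z \<in> E" using y(4) by blast
            have "0 \<le> u z - 1" "u z - 1 \<le> 2 * L * d"
              using u_gt1[OF zE] small[OF True] M2 by linarith+
            moreover have "2 * L * d \<le> 1" using mult_left_mono[OF dr, of "2 * L"] r1L L by linarith
            ultimately have "(u z - 1) powr (p - 1) \<le> 1"
              using powr_mono2[of "p - 1" "u z - 1" 1] p by simp
            then have "(u z - 1) powr (p - 1) * \<phi> z \<le> 1 * (C * d)"
              using \<phi> by (intro mult_mono) auto
            then show ?thesis using True zE by simp
          next
            case False
            then show ?thesis using test_function_off(1)[OF t False] by simp
          qed
        qed
        also have "\<dots> = C * d * (V * d ^ DIM('a))"
          using measure_ball[of d x] y(3) by (simp add: V_def)
        finally show ?thesis .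
      qed
      define P where "P = d ^ DIM('a)"
      have P: "P > 0" using y(3) by (simp add: P_def)
      have dN: "d * d ^ (DIM('a) - 1) = P" using dim unfolding P_def by (simp add: power_eq_if)
      have e1: "C * (\<delta> * L * d) * d ^ (DIM('a) - 1) = (C * (\<delta> * L)) * P"
        unfolding dN[symmetric] by (simp only: mult_ac)
      have "c * P - (C * (\<delta> * L)) * P \<le> C * d * (V * P)"
        using lower upper unfolding fval e1 P_def by linarith
      moreover have "(C * (\<delta> * L)) * P \<le> (c / 2) * P" using \<delta>2 P by (intro mult_right_mono) auto
      moreover have "C * d * (V * P) \<le> (c / 4) * P"
      proof -
        have "C * V * d \<le> C * V * r1" using dr C V by (intro mult_left_mono) auto
        then have "(C * V * d) * P \<le> (c / 4) * P" using r1V P by (intro mult_right_mono) auto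
        then show ?thesis by (simp add: mult_ac)
      qed
      moreover have "c * P > 0" using c P by simp
      ultimately show False by linarith
    qed
  qed
qed

text \<open>Instead of iterating the improvement, one maximizes \<open>u - 1 - lam \<bar>z - x1\<bar>\<close> over the closed ball of radius
\<open>r / 2\<close>, where \<open>x1 \<in> E\<close> is close to \<open>x0\<close>. At a maximum in the inner ball of radius \<open>r / 4\<close>, the improved point
would gain at least \<open>\<delta> c0 d\<close> in \<open>u\<close> and lose less than \<open>lam d\<close> through its distance; so the maximum is attained at
distance \<open>r / 4\<close> or more from \<open>x0\<close>, and positivity of the maximum gives \<open>u - 1 \<ge> lam r / 8\<close> there.\<close>

lemma frontier_growth:
  assumes c0: "c0 > 0" and r0: "r0 > 0" and Ene: "E \<noteq> {}"
    and nd: "\<And>x. x \<in> E \<Longrightarrow> infdist x F \<le> r0 \<Longrightarrow> 1 + c0 * infdist x F \<le> u x"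
  obtains \<kappa> r2 where "0 < \<kappa>" "\<kappa> < 1 / 2" "r2 > 0"
    "\<And>x0 r. x0 \<in> frontier E \<Longrightarrow> 0 < r \<Longrightarrow> r \<le> r2 \<Longrightarrow> ball x0 r \<subseteq> \<Omega> \<and>
      (\<exists>x1. \<forall>z\<in>ball x1 (\<kappa> * r). z \<in> E \<and> \<kappa> * r \<le> u z - 1 \<and> \<kappa> * r \<le> norm (z - x0) \<and> norm (z - x0) \<le> (1 - \<kappa>) * r)"
proof -
  have ne\<Omega>: "\<Omega> \<noteq> {}" "\<Omega> \<noteq> UNIV" using Ene E_subset bd not_bounded_UNIV by auto
  have "F \<noteq> {}"
  proof -
    obtain z where "z \<in> frontier \<Omega>" using frontier_not_empty[OF ne\<Omega>] by blast
    then have "z \<in> F" using bdry[of z] by (simp add: F_def frontier_def)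
    then show ?thesis by blast
  qed
  then obtain \<delta> r1 where \<delta>: "\<delta> > 0" and r1: "r1 > 0" "r1 \<le> r0" and
    imp: "\<And>x. x \<in> E \<Longrightarrow> infdist x F \<le> r1 \<Longrightarrow>
      \<exists>x2. norm (x2 - x) < infdist x F \<and> (1 + \<delta>) * (u x - 1) \<le> u x2 - 1"
    using improvement[OF c0 r0 _ nd] by metis
  define lam where "lam = \<delta> * c0 / 2"
  have lam: "lam > 0" using \<delta> c0 by (simp add: lam_def)
  define \<kappa> where "\<kappa> = min (1 / 4) (lam / 8 / (2 * L + 1))"
  have \<kappa>: "0 < \<kappa>" "\<kappa> \<le> 1 / 4"
    using lam L min.cobounded1[of "1 / 4" "lam / 8 / (2 * L + 1)"] unfolding \<kappa>_def by (simp, blast)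
  have \<kappa>2: "\<kappa> * (2 * L + 1) \<le> lam / 8"
  proof -
    have "\<kappa> \<le> lam / 8 / (2 * L + 1)" unfolding \<kappa>_def by (rule min.cobounded2)
    moreover have "0 < 2 * L + 1" using L by simp
    ultimately show ?thesis by (simp only: pos_le_divide_eq)
  qed
  define r2 where "r2 = min (4 * r1) (setdist E (frontier \<Omega>))"
  have r2: "r2 > 0" using r1 setdist_pos[OF Ene] by (simp add: r2_def)
  show thesis
  proof (rule that[OF \<kappa>(1) _ r2])
    show "\<kappa> < 1 / 2" using \<kappa> by simp
    fix x0 r assume x0: "x0 \<in> frontier E" and r: "0 < r" "r \<le> r2"
    have sub: "ball x0 r \<subseteq> \<Omega>"
      by (rule ball_subset_Omega[OF frontier_E(4)[OF x0]]) (use r in \<open>simp add: r2_def\<close>)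
    have r4: "r / 4 \<le> r1" using r by (simp add: r2_def)
    have cb: "cball x0 (r / 2) \<subseteq> closure \<Omega>" using sub r Omega_closure by force
    obtain x1 where x1: "x1 \<in> E" "dist x1 x0 < r / 8"
      using frontier_E(4)[OF x0] r closure_approachable[of x0 E] by (metis zero_less_divide_iff zero_less_numeral)
    define \<Psi> where "\<Psi> z = u z - 1 - lam * norm (z - x1)" for z
    have "continuous_on (cball x0 (r / 2)) \<Psi>"
      unfolding \<Psi>_def[abs_def] by (intro continuous_intros continuous_on_subset[OF continuous_u cb])
    then obtain xs where xs: "xs \<in> cball x0 (r / 2)" "\<And>z. z \<in> cball x0 (r / 2) \<Longrightarrow> \<Psi> z \<le> \<Psi> xs"
      using continuous_attains_sup[OF compact_cball, of x0 "r / 2" \<Psi>] r by auto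
    have "x1 \<in> cball x0 (r / 2)" using x1(2) r by (simp add: dist_commute)
    from xs(2)[OF this] have "u x1 - 1 \<le> \<Psi> xs" by (simp add: \<Psi>_def)
    then have \<Psi>pos: "0 < \<Psi> xs" using u_gt1[OF x1(1)] by linarith
    have l0: "0 \<le> lam * norm (xs - x1)" using lam by simp
    have xsE: "xs \<in> E" unfolding E_iff
    proof
      show "xs \<in> closure \<Omega>" using xs(1) cb by blast
      show "1 < u xs" using \<Psi>pos l0 unfolding \<Psi>_def by linarith
    qed
    have far: "r / 4 \<le> norm (xs - x0)"
    proof (rule ccontr)
      assume "\<not> ?thesis"
      then have near: "norm (xs - x0) < r / 4" by simp
      have dle: "infdist xs F \<le> norm (xs - x0)" using infdist_le[OF frontier_E(3)[OF x0], of xs] by (simp add: dist_norm)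
      then have "infdist xs F \<le> r1" using near r4 by linarith
      then obtain x2 where x2: "norm (x2 - xs) < infdist xs F" "(1 + \<delta>) * (u xs - 1) \<le> u x2 - 1"
        using imp[OF xsE] by blast
      have "norm (x2 - x0) \<le> norm (x2 - xs) + norm (xs - x0)"
        using norm_triangle_ineq[of "x2 - xs" "xs - x0"] by simp
      then have "norm (x2 - x0) \<le> r / 2" using x2(1) dle near by linarith
      then have "x2 \<in> cball x0 (r / 2)" by (simp add: dist_norm norm_minus_commute)
      from xs(2)[OF this] have le: "\<Psi> x2 \<le> \<Psi> xs" .
      have "norm (x2 - x1) \<le> norm (x2 - xs) + norm (xs - x1)"
        using norm_triangle_ineq[of "x2 - xs" "xs - x1"] by simp
      then have "norm (x2 - x1) \<le> infdist xs F + norm (xs - x1)" using x2(1) by linarith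
      then have "lam * norm (x2 - x1) \<le> lam * (infdist xs F + norm (xs - x1))" using lam by (intro mult_left_mono) auto
      then have a: "lam * norm (x2 - x1) \<le> lam * infdist xs F + lam * norm (xs - x1)" by (simp only: distrib_left)
      have b: "(u xs - 1) + \<delta> * (u xs - 1) \<le> u x2 - 1" using x2(2) by (simp add: algebra_simps)
      have "c0 * infdist xs F \<le> u xs - 1" using nd[OF xsE] \<open>infdist xs F \<le> r1\<close> r1(2) by simp
      then have "\<delta> * (c0 * infdist xs F) \<le> \<delta> * (u xs - 1)" using \<delta> by (intro mult_left_mono) auto
      moreover have "\<delta> * (c0 * infdist xs F) = 2 * (lam * infdist xs F)" by (simp add: lam_def)
      moreover have "0 < lam * infdist xs F" using lam x2(1) norm_ge_zero[of "x2 - xs"] by (intro mult_pos_pos) linarith+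
      ultimately show False using a b le unfolding \<Psi>_def by linarith
    qed
    have "norm (xs - x0) \<le> norm (xs - x1) + norm (x1 - x0)"
      using norm_triangle_ineq[of "xs - x1" "x1 - x0"] by simp
    then have "r / 8 \<le> norm (xs - x1)" using far x1(2) by (simp add: dist_norm)
    then have "lam * (r / 8) \<le> lam * norm (xs - x1)" using lam by (intro mult_left_mono) auto
    then have big: "lam / 8 * r \<le> u xs - 1" using \<Psi>pos unfolding \<Psi>_def by simp
    have kr: "\<kappa> * r \<le> r / 4" using mult_right_mono[OF \<kappa>(2), of r] r by simp
    have "z \<in> E \<and> \<kappa> * r \<le> u z - 1 \<and> \<kappa> * r \<le> norm (z - x0) \<and> norm (z - x0) \<le> (1 - \<kappa>) * r"
      if z: "z \<in> ball xs (\<kappa> * r)" for z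
    proof -
      have zx: "norm (z - xs) < \<kappa> * r" using z by (simp add: dist_norm norm_minus_commute)
      have "norm (z - x0) \<le> norm (z - xs) + norm (xs - x0)"
        using norm_triangle_ineq[of "z - xs" "xs - x0"] by simp
      moreover have "norm (xs - x0) \<le> r / 2" using xs(1) by (simp add: dist_norm norm_minus_commute)
      ultimately have up: "norm (z - x0) \<le> r / 2 + \<kappa> * r" using zx by linarith
      then have up2: "norm (z - x0) \<le> (1 - \<kappa>) * r" unfolding left_diff_distrib using kr by linarith
      have "norm (z - x0) < r" using up kr r by linarith
      then have "z \<in> \<Omega>" using sub by (auto simp: dist_norm norm_minus_commute)
      then have zc: "z \<in> closure \<Omega>" by (rule Omega_closure)
      have "\<bar>u z - u xs\<bar> \<le> L * norm (z - xs)" by (rule lip[OF zc]) (use xsE E_iff in blast)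
      also have "\<dots> \<le> L * (\<kappa> * r)" using zx L by (intro mult_left_mono) auto
      finally have a: "lam / 8 * r - L * (\<kappa> * r) \<le> u z - 1" using big by linarith
      have "\<kappa> * (2 * L + 1) * r \<le> lam / 8 * r" using \<kappa>2 r by (intro mult_right_mono) auto
      then have b: "2 * (L * (\<kappa> * r)) + \<kappa> * r \<le> lam / 8 * r" by (simp add: algebra_simps)
      have kp: "0 < \<kappa> * r" "0 < L * (\<kappa> * r)" using \<kappa> r L by simp_all
      have w: "\<kappa> * r \<le> u z - 1" "L * (\<kappa> * r) \<le> u z - 1" using a b kp by linarith+
      have zE: "z \<in> E" unfolding E_iff using zc w(1) kp(1) by auto
      have "\<bar>u z - u x0\<bar> \<le> L * norm (z - x0)" by (rule lip[OF zc Omega_closure[OF frontier_E(1)[OF x0]]])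
      then have "L * (\<kappa> * r) \<le> L * norm (z - x0)" using w(2) frontier_E(2)[OF x0] by linarith
      then have "\<kappa> * r \<le> norm (z - x0)" using L by simp
      with zE w(1) up2 show ?thesis by blast
    qed
    then show "ball x0 r \<subseteq> \<Omega> \<and>
      (\<exists>x1. \<forall>z\<in>ball x1 (\<kappa> * r). z \<in> E \<and> \<kappa> * r \<le> u z - 1 \<and> \<kappa> * r \<le> norm (z - x0) \<and> norm (z - x0) \<le> (1 - \<kappa>) * r)"
      using sub by blast
  qed
qed

end

section \<open>Competitors for the minimization problem\<close>

lemma powr_tangent:
  fixes x y p :: real
  assumes "x > 0" "y > 0" "p \<ge> 1"
  shows "x powr p + p * x powr (p - 1) * (y - x) \<le> y powr p"
proof -
  have d: "((\<lambda>z. z powr p) has_real_derivative p * z powr (p - 1)) (at z)" if "z > 0" for z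
    by (rule has_real_derivative_powr[OF that])
  consider "x = y" | "x < y" | "y < x" by linarith
  then show ?thesis
  proof cases
    case 2
    then obtain z where z: "x < z" "z < y" "y powr p - x powr p = (y - x) * (p * z powr (p - 1))"
      using MVT2[OF 2, of "\<lambda>z. z powr p" "\<lambda>z. p * z powr (p - 1)"] d assms(1) by (metis less_le_trans)
    have "x powr (p - 1) \<le> z powr (p - 1)" using z assms by (intro powr_mono2) auto
    then have "p * x powr (p - 1) * (y - x) \<le> p * z powr (p - 1) * (y - x)"
      using 2 assms by (intro mult_right_mono mult_left_mono) auto
    then show ?thesis using z(3) by (simp add: mult_ac)
  next
    case 3
    then obtain z where z: "y < z" "z < x" "x powr p - y powr p = (x - y) * (p * z powr (p - 1))"
      using MVT2[OF 3, of "\<lambda>z. z powr p" "\<lambda>z. p * z powr (p - 1)"] d assms(2) by (metis less_le_trans)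
    have "z powr (p - 1) \<le> x powr (p - 1)" using z assms by (intro powr_mono2) auto
    then have "p * z powr (p - 1) * (x - y) \<le> p * x powr (p - 1) * (x - y)"
      using 3 assms by (intro mult_right_mono mult_left_mono) auto
    then show ?thesis using z(3) by (simp add: algebra_simps)
  qed simp
qed

locale minimizer = free_boundary +
  assumes H10: "u \<in> H10 \<Omega>" and min: "minimizes_J_on_M \<Omega> p u"
begin

definition g :: "'a \<Rightarrow> 'a" where "g = weak_grad \<Omega> u"
abbreviation M :: "'a measure" where "M \<equiv> lebesgue_on \<Omega>"

text \<open>By the equation, \<open>source f\<close> is also the integral of \<open>\<nabla>u \<bullet> \<nabla>f\<close> for every test function \<open>f\<close> of \<open>E\<close>.\<close>

definition source :: "('a \<Rightarrow> real) \<Rightarrow> real" where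
  "source f = integral\<^sup>L M (\<lambda>x. indicat_real E x * ((u x - 1) powr (p - 1) * f x))"

definition energy :: "('a \<Rightarrow> real) \<Rightarrow> real" where
  "energy f = integral\<^sup>L M (\<lambda>x. (norm (grad f x))\<^sup>2)"

lemma sets_Omega: "\<Omega> \<in> sets lebesgue" using op by simp

lemma finite_M: "finite_measure M"
  using bd op by (intro finite_measure_lebesgue_on) (simp add: lmeasurable_open)

lemma g_weak: "has_weak_gradient \<Omega> u g"
  unfolding g_def using H10 by (intro weak_grad_has) (simp add: H10_def)

lemma g_measurable: "g \<in> borel_measurable M"
  by (rule weak_gradient_measurable[OF op g_weak])

lemma u_measurable: "u \<in> borel_measurable M"
  using borel_measurable_continuous_on_indicator[of \<Omega> u] continuous_u_Omega op
  by (subst borel_measurable_restrict_space_iff) (auto intro: borel_imp_lebesgue_measurable)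

lemma E_measurable: "E \<in> sets lebesgue" "E \<in> sets M"
  using open_E E_subset sets_restrict_space_iff[of \<Omega> lebesgue E] sets_Omega by auto

lemma u_bounded: obtains B where "B > 0" "\<And>x. x \<in> closure \<Omega> \<Longrightarrow> \<bar>u x\<bar> \<le> B"
proof -
  have "compact (u ` closure \<Omega>)" using bd continuous_u by (intro compact_continuous_image) auto
  then obtain B where B: "B > 0" "\<forall>y\<in>u ` closure \<Omega>. norm y \<le> B"
    using bounded_pos[THEN iffD1, OF compact_imp_bounded] by blast
  then show thesis by (intro that[OF B(1)]) auto
qed

lemma g_bounded: "AE x in M. norm (g x) \<le> DIM('a) * L"
proof -
  obtain B where B: "B > 0" "\<And>x. x \<in> closure \<Omega> \<Longrightarrow> \<bar>u x\<bar> \<le> B" using u_bounded by metis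
  have "AE x in lebesgue. \<forall>i\<in>Basis. x \<in> \<Omega> \<longrightarrow> \<bar>g x \<bullet> i\<bar> \<le> L"
  proof (rule AE_finite_allI[OF finite_Basis])
    fix i :: 'a assume i: "i \<in> Basis"
    show "AE x in lebesgue. x \<in> \<Omega> \<longrightarrow> \<bar>g x \<bullet> i\<bar> \<le> L"
      by (rule weak_gradient_le_lipschitz[OF op g_weak _ _ less_imp_le[OF B(1)] continuous_u_Omega i])
        (use lip B(2) Omega_closure in blast)+
  qed
  then have "AE x in lebesgue. x \<in> \<Omega> \<longrightarrow> norm (g x) \<le> DIM('a) * L"
  proof eventually_elim
    case (elim x)
    show ?case
    proof
      assume "x \<in> \<Omega>"
      have "norm (g x) \<le> (\<Sum>i\<in>Basis. \<bar>g x \<bullet> i\<bar>)" by (rule norm_le_l1)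
      also have "\<dots> \<le> (\<Sum>i\<in>(Basis::'a set). L)" by (rule sum_mono) (use elim \<open>x \<in> \<Omega>\<close> in blast)
      finally show "norm (g x) \<le> DIM('a) * L" by simp
    qed
  qed
  then show ?thesis using sets_Omega by (subst AE_restrict_space_iff) auto
qed

lemma integrable_AE_bounded:
  fixes f :: "'a \<Rightarrow> real"
  assumes "f \<in> borel_measurable M" "AE x in M. \<bar>f x\<bar> \<le> K"
  shows "integrable M f"
  using finite_measure.integrable_const_bound[OF finite_M, of f K] assms by simp

lemma integral_over_subset:
  fixes f :: "'a \<Rightarrow> real"
  assumes "A \<subseteq> \<Omega>"
  shows "(LINT x:A|lebesgue. f x) = integral\<^sup>L M (\<lambda>x. indicat_real A x * f x)"
proof -
  have "integral\<^sup>L M (\<lambda>x. indicat_real A x * f x) = (LINT x:\<Omega>|lebesgue. indicat_real A x * f x)"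
    by (rule set_integral_lebesgue_on[OF sets_Omega, symmetric])
  also have "\<dots> = (LINT x:A|lebesgue. f x)"
    unfolding set_lebesgue_integral_def using assms
    by (intro Bochner_Integration.integral_cong) (auto simp: indicator_def)
  finally show ?thesis by simp
qed

lemma weak_test:
  assumes "test_function \<Omega> \<phi>"
  shows "integrable M (\<lambda>x. g x \<bullet> grad \<phi> x)"
    "integral\<^sup>L M (\<lambda>x. g x \<bullet> grad \<phi> x) = - (LINT x:\<Omega>|lebesgue. u x * laplacian \<phi> x)"
proof -
  show "integrable M (\<lambda>x. g x \<bullet> grad \<phi> x)"
    using weak_gradient_laplacian(3)[OF g_weak assms] sets_Omega
    unfolding set_integrable_def by (subst integrable_restrict_space) auto
  show "integral\<^sup>L M (\<lambda>x. g x \<bullet> grad \<phi> x) = - (LINT x:\<Omega>|lebesgue. u x * laplacian \<phi> x)"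
    using weak_gradient_laplacian(1)[OF g_weak assms] by (simp add: set_integral_lebesgue_on[OF sets_Omega])
qed

lemma weak_test_E:
  assumes t: "test_function E \<psi>"
  shows "integral\<^sup>L M (\<lambda>x. g x \<bullet> grad \<psi> x) = integral\<^sup>L M (\<lambda>x. indicat_real E x * ((u x - 1) powr (p - 1) * \<psi> x))"
    "integrable M (\<lambda>x. indicat_real E x * ((u x - 1) powr (p - 1) * \<psi> x))"
proof -
  have lz: "laplacian \<psi> x = 0" if "x \<notin> E" for x
    by (rule test_function_off(1)[OF test_function_laplacian[OF t] that])
  have "integral\<^sup>L M (\<lambda>x. g x \<bullet> grad \<psi> x) = - (LINT x:\<Omega>|lebesgue. u x * laplacian \<psi> x)"
    by (rule weak_test(2)[OF test_function_mono[OF t E_subset]])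
  also have "(LINT x:\<Omega>|lebesgue. u x * laplacian \<psi> x) = (LINT x:E|lebesgue. u x * laplacian \<psi> x)"
  proof -
    have "(LINT x:\<Omega>|lebesgue. u x * laplacian \<psi> x) = (LINT x|lebesgue. u x * laplacian \<psi> x)"
      by (rule set_integral_of_support(1)) (simp add: lz[OF contra_subsetD[OF E_subset]])
    also have "\<dots> = (LINT x:E|lebesgue. u x * laplacian \<psi> x)"
      by (rule set_integral_of_support(1)[symmetric]) (simp add: lz)
    finally show ?thesis .
  qed
  finally show "integral\<^sup>L M (\<lambda>x. g x \<bullet> grad \<psi> x) = integral\<^sup>L M (\<lambda>x. indicat_real E x * ((u x - 1) powr (p - 1) * \<psi> x))"
    by (simp add: test_equation(1)[OF t] integral_over_subset[OF E_subset])
  have "integrable lebesgue (\<lambda>x. indicat_real E x * ((u x - 1) powr (p - 1) * \<psi> x))"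
    using test_equation(2)[OF t] by (simp add: set_integrable_def)
  then show "integrable M (\<lambda>x. indicat_real E x * ((u x - 1) powr (p - 1) * \<psi> x))"
    by (rule integrable_on_subset_measure[OF sets_Omega])
qed

lemma grad_test_bounded:
  assumes "test_function \<Omega>' \<phi>"
  obtains K where "K > 0" "\<And>x. norm (grad \<phi> x) \<le> K"
proof -
  obtain K where K: "compact K" "\<And>e x. x \<notin> K \<Longrightarrow> pd e \<phi> x = 0" using test_functionE[OF assms] by metis
  have "continuous_on UNIV (\<lambda>x. norm (grad \<phi> x))" by (intro continuous_on_norm grad_test_continuous[OF assms])
  then obtain B where "B > 0" "\<And>x. \<bar>norm (grad \<phi> x)\<bar> \<le> B"
    using bounded_range_if_compact_support[of "\<lambda>x. norm (grad \<phi> x)" K] K by (auto simp: grad_def)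
  then show thesis by (intro that[of B]) auto
qed

end

text \<open>The two-parameter competitor \<open>u + t \<phi> + \<tau> \<psi>\<close>: \<open>\<phi>\<close> raises \<open>u\<close> in \<open>A\<close>, a ball about a free boundary point, and \<open>\<psi>\<close>,
supported in a compact part \<open>Q\<close> of \<open>E\<close> disjoint from \<open>A\<close>, readjusts the constraint. For
\<open>\<bar>\<tau>\<bar> \<le> (1 - \<mu>) \<eta>\<close> the competitor is at least \<open>1 + \<mu> (u - 1)\<close> on \<open>Q\<close>.\<close>

locale variation = minimizer +
  fixes \<psi> :: "'a \<Rightarrow> real" and Q :: "'a set" and \<eta> \<mu> :: real
    and \<phi> :: "'a \<Rightarrow> real" and A :: "'a set" and t :: real
  assumes \<psi>: "test_function E \<psi>" "\<And>x. 0 \<le> \<psi> x" "\<And>x. \<psi> x \<le> 1"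
      "\<And>x. x \<notin> Q \<Longrightarrow> \<psi> x = 0" "\<And>x. x \<notin> Q \<Longrightarrow> grad \<psi> x = 0"
    and Q: "Q \<subseteq> E" "Q \<in> sets lebesgue" "\<And>x. x \<in> Q \<Longrightarrow> \<eta> \<le> u x - 1"
    and \<eta>: "\<eta> > 0" and \<mu>: "0 < \<mu>" "\<mu> < 1"
    and \<phi>: "test_function A \<phi>" "\<And>x. 0 \<le> \<phi> x"
    and A: "A \<subseteq> \<Omega>" "A \<inter> Q = {}" "A \<in> sets lebesgue" "bounded A"
    and t: "t \<ge> 0"
begin

definition E1 :: "'a set" where "E1 = above1 \<Omega> (\<lambda>x. u x + t * \<phi> x)"

text \<open>The integral of \<open>gap \<tau>\<close> is the amount by which \<open>u + t \<phi> + \<tau> \<psi>\<close> violates the constraint. The set \<open>E1\<close> is free of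
\<open>\<tau>\<close>, because on \<open>Q\<close> the competitor exceeds 1 for all admissible \<open>\<tau>\<close>.\<close>

definition gap :: "real \<Rightarrow> 'a \<Rightarrow> real" where
  "gap \<tau> x = indicat_real E1 x *
     ((norm (g x + t *\<^sub>R grad \<phi> x + \<tau> *\<^sub>R grad \<psi> x))\<^sup>2 - (u x + t * \<phi> x + \<tau> * \<psi> x - 1) powr p)"

lemma off_A: "x \<notin> A \<Longrightarrow> \<phi> x = 0" "x \<notin> A \<Longrightarrow> grad \<phi> x = 0"
  using test_function_off[OF \<phi>(1)] by (auto simp: grad_def)

lemma grad_orthogonal: "grad \<phi> x \<bullet> grad \<psi> x = 0"
proof (cases "x \<in> Q")
  case True
  then have "x \<notin> A" using A(2) by blast
  then show ?thesis by (simp add: off_A(2))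
qed (simp add: \<psi>(5))

lemma E_E1: "E \<subseteq> E1"
  unfolding E1_def above1_def E_def using \<phi>(2) t by (auto intro: add_strict_increasing2 less_le_trans)

lemma E1_E: "E1 \<subseteq> E \<union> (A - E)"
  unfolding E1_def above1_def using off_A(1) by (auto simp: E_def above1_def)

lemma E1_Omega: "E1 \<subseteq> \<Omega>" by (auto simp: E1_def above1_def)

lemma on_Q:
  assumes "x \<in> Q" "\<bar>\<tau>\<bar> \<le> (1 - \<mu>) * \<eta>"
  shows "\<phi> x = 0" "grad \<phi> x = 0" "x \<in> E" "0 < u x - 1" "\<mu> * (u x - 1) \<le> u x - 1 + \<tau> * \<psi> x"
    "0 < u x - 1 + \<tau> * \<psi> x"
proof -
  have "x \<notin> A" using assms(1) A(2) by blast
  then show "\<phi> x = 0" "grad \<phi> x = 0" by (rule off_A)+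
  show xE: "x \<in> E" using assms(1) Q(1) by blast
  show pos: "0 < u x - 1" using u_gt1[OF xE] by simp
  have "\<bar>\<tau> * \<psi> x\<bar> \<le> ((1 - \<mu>) * \<eta>) * 1"
    unfolding abs_mult using assms(2) \<psi>(2,3)[of x] by (intro mult_mono) auto
  also have "\<dots> \<le> (1 - \<mu>) * (u x - 1)" using Q(3)[OF assms(1)] \<mu> by (simp add: mult_left_mono)
  finally show "\<mu> * (u x - 1) \<le> u x - 1 + \<tau> * \<psi> x" by (simp add: algebra_simps abs_le_iff)
  moreover have "0 < \<mu> * (u x - 1)" using pos \<mu> by simp
  ultimately show "0 < u x - 1 + \<tau> * \<psi> x" by linarith
qed

lemma measurable_facts:
  "u \<in> borel_measurable M" "g \<in> borel_measurable M" "\<phi> \<in> borel_measurable M" "\<psi> \<in> borel_measurable M"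
  "grad \<phi> \<in> borel_measurable M" "grad \<psi> \<in> borel_measurable M"
  "indicat_real E \<in> borel_measurable M" "indicat_real E1 \<in> borel_measurable M" "indicat_real Q \<in> borel_measurable M"
  "indicat_real (A - E) \<in> borel_measurable M"
proof -
  show u: "u \<in> borel_measurable M" by (rule u_measurable)
  show "g \<in> borel_measurable M" by (rule g_measurable)
  show p: "\<phi> \<in> borel_measurable M" "\<psi> \<in> borel_measurable M"
    "grad \<phi> \<in> borel_measurable M" "grad \<psi> \<in> borel_measurable M"
    using test_function_measurable grad_test_measurable \<phi>(1) \<psi>(1) measurable_restrict_space1 by blast+
  have sM: "S \<inter> \<Omega> \<in> sets M" if "S \<in> sets lebesgue" for S
    using that sets_restrict_space_iff[of \<Omega> lebesgue "S \<inter> \<Omega>"] sets_Omega by auto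
  have "E1 = {x \<in> space M. 1 < u x + t * \<phi> x}" by (auto simp: E1_def above1_def)
  moreover have "(\<lambda>x. u x + t * \<phi> x) \<in> borel_measurable M" using u p(1) by measurable
  ultimately have "E1 \<in> sets M" using borel_measurable_less[of "\<lambda>_. 1" M "\<lambda>x. u x + t * \<phi> x"] by simp
  then show "indicat_real E1 \<in> borel_measurable M" by (rule borel_measurable_indicator)
  show "indicat_real E \<in> borel_measurable M" by (rule borel_measurable_indicator[OF E_measurable(2)])
  have "Q \<inter> \<Omega> = Q" using Q(1) E_subset by blast
  then show "indicat_real Q \<in> borel_measurable M" using sM[OF Q(2)] by simp
  have "(A - E) \<inter> \<Omega> = A - E" using A(1) by blast
  moreover have "A - E \<in> sets lebesgue" using A(3) E_measurable(1) by (rule sets.Diff)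
  ultimately show "indicat_real (A - E) \<in> borel_measurable M" using sM[of "A - E"] by simp
qed

lemma gap_measurable: "gap \<tau> \<in> borel_measurable M"
proof -
  note [measurable] = measurable_facts
  show ?thesis unfolding gap_def[abs_def] by measurable
qed

lemma indicator_E_integrals:
  "integral\<^sup>L M (\<lambda>x. indicat_real E x * (norm (g x))\<^sup>2) = integral\<^sup>L M (\<lambda>x. indicat_real E x * (u x - 1) powr p)"
  "integral\<^sup>L M (\<lambda>x. indicat_real E x * (u x - 1) powr p) > 0"
proof -
  have "u \<in> M_set \<Omega> p" using min by (simp add: minimizes_J_on_M_def)
  then have "(LINT x:E|lebesgue. (norm (g x))\<^sup>2) = (LINT x:E|lebesgue. (u x - 1) powr p)"
    "0 < (LINT x:E|lebesgue. (u x - 1) powr p)"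
    by (auto simp: M_set_def E_def g_def)
  then show "integral\<^sup>L M (\<lambda>x. indicat_real E x * (norm (g x))\<^sup>2) = integral\<^sup>L M (\<lambda>x. indicat_real E x * (u x - 1) powr p)"
    "integral\<^sup>L M (\<lambda>x. indicat_real E x * (u x - 1) powr p) > 0"
    by (simp_all only: integral_over_subset[OF E_subset])
qed

lemma bounds:
  obtains K where "K > 0" "AE x in M. norm (g x) \<le> K"
    "\<And>x. x \<in> \<Omega> \<Longrightarrow> \<bar>u x - 1\<bar> \<le> K" "\<And>x. \<phi> x \<le> K" "\<And>x. norm (grad \<phi> x) \<le> K" "\<And>x. norm (grad \<psi> x) \<le> K"
proof -
  obtain B where B: "B > 0" "\<And>x. x \<in> closure \<Omega> \<Longrightarrow> \<bar>u x\<bar> \<le> B" using u_bounded by metis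
  obtain B1 where B1: "B1 > 0" "\<And>x. \<bar>\<phi> x\<bar> \<le> B1" using test_function_bounded[OF \<phi>(1)] by metis
  obtain B2 where B2: "B2 > 0" "\<And>x. norm (grad \<phi> x) \<le> B2" using grad_test_bounded[OF \<phi>(1)] by metis
  obtain B3 where B3: "B3 > 0" "\<And>x. norm (grad \<psi> x) \<le> B3" using grad_test_bounded[OF \<psi>(1)] by metis
  define K where "K = DIM('a) * L + (B + 1) + B1 + B2 + B3"
  have nn: "0 \<le> DIM('a) * L" using L by simp
  show thesis
  proof (rule that[of K])
    show "K > 0" using nn B B1 B2 B3 by (simp add: K_def)
    show "AE x in M. norm (g x) \<le> K" using g_bounded by eventually_elim (use B B1 B2 B3 in \<open>simp add: K_def\<close>)
    show "\<bar>u x - 1\<bar> \<le> K" if "x \<in> \<Omega>" for x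
      using B(2)[OF Omega_closure[OF that]] nn B1 B2 B3 unfolding K_def by linarith
    show "\<phi> x \<le> K" for x using B1(2)[of x] nn B B2 B3 unfolding K_def by linarith
    show "norm (grad \<phi> x) \<le> K" for x using B2(2)[of x] nn B B1 B3 unfolding K_def by linarith
    show "norm (grad \<psi> x) \<le> K" for x using B3(2)[of x] nn B B2 B1 unfolding K_def by linarith
  qed
qed

lemma integrable_pieces:
  "integrable M (\<lambda>x. g x \<bullet> grad \<phi> x)" "integrable M (\<lambda>x. g x \<bullet> grad \<psi> x)"
  "integrable M (\<lambda>x. (norm (grad \<phi> x))\<^sup>2)" "integrable M (\<lambda>x. (norm (grad \<psi> x))\<^sup>2)"
  "integrable M (\<lambda>x. indicat_real E x * ((u x - 1) powr (p - 1) * \<psi> x))"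
  "integrable M (indicat_real (A - E))"
proof -
  show "integrable M (\<lambda>x. g x \<bullet> grad \<phi> x)" "integrable M (\<lambda>x. g x \<bullet> grad \<psi> x)"
    using weak_test(1) test_function_mono[OF \<phi>(1) A(1)] test_function_mono[OF \<psi>(1) E_subset] by blast+
  show "integrable M (\<lambda>x. (norm (grad \<phi> x))\<^sup>2)" "integrable M (\<lambda>x. (norm (grad \<psi> x))\<^sup>2)"
    using integrable_on_subset_measure[OF sets_Omega grad_test_square_integrable] \<phi>(1) \<psi>(1) by blast+
  show "integrable M (\<lambda>x. indicat_real E x * ((u x - 1) powr (p - 1) * \<psi> x))" by (rule weak_test_E(2)[OF \<psi>(1)])
  show "integrable M (indicat_real (A - E))"
    by (rule integrable_AE_bounded[OF measurable_facts(10), of 1]) (simp add: indicator_def)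
qed

lemma norm_expand:
  "(norm (g x + t *\<^sub>R grad \<phi> x + \<tau> *\<^sub>R grad \<psi> x))\<^sup>2 =
    (norm (g x))\<^sup>2 + 2 * t * (g x \<bullet> grad \<phi> x) + t\<^sup>2 * (norm (grad \<phi> x))\<^sup>2
    + 2 * \<tau> * (g x \<bullet> grad \<psi> x) + \<tau>\<^sup>2 * (norm (grad \<psi> x))\<^sup>2"
proof -
  have c: "grad \<phi> x \<bullet> g x = g x \<bullet> grad \<phi> x" "grad \<psi> x \<bullet> g x = g x \<bullet> grad \<psi> x"
    "grad \<phi> x \<bullet> grad \<psi> x = 0" "grad \<psi> x \<bullet> grad \<phi> x = 0"
    using grad_orthogonal[of x] by (simp_all add: inner_commute)
  show ?thesis
    by (simp only: power2_norm_eq_inner inner_add_left inner_add_right inner_scaleR_left inner_scaleR_right c) algebra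
qed

lemma integrable_AE_le:
  assumes "f \<in> borel_measurable M" "AE x in M. norm (g x) \<le> K"
    "\<And>x. x \<in> \<Omega> \<Longrightarrow> norm (g x) \<le> K \<Longrightarrow> \<bar>f x\<bar> \<le> (C::real)"
  shows "integrable M f"
proof (rule integrable_AE_bounded[OF assms(1)])
  have "AE x in M. x \<in> \<Omega>" using AE_space[of M] by simp
  with assms(2) show "AE x in M. \<bar>f x\<bar> \<le> C"
    by eventually_elim (rule assms(3))
qed

text \<open>The terms linear in \<open>\<tau>\<close> cancel: the energy contributes \<open>\<tau> source \<psi>\<close> and, by convexity of the power, the potential at
most \<open>- \<tau> source \<psi>\<close>. On \<open>A\<close> the competitor is above \<open>u\<close>, so there the potential term can only decrease \<open>J\<close>.\<close>

lemma competitor_inequality: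
  assumes \<tau>: "\<bar>\<tau>\<bar> \<le> (1 - \<mu>) * \<eta>" and zero: "integral\<^sup>L M (gap \<tau>) = 0"
  shows "0 \<le> t * integral\<^sup>L M (\<lambda>x. g x \<bullet> grad \<phi> x) + t\<^sup>2 / 2 * energy \<phi>
    + integral\<^sup>L M (indicat_real (A - E)) + \<tau>\<^sup>2 / 2 * energy \<psi>"
proof -
  obtain K where K: "K > 0" "AE x in M. norm (g x) \<le> K"
    "\<And>x. x \<in> \<Omega> \<Longrightarrow> \<bar>u x - 1\<bar> \<le> K" "\<And>x. \<phi> x \<le> K" "\<And>x. norm (grad \<phi> x) \<le> K" "\<And>x. norm (grad \<psi> x) \<le> K"
    using bounds by metis
  note [measurable] = measurable_facts
  have t\<phi>: "test_function \<Omega> \<phi>" by (rule test_function_mono[OF \<phi>(1) A(1)])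
  have t\<psi>: "test_function \<Omega> \<psi>" by (rule test_function_mono[OF \<psi>(1) E_subset])
  define \<theta> where "\<theta> x = t * \<phi> x + \<tau> * \<psi> x" for x
  have t\<theta>: "test_function \<Omega> \<theta>" unfolding \<theta>_def[abs_def] by (rule test_function_lincomb[OF t\<phi> t\<psi>])
  define v where "v x = u x + \<theta> x" for x
  have vH: "v \<in> H10 \<Omega>" unfolding v_def[abs_def] by (rule H10_add_test(1)[OF op H10 t\<theta>])
  define gv where "gv x = g x + t *\<^sub>R grad \<phi> x + \<tau> *\<^sub>R grad \<psi> x" for x
  have gvm[measurable]: "gv \<in> borel_measurable M" unfolding gv_def[abs_def] by measurable
  have vm[measurable]: "v \<in> borel_measurable M" unfolding v_def[abs_def] \<theta>_def[abs_def] by measurable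
  have wgm[measurable]: "weak_grad \<Omega> v \<in> borel_measurable M"
    using weak_gradient_measurable[OF op weak_grad_has] vH by (simp add: H10_def)
  have ae: "AE x in M. weak_grad \<Omega> v x = gv x"
  proof -
    have "grad \<theta> x = t *\<^sub>R grad \<phi> x + \<tau> *\<^sub>R grad \<psi> x" for x
      unfolding \<theta>_def[abs_def] by (rule grad_lincomb[OF t\<phi> t\<psi>])
    then show ?thesis using H10_add_test(2)[OF op H10 t\<theta>]
      unfolding v_def[abs_def, symmetric] g_def[symmetric] gv_def by (simp add: add.assoc)
  qed
  have v1: "v x - 1 = u x + t * \<phi> x + \<tau> * \<psi> x - 1" for x by (simp add: v_def \<theta>_def)
  have Ev: "above1 \<Omega> v = E1"
  proof -
    have "1 < v x \<longleftrightarrow> 1 < u x + t * \<phi> x" for x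
    proof (cases "x \<in> Q")
      case True
      then show ?thesis using on_Q[OF True \<tau>] v1[of x] by simp
    next
      case False
      then show ?thesis using v1[of x] \<psi>(4)[OF False] by simp
    qed
    then show ?thesis by (auto simp: above1_def E1_def)
  qed
  have vlow: "\<mu> * (u x - 1) \<le> v x - 1" if "x \<in> E" for x
  proof (cases "x \<in> Q")
    case True
    then show ?thesis using on_Q[OF True \<tau>] v1[of x] by simp
  next
    case False
    have "\<mu> * (u x - 1) \<le> 1 * (u x - 1)" using \<mu> u_gt1[OF that] by (intro mult_right_mono) auto
    moreover have "0 \<le> t * \<phi> x" using t \<phi>(2) by simp
    ultimately show ?thesis using v1[of x] \<psi>(4)[OF False] by simp
  qed
  have vK: "\<bar>v x - 1\<bar> \<le> K + t * K + \<bar>\<tau>\<bar>" if "x \<in> \<Omega>" for x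
  proof -
    have "\<bar>t * \<phi> x\<bar> \<le> t * K" using t \<phi>(2)[of x] K(4)[of x] by (simp add: abs_mult mult_left_mono)
    moreover have "\<bar>\<tau> * \<psi> x\<bar> \<le> \<bar>\<tau>\<bar> * 1" unfolding abs_mult using \<psi>(2,3)[of x] by (intro mult_left_mono) auto
    ultimately show ?thesis using K(3)[OF that] v1[of x] by linarith
  qed
  have gvK: "norm (gv x) \<le> K + t * K + \<bar>\<tau>\<bar> * K" if "norm (g x) \<le> K" for x
  proof -
    have "norm (gv x) \<le> norm (g x) + norm (t *\<^sub>R grad \<phi> x) + norm (\<tau> *\<^sub>R grad \<psi> x)"
      unfolding gv_def by (rule order_trans[OF norm_triangle_ineq add_right_mono[OF norm_triangle_ineq]])
    moreover have "norm (t *\<^sub>R grad \<phi> x) \<le> t * K" using t K(5)[of x] by (simp add: mult_left_mono)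
    moreover have "norm (\<tau> *\<^sub>R grad \<psi> x) \<le> \<bar>\<tau>\<bar> * K" using K(6)[of x] by (simp add: mult_left_mono)
    ultimately show ?thesis using that by linarith
  qed
  define K1 where "K1 = K + t * K + \<bar>\<tau>\<bar> * K + \<bar>\<tau>\<bar>"
  have K1: "K1 \<ge> 0" "K \<le> K1" using K(1) t by (simp_all add: K1_def)
  have gvK1: "(norm (gv x))\<^sup>2 \<le> K1\<^sup>2" if "norm (g x) \<le> K" for x
  proof (rule power_mono)
    show "norm (gv x) \<le> K1" using gvK[OF that] unfolding K1_def by linarith
  qed simp
  have gK1: "(norm (g x))\<^sup>2 \<le> K1\<^sup>2" if "norm (g x) \<le> K" for x
    by (rule power_mono) (use that K1 in auto)
  have vK1: "\<bar>v x - 1\<bar> powr p \<le> K1 powr p" if "x \<in> \<Omega>" for x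
  proof (rule powr_mono2)
    have "0 \<le> \<bar>\<tau>\<bar> * K" using K(1) by simp
    then show "\<bar>v x - 1\<bar> \<le> K1" using vK[OF that] unfolding K1_def by linarith
  qed (use p in auto)
  have uK1: "\<bar>u x - 1\<bar> powr p \<le> K1 powr p" if "x \<in> \<Omega>" for x
    by (rule powr_mono2) (use K(3)[OF that] K1 p in auto)
  have i1: "integrable M (\<lambda>x. indicat_real E1 x * (norm (gv x))\<^sup>2)"
  proof (rule integrable_AE_le[OF _ K(2), of _ "K1\<^sup>2"])
    show "\<bar>indicat_real E1 x * (norm (gv x))\<^sup>2\<bar> \<le> K1\<^sup>2" if "norm (g x) \<le> K" for x
      using gvK1[OF that] by (simp add: indicator_def)
  qed measurable
  have i2: "integrable M (\<lambda>x. indicat_real E1 x * (v x - 1) powr p)"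
  proof (rule integrable_AE_le[OF _ K(2), of _ "K1 powr p"])
    show "\<bar>indicat_real E1 x * (v x - 1) powr p\<bar> \<le> K1 powr p" if x: "x \<in> \<Omega>" for x
    proof (cases "x \<in> E1")
      case True
      then have "x \<in> above1 \<Omega> v" using Ev by simp
      then have "0 \<le> v x - 1" by (simp add: above1_def)
      then show ?thesis using vK1[OF x] True by simp
    qed simp
  qed measurable
  have "v \<in> M_set \<Omega> p"
  proof -
    have "(LINT x:E1|lebesgue. (norm (weak_grad \<Omega> v x))\<^sup>2) = integral\<^sup>L M (\<lambda>x. indicat_real E1 x * (norm (weak_grad \<Omega> v x))\<^sup>2)"
      by (rule integral_over_subset[OF E1_Omega])
    also have "\<dots> = integral\<^sup>L M (\<lambda>x. indicat_real E1 x * (norm (gv x))\<^sup>2)"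
    proof (rule integral_cong_AE)
      show "AE x in M. indicat_real E1 x * (norm (weak_grad \<Omega> v x))\<^sup>2 = indicat_real E1 x * (norm (gv x))\<^sup>2"
        using ae by eventually_elim simp
    qed measurable
    finally have a: "(LINT x:E1|lebesgue. (norm (weak_grad \<Omega> v x))\<^sup>2) = integral\<^sup>L M (\<lambda>x. indicat_real E1 x * (norm (gv x))\<^sup>2)" .
    have b: "(LINT x:E1|lebesgue. (v x - 1) powr p) = integral\<^sup>L M (\<lambda>x. indicat_real E1 x * (v x - 1) powr p)"
      by (rule integral_over_subset[OF E1_Omega])
    have "integral\<^sup>L M (gap \<tau>) = integral\<^sup>L M (\<lambda>x. indicat_real E1 x * (norm (gv x))\<^sup>2 - indicat_real E1 x * (v x - 1) powr p)"
      unfolding gap_def gv_def v1 right_diff_distrib by (rule refl)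
    also have "\<dots> = integral\<^sup>L M (\<lambda>x. indicat_real E1 x * (norm (gv x))\<^sup>2) - integral\<^sup>L M (\<lambda>x. indicat_real E1 x * (v x - 1) powr p)"
      by (rule Bochner_Integration.integral_diff[OF i1 i2])
    finally have c: "integral\<^sup>L M (\<lambda>x. indicat_real E1 x * (norm (gv x))\<^sup>2) = integral\<^sup>L M (\<lambda>x. indicat_real E1 x * (v x - 1) powr p)"
      using zero by simp
    have "0 < \<mu> powr p * integral\<^sup>L M (\<lambda>x. indicat_real E x * (u x - 1) powr p)"
      using indicator_E_integrals(2) \<mu> by simp
    also have "\<dots> = integral\<^sup>L M (\<lambda>x. \<mu> powr p * (indicat_real E x * (u x - 1) powr p))" by simp
    also have "\<dots> \<le> integral\<^sup>L M (\<lambda>x. indicat_real E1 x * (v x - 1) powr p)"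
    proof (rule integral_mono[OF _ i2])
      have "integrable M (\<lambda>x. indicat_real E x * (u x - 1) powr p)"
        using indicator_E_integrals(2) not_integrable_integral_eq by force
      then show "integrable M (\<lambda>x. \<mu> powr p * (indicat_real E x * (u x - 1) powr p))" by (rule integrable_mult_right)
      show "\<mu> powr p * (indicat_real E x * (u x - 1) powr p) \<le> indicat_real E1 x * (v x - 1) powr p" for x
      proof (cases "x \<in> E")
        case True
        have "(\<mu> * (u x - 1)) powr p \<le> (v x - 1) powr p"
          using vlow[OF True] \<mu> u_gt1[OF True] p by (intro powr_mono2) auto
        then show ?thesis using True E_E1 u_gt1[OF True] \<mu> by (auto simp: powr_mult)
      qed simp
    qed
    finally have "0 < integral\<^sup>L M (\<lambda>x. indicat_real E1 x * (v x - 1) powr p)" .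
    with vH a b c show ?thesis by (simp add: M_set_def Ev)
  qed
  then have J: "J_fun \<Omega> p u \<le> J_fun \<Omega> p v" using min by (simp add: minimizes_J_on_M_def)
  define jv where "jv x = 1/2 * (norm (gv x))\<^sup>2 + indicat_real E1 x - 1/p * (max (v x - 1) 0) powr p" for x
  define ju where "ju x = 1/2 * (norm (g x))\<^sup>2 + indicat_real E x - 1/p * (max (u x - 1) 0) powr p" for x
  have Ju: "J_fun \<Omega> p u = integral\<^sup>L M ju"
    unfolding J_fun_def ju_def E_def g_def by (rule set_integral_lebesgue_on[OF sets_Omega])
  have Jv: "J_fun \<Omega> p v = integral\<^sup>L M jv"
    unfolding J_fun_def set_integral_lebesgue_on[OF sets_Omega] Ev
  proof (rule integral_cong_AE)
    show "jv \<in> borel_measurable M" unfolding jv_def[abs_def] by measurable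
    show "AE x in M. 1 / 2 * (norm (weak_grad \<Omega> v x))\<^sup>2 + indicat_real E1 x - 1 / p * max (v x - 1) 0 powr p = jv x"
      using ae by eventually_elim (simp add: jv_def)
  qed measurable
  have ij: "integrable M (\<lambda>x. 1/2 * (norm (G x))\<^sup>2 + indicat_real S x - 1/p * (max (f x - 1) 0) powr p)"
    if m: "G \<in> borel_measurable M" "f \<in> borel_measurable M" "indicat_real S \<in> borel_measurable M"
      and b: "\<And>x. norm (g x) \<le> K \<Longrightarrow> (norm (G x))\<^sup>2 \<le> K1\<^sup>2" "\<And>x. x \<in> \<Omega> \<Longrightarrow> \<bar>f x - 1\<bar> powr p \<le> K1 powr p"
    for G :: "'a \<Rightarrow> 'a" and f S
  proof (rule integrable_AE_le[OF _ K(2), of _ "K1\<^sup>2 + 1 + K1 powr p"])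
    note [measurable] = m
    show "(\<lambda>x. 1/2 * (norm (G x))\<^sup>2 + indicat_real S x - 1/p * (max (f x - 1) 0) powr p) \<in> borel_measurable M"
      by measurable
    fix x assume x: "x \<in> \<Omega>" "norm (g x) \<le> K"
    have "(max (f x - 1) 0) powr p \<le> \<bar>f x - 1\<bar> powr p" using p by (intro powr_mono2) auto
    then have "(max (f x - 1) 0) powr p \<le> K1 powr p" using b(2)[OF x(1)] by linarith
    then have "1/p * (max (f x - 1) 0) powr p \<le> 1 * K1 powr p" using p by (intro mult_mono) auto
    moreover have "0 \<le> 1/p * (max (f x - 1) 0) powr p" using p by simp
    moreover have "0 \<le> (norm (G x))\<^sup>2" "0 \<le> indicat_real S x" "indicat_real S x \<le> 1" by (simp_all add: indicator_def)
    ultimately show "\<bar>1/2 * (norm (G x))\<^sup>2 + indicat_real S x - 1/p * (max (f x - 1) 0) powr p\<bar> \<le> K1\<^sup>2 + 1 + K1 powr p"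
      using b(1)[OF x(2)] unfolding abs_le_iff by (intro conjI) linarith+
  qed
  have ijv: "integrable M jv" unfolding jv_def[abs_def]
    by (rule ij) (use gvm vm measurable_facts(8) gvK1 vK1 in auto)
  have iju: "integrable M ju" unfolding ju_def[abs_def]
    by (rule ij) (use measurable_facts(1,2,7) gK1 uK1 in auto)
  define w where "w x = indicat_real E x * ((u x - 1) powr (p - 1) * \<psi> x)" for x
  have iw: "integrable M w" unfolding w_def[abs_def] by (rule integrable_pieces(5))
  have wI: "integral\<^sup>L M w = source \<psi>" unfolding w_def[abs_def] source_def by (rule refl)
  have pI: "integral\<^sup>L M (\<lambda>x. g x \<bullet> grad \<psi> x) = source \<psi>" unfolding source_def by (rule weak_test_E(1)[OF \<psi>(1)])
  have pw: "jv x - ju x \<le> (t * (g x \<bullet> grad \<phi> x) + t\<^sup>2 / 2 * (norm (grad \<phi> x))\<^sup>2)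
     + (\<tau> * (g x \<bullet> grad \<psi> x) + \<tau>\<^sup>2 / 2 * (norm (grad \<psi> x))\<^sup>2) + (indicat_real (A - E) x - \<tau> * w x)" for x
  proof -
    have ex: "1/2 * (norm (gv x))\<^sup>2 = 1/2 * (norm (g x))\<^sup>2 + (t * (g x \<bullet> grad \<phi> x) + t\<^sup>2 / 2 * (norm (grad \<phi> x))\<^sup>2)
     + (\<tau> * (g x \<bullet> grad \<psi> x) + \<tau>\<^sup>2 / 2 * (norm (grad \<psi> x))\<^sup>2)"
      unfolding gv_def norm_expand by (simp add: algebra_simps)
    have ind: "indicat_real E1 x - indicat_real E x \<le> indicat_real (A - E) x"
      using E1_E by (auto simp: indicator_def)
    have pot: "\<tau> * w x \<le> 1/p * (max (v x - 1) 0) powr p - 1/p * (max (u x - 1) 0) powr p"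
    proof (cases "x \<in> Q")
      case True
      note q = on_Q[OF True \<tau>]
      have v': "v x - 1 = u x - 1 + \<tau> * \<psi> x" using v1[of x] q(1) by simp
      have "(u x - 1) powr p + p * (u x - 1) powr (p - 1) * ((u x - 1 + \<tau> * \<psi> x) - (u x - 1)) \<le> (u x - 1 + \<tau> * \<psi> x) powr p"
        by (rule powr_tangent[OF q(4,6)]) (use p in simp)
      then have "p * (\<tau> * w x) \<le> (v x - 1) powr p - (u x - 1) powr p"
        unfolding v' w_def using q(3) by (simp add: mult_ac)
      then have "\<tau> * w x \<le> ((v x - 1) powr p - (u x - 1) powr p) / p" using p by (simp add: pos_le_divide_eq mult.commute)
      moreover have "max (v x - 1) 0 = v x - 1" "max (u x - 1) 0 = u x - 1" unfolding v' using q(4,6) by simp_all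
      ultimately show ?thesis by (simp add: diff_divide_distrib)
    next
      case False
      have "w x = 0" by (simp add: w_def \<psi>(4)[OF False])
      moreover have "u x \<le> v x" using v1[of x] \<psi>(4)[OF False] t \<phi>(2)[of x] by simp
      then have "(max (u x - 1) 0) powr p \<le> (max (v x - 1) 0) powr p" using p by (intro powr_mono2) auto
      then have "1/p * (max (u x - 1) 0) powr p \<le> 1/p * (max (v x - 1) 0) powr p" using p by (intro mult_left_mono) auto
      ultimately show ?thesis by simp
    qed
    show ?thesis unfolding jv_def ju_def ex using ind pot by linarith
  qed
  have "0 \<le> integral\<^sup>L M jv - integral\<^sup>L M ju" using J Ju Jv by simp
  also have "\<dots> = integral\<^sup>L M (\<lambda>x. jv x - ju x)" by (rule Bochner_Integration.integral_diff[OF ijv iju, symmetric])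
  also have "\<dots> \<le> integral\<^sup>L M (\<lambda>x. (t * (g x \<bullet> grad \<phi> x) + t\<^sup>2 / 2 * (norm (grad \<phi> x))\<^sup>2)
     + (\<tau> * (g x \<bullet> grad \<psi> x) + \<tau>\<^sup>2 / 2 * (norm (grad \<psi> x))\<^sup>2) + (indicat_real (A - E) x - \<tau> * w x))"
    by (rule integral_mono[OF _ _ pw])
      (intro Bochner_Integration.integrable_diff Bochner_Integration.integrable_add integrable_mult_right
        ijv iju integrable_pieces iw)+
  also have "\<dots> = (t * integral\<^sup>L M (\<lambda>x. g x \<bullet> grad \<phi> x) + t\<^sup>2 / 2 * integral\<^sup>L M (\<lambda>x. (norm (grad \<phi> x))\<^sup>2))
     + (\<tau> * source \<psi> + \<tau>\<^sup>2 / 2 * energy \<psi>) + (integral\<^sup>L M (indicat_real (A - E)) - \<tau> * source \<psi>)"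
    using integrable_pieces iw
    by (simp add: pI wI energy_def Bochner_Integration.integral_add Bochner_Integration.integral_diff)
  finally show ?thesis by (simp add: energy_def)
qed

end

section \<open>Returning to the constraint\<close>

context variation
begin

lemma gap_split:
  assumes "\<bar>\<tau>\<bar> \<le> (1 - \<mu>) * \<eta>"
  shows "gap \<tau> x = gap 0 x + 2 * \<tau> * (g x \<bullet> grad \<psi> x) + \<tau>\<^sup>2 * (norm (grad \<psi> x))\<^sup>2
    - indicat_real Q x * ((u x - 1 + \<tau> * \<psi> x) powr p - (u x - 1) powr p)"
proof (cases "x \<in> Q")
  case True
  note q = on_Q[OF True assms]
  have "x \<in> E1" using q(3) E_E1 by blast
  moreover have e: "u x + t * \<phi> x + \<sigma> * \<psi> x - 1 = u x - 1 + \<sigma> * \<psi> x" for \<sigma> using q(1) by simp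
  ultimately show ?thesis unfolding gap_def norm_expand e using True q(2) by simp
next
  case False
  then show ?thesis by (simp add: gap_def \<psi>(4,5))
qed

lemma gap_integrable:
  assumes \<tau>: "\<bar>\<tau>\<bar> \<le> (1 - \<mu>) * \<eta>"
  shows "integrable M (gap \<tau>)"
proof -
  obtain K where K: "K > 0" "AE x in M. norm (g x) \<le> K"
    "\<And>x. x \<in> \<Omega> \<Longrightarrow> \<bar>u x - 1\<bar> \<le> K" "\<And>x. \<phi> x \<le> K" "\<And>x. norm (grad \<phi> x) \<le> K" "\<And>x. norm (grad \<psi> x) \<le> K"
    using bounds by metis
  define K1 where "K1 = K + t * K + \<bar>\<tau>\<bar> * K"
  define K2 where "K2 = K + t * K + \<bar>\<tau>\<bar>"
  show ?thesis
  proof (rule integrable_AE_le[OF gap_measurable K(2)])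
    fix x assume x: "x \<in> \<Omega>" "norm (g x) \<le> K"
    show "\<bar>gap \<tau> x\<bar> \<le> K1\<^sup>2 + K2 powr p"
    proof (cases "x \<in> E1")
      case True
      define b where "b = u x + t * \<phi> x + \<tau> * \<psi> x - 1"
      have b0: "0 < b"
      proof (cases "x \<in> Q")
        case xQ: True
        then show ?thesis using on_Q(1,6)[OF xQ \<tau>] by (simp add: b_def)
      next
        case False
        then show ?thesis using True by (simp add: b_def \<psi>(4) E1_def above1_def)
      qed
      have "t * \<phi> x \<le> t * K" using t K(4) by (intro mult_left_mono) auto
      moreover have "\<bar>\<tau> * \<psi> x\<bar> \<le> \<bar>\<tau>\<bar> * 1" unfolding abs_mult using \<psi>(2,3)[of x] by (intro mult_left_mono) auto
      ultimately have "b \<le> K2" using K(3)[OF x(1)] unfolding b_def K2_def by linarith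
      then have b1: "0 \<le> b powr p" "b powr p \<le> K2 powr p" using b0 p by (auto intro: powr_mono2)
      have "norm (g x + t *\<^sub>R grad \<phi> x + \<tau> *\<^sub>R grad \<psi> x) \<le> norm (g x) + norm (t *\<^sub>R grad \<phi> x) + norm (\<tau> *\<^sub>R grad \<psi> x)"
        by (rule order_trans[OF norm_triangle_ineq add_right_mono[OF norm_triangle_ineq]])
      moreover have "norm (t *\<^sub>R grad \<phi> x) \<le> t * K" using t K(5)[of x] by (simp add: mult_left_mono)
      moreover have "norm (\<tau> *\<^sub>R grad \<psi> x) \<le> \<bar>\<tau>\<bar> * K" using K(6)[of x] by (simp add: mult_left_mono)
      ultimately have "norm (g x + t *\<^sub>R grad \<phi> x + \<tau> *\<^sub>R grad \<psi> x) \<le> K1" using x(2) unfolding K1_def by linarith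
      then have "(norm (g x + t *\<^sub>R grad \<phi> x + \<tau> *\<^sub>R grad \<psi> x))\<^sup>2 \<le> K1\<^sup>2" by (rule power_mono) simp
      moreover have "0 \<le> (norm (g x + t *\<^sub>R grad \<phi> x + \<tau> *\<^sub>R grad \<psi> x))\<^sup>2" by simp
      ultimately show ?thesis using b1 True unfolding gap_def b_def[symmetric] abs_le_iff
        by (simp only: indicator_simps(1) mult_1_left) linarith
    qed (simp add: gap_def)
  qed
qed

text \<open>Provides the continuity in \<open>\<tau>\<close> that the intermediate value theorem asks for.\<close>

lemma gap_lipschitz:
  obtains C where "C \<ge> 0"
    "\<And>\<tau> \<sigma>. \<bar>\<tau>\<bar> \<le> (1 - \<mu>) * \<eta> \<Longrightarrow> \<bar>\<sigma>\<bar> \<le> (1 - \<mu>) * \<eta> \<Longrightarrow>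
      \<bar>integral\<^sup>L M (gap \<tau>) - integral\<^sup>L M (gap \<sigma>)\<bar> \<le> C * \<bar>\<tau> - \<sigma>\<bar>"
proof -
  obtain K where K: "K > 0" "AE x in M. norm (g x) \<le> K"
    "\<And>x. x \<in> \<Omega> \<Longrightarrow> \<bar>u x - 1\<bar> \<le> K" "\<And>x. \<phi> x \<le> K" "\<And>x. norm (grad \<phi> x) \<le> K" "\<And>x. norm (grad \<psi> x) \<le> K"
    using bounds by metis
  define T where "T = (1 - \<mu>) * \<eta>"
  have T: "T > 0" using \<mu> \<eta> by (simp add: T_def)
  define H where "H = 2 * K\<^sup>2 + 2 * T * K\<^sup>2 + p * (K + T) powr (p - 1)"
  have H: "H \<ge> 0" using T p by (simp add: H_def)
  have power_bound: "(u x - 1 + \<tau> * \<psi> x) powr p - (u x - 1 + \<sigma> * \<psi> x) powr p \<le> p * (K + T) powr (p - 1) * \<bar>\<tau> - \<sigma>\<bar>"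
    if x: "x \<in> Q" and \<tau>: "\<bar>\<tau>\<bar> \<le> T" and \<sigma>: "\<bar>\<sigma>\<bar> \<le> T" for x \<tau> \<sigma>
  proof -
    define y where "y = u x - 1 + \<tau> * \<psi> x"
    define z where "z = u x - 1 + \<sigma> * \<psi> x"
    have pos: "0 < y" "0 < z" using on_Q(6)[OF x] \<tau> \<sigma> by (simp_all add: y_def z_def T_def)
    have "x \<in> \<Omega>" using x Q(1) E_subset by blast
    moreover have "\<bar>\<tau> * \<psi> x\<bar> \<le> T * 1" unfolding abs_mult using \<tau> T \<psi>(2,3)[of x] by (intro mult_mono) auto
    ultimately have yK: "y \<le> K + T" using K(3)[of x] unfolding y_def by linarith
    have "y powr p + p * y powr (p - 1) * (z - y) \<le> z powr p" by (rule powr_tangent[OF pos]) (use p in simp)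
    then have "y powr p - z powr p \<le> p * y powr (p - 1) * (y - z)" by (simp add: algebra_simps)
    also have "\<dots> \<le> p * y powr (p - 1) * \<bar>\<tau> - \<sigma>\<bar>"
    proof (rule mult_left_mono)
      have "y - z = (\<tau> - \<sigma>) * \<psi> x" by (simp add: y_def z_def algebra_simps)
      also have "\<dots> \<le> \<bar>\<tau> - \<sigma>\<bar> * 1" using \<psi>(2,3)[of x] by (intro mult_mono) auto
      finally show "y - z \<le> \<bar>\<tau> - \<sigma>\<bar>" by simp
    qed (use p in simp)
    also have "\<dots> \<le> p * (K + T) powr (p - 1) * \<bar>\<tau> - \<sigma>\<bar>"
      using pos yK p by (intro mult_right_mono mult_left_mono powr_mono2) auto
    finally show ?thesis by (simp add: y_def z_def)
  qed
  have pw: "\<bar>gap \<tau> x - gap \<sigma> x\<bar> \<le> H * \<bar>\<tau> - \<sigma>\<bar>"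
    if \<tau>: "\<bar>\<tau>\<bar> \<le> T" and \<sigma>: "\<bar>\<sigma>\<bar> \<le> T" and gx: "norm (g x) \<le> K" for \<tau> \<sigma> x
  proof -
    define e where "e = indicat_real Q x * ((u x - 1 + \<tau> * \<psi> x) powr p - (u x - 1 + \<sigma> * \<psi> x) powr p)"
    have eq: "gap \<tau> x - gap \<sigma> x = (\<tau> - \<sigma>) * (2 * (g x \<bullet> grad \<psi> x)) + (\<tau> - \<sigma>) * ((\<tau> + \<sigma>) * (norm (grad \<psi> x))\<^sup>2) - e"
      using gap_split[of \<tau> x] gap_split[of \<sigma> x] \<tau> \<sigma>
      by (simp add: T_def e_def algebra_simps power2_eq_square)
    have "\<bar>g x \<bullet> grad \<psi> x\<bar> \<le> norm (g x) * norm (grad \<psi> x)" by (rule Cauchy_Schwarz_ineq2)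
    also have "\<dots> \<le> K * K" using gx K(6)[of x] K(1) by (intro mult_mono) auto
    finally have a: "\<bar>2 * (g x \<bullet> grad \<psi> x)\<bar> \<le> 2 * K\<^sup>2" by (simp add: power2_eq_square)
    have "\<bar>\<tau> + \<sigma>\<bar> \<le> 2 * T" using \<tau> \<sigma> by linarith
    moreover have "(norm (grad \<psi> x))\<^sup>2 \<le> K\<^sup>2" using K(6)[of x] by (intro power_mono) auto
    ultimately have b: "\<bar>(\<tau> + \<sigma>) * (norm (grad \<psi> x))\<^sup>2\<bar> \<le> 2 * T * K\<^sup>2"
      unfolding abs_mult by (intro mult_mono) auto
    have c: "\<bar>e\<bar> \<le> p * (K + T) powr (p - 1) * \<bar>\<tau> - \<sigma>\<bar>"
    proof (cases "x \<in> Q")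
      case True
      then show ?thesis using power_bound[OF True \<tau> \<sigma>] power_bound[OF True \<sigma> \<tau>]
        by (simp add: e_def abs_le_iff abs_minus_commute)
    qed (use p in \<open>simp add: e_def\<close>)
    have "\<bar>gap \<tau> x - gap \<sigma> x\<bar> \<le> \<bar>\<tau> - \<sigma>\<bar> * (2 * K\<^sup>2) + \<bar>\<tau> - \<sigma>\<bar> * (2 * T * K\<^sup>2) + p * (K + T) powr (p - 1) * \<bar>\<tau> - \<sigma>\<bar>"
    proof -
      have "\<bar>(\<tau> - \<sigma>) * (2 * (g x \<bullet> grad \<psi> x))\<bar> \<le> \<bar>\<tau> - \<sigma>\<bar> * (2 * K\<^sup>2)"
        unfolding abs_mult[of "\<tau> - \<sigma>"] by (rule mult_left_mono[OF a]) simp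
      moreover have "\<bar>(\<tau> - \<sigma>) * ((\<tau> + \<sigma>) * (norm (grad \<psi> x))\<^sup>2)\<bar> \<le> \<bar>\<tau> - \<sigma>\<bar> * (2 * T * K\<^sup>2)"
        unfolding abs_mult[of "\<tau> - \<sigma>"] by (rule mult_left_mono[OF b]) simp
      ultimately show ?thesis using c unfolding eq by linarith
    qed
    also have "\<dots> = H * \<bar>\<tau> - \<sigma>\<bar>" by (simp add: H_def algebra_simps)
    finally show ?thesis .
  qed
  show thesis
  proof (rule that[of "H * measure M (space M)"])
    show "0 \<le> H * measure M (space M)" using H by simp
    fix \<tau> \<sigma> :: real assume ts: "\<bar>\<tau>\<bar> \<le> (1 - \<mu>) * \<eta>" "\<bar>\<sigma>\<bar> \<le> (1 - \<mu>) * \<eta>"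
    have i: "integrable M (gap \<tau>)" "integrable M (gap \<sigma>)" using gap_integrable ts by blast+
    have ic: "integrable M (\<lambda>x. H * \<bar>\<tau> - \<sigma>\<bar>)" by (rule finite_measure.integrable_const[OF finite_M])
    have "\<bar>integral\<^sup>L M (gap \<tau>) - integral\<^sup>L M (gap \<sigma>)\<bar> = \<bar>integral\<^sup>L M (\<lambda>x. gap \<tau> x - gap \<sigma> x)\<bar>"
      using i by simp
    also have "\<dots> \<le> integral\<^sup>L M (\<lambda>x. \<bar>gap \<tau> x - gap \<sigma> x\<bar>)" by (rule integral_abs_bound)
    also have "\<dots> \<le> integral\<^sup>L M (\<lambda>x. H * \<bar>\<tau> - \<sigma>\<bar>)"
    proof (rule integral_mono_AE[OF integrable_abs[OF Bochner_Integration.integrable_diff[OF i]] ic])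
      show "AE x in M. \<bar>gap \<tau> x - gap \<sigma> x\<bar> \<le> H * \<bar>\<tau> - \<sigma>\<bar>"
        using K(2) by eventually_elim (rule pw, use ts in \<open>simp_all add: T_def\<close>)
    qed
    also have "\<dots> = H * measure M (space M) * \<bar>\<tau> - \<sigma>\<bar>" by simp
    finally show "\<bar>integral\<^sup>L M (gap \<tau>) - integral\<^sup>L M (gap \<sigma>)\<bar> \<le> H * measure M (space M) * \<bar>\<tau> - \<sigma>\<bar>" .
  qed
qed

text \<open>To first order \<open>\<integral> gap \<tau>\<close> is \<open>\<integral> gap 0 - (p - 2) \<tau> source \<psi>\<close>. Tangent inequalities for the power at \<open>u - 1\<close> and at the
perturbed value turn this into one-sided bounds of half that slope at \<open>\<plusminus> s\<close>, and the intermediate value theorem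
applies. The condition on \<open>\<mu>\<close> is what leaves half of the slope for negative \<open>\<tau>\<close>.\<close>

lemma constraint_solvable:
  assumes src: "source \<psi> > 0" and \<mu>p: "p * \<mu> powr (p - 1) = (p + 2) / 2"
    and s: "0 \<le> s" "s \<le> (1 - \<mu>) * \<eta>" "energy \<psi> * s \<le> (p - 2) / 2 * source \<psi>"
    and P: "\<bar>integral\<^sup>L M (gap 0)\<bar> \<le> (p - 2) / 2 * source \<psi> * s"
  obtains \<tau> where "\<bar>\<tau>\<bar> \<le> s" "integral\<^sup>L M (gap \<tau>) = 0"
proof -
  define K where "K \<tau> = integral\<^sup>L M (gap \<tau>)" for \<tau>
  define w where "w x = indicat_real E x * ((u x - 1) powr (p - 1) * \<psi> x)" for x
  define q where "q = (p - 2) / 2 * source \<psi>"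
  have iw: "integrable M w" unfolding w_def[abs_def] by (rule integrable_pieces(5))
  have wI: "integral\<^sup>L M w = source \<psi>" unfolding w_def[abs_def] source_def by (rule refl)
  have pI: "integral\<^sup>L M (\<lambda>x. g x \<bullet> grad \<psi> x) = source \<psi>" unfolding source_def by (rule weak_test_E(1)[OF \<psi>(1)])
  have T0: "0 \<le> (1 - \<mu>) * \<eta>" using \<mu> \<eta> by simp
  have i0: "integrable M (gap 0)" by (rule gap_integrable) (use T0 in simp)
  have sT: "\<bar>s\<bar> \<le> (1 - \<mu>) * \<eta>" "\<bar>- s\<bar> \<le> (1 - \<mu>) * \<eta>" using s by simp_all
  have ints: "integral\<^sup>L M (\<lambda>x. gap 0 x + a * (g x \<bullet> grad \<psi> x) + b * (norm (grad \<psi> x))\<^sup>2 + c * w x)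
      = K 0 + a * source \<psi> + b * energy \<psi> + c * source \<psi>"
    "integrable M (\<lambda>x. gap 0 x + a * (g x \<bullet> grad \<psi> x) + b * (norm (grad \<psi> x))\<^sup>2 + c * w x)" for a b c
    using i0 integrable_pieces(2,4) iw by (simp_all add: pI wI energy_def K_def)
  have "K s \<le> integral\<^sup>L M (\<lambda>x. gap 0 x + (2 * s) * (g x \<bullet> grad \<psi> x) + s\<^sup>2 * (norm (grad \<psi> x))\<^sup>2 + (- (p * s)) * w x)"
    unfolding K_def
  proof (rule integral_mono[OF gap_integrable[OF sT(1)] ints(2)])
    fix x
    have "p * s * w x \<le> indicat_real Q x * ((u x - 1 + s * \<psi> x) powr p - (u x - 1) powr p)"
    proof (cases "x \<in> Q")
      case True
      note q = on_Q[OF True sT(1)]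
      have "(u x - 1) powr p + p * (u x - 1) powr (p - 1) * ((u x - 1 + s * \<psi> x) - (u x - 1)) \<le> (u x - 1 + s * \<psi> x) powr p"
        by (rule powr_tangent[OF q(4,6)]) (use p in simp)
      then show ?thesis using True q(3) by (simp add: w_def mult_ac)
    qed (simp add: w_def \<psi>(4))
    then show "gap s x \<le> gap 0 x + (2 * s) * (g x \<bullet> grad \<psi> x) + s\<^sup>2 * (norm (grad \<psi> x))\<^sup>2 + (- (p * s)) * w x"
      unfolding gap_split[OF sT(1), of x] by simp
  qed
  also have "\<dots> = K 0 - 2 * (q * s) + energy \<psi> * s * s" unfolding ints(1) by (simp add: q_def power2_eq_square field_simps)
  also have "energy \<psi> * s * s \<le> q * s" using s(1,3) unfolding q_def by (intro mult_right_mono) auto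
  finally have up: "K s \<le> 0" using P unfolding K_def q_def by linarith
  have "integral\<^sup>L M (\<lambda>x. gap 0 x + (- (2 * s)) * (g x \<bullet> grad \<psi> x) + s\<^sup>2 * (norm (grad \<psi> x))\<^sup>2 + ((p + 2) / 2 * s) * w x) \<le> K (- s)"
    unfolding K_def
  proof (rule integral_mono[OF ints(2) gap_integrable[OF sT(2)]])
    fix x
    have "indicat_real Q x * ((u x - 1 + (- s) * \<psi> x) powr p - (u x - 1) powr p) \<le> - ((p + 2) / 2 * s * w x)"
    proof (cases "x \<in> Q")
      case True
      note q = on_Q[OF True sT(2)]
      define y where "y = u x - 1 + (- s) * \<psi> x"
      have y: "0 < y" "\<mu> * (u x - 1) \<le> y" using q(5,6) by (simp_all add: y_def)
      have "y powr p + p * y powr (p - 1) * ((u x - 1) - y) \<le> (u x - 1) powr p"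
        by (rule powr_tangent[OF y(1) q(4)]) (use p in simp)
      then have a: "y powr p - (u x - 1) powr p \<le> - (p * y powr (p - 1) * (s * \<psi> x))" by (simp add: y_def)
      have "(\<mu> * (u x - 1)) powr (p - 1) \<le> y powr (p - 1)" using y(2) \<mu> q(4) p by (intro powr_mono2) auto
      then have "p * (\<mu> powr (p - 1) * (u x - 1) powr (p - 1)) * (s * \<psi> x) \<le> p * y powr (p - 1) * (s * \<psi> x)"
        using p s(1) \<psi>(2)[of x] \<mu> q(4) by (intro mult_right_mono mult_left_mono) (auto simp: powr_mult)
      moreover have "p * (\<mu> powr (p - 1) * (u x - 1) powr (p - 1)) * (s * \<psi> x) = (p + 2) / 2 * s * w x"
        unfolding \<mu>p[symmetric] w_def using q(3) by simp
      ultimately show ?thesis using a True by (simp add: y_def)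
    qed (simp add: w_def \<psi>(4))
    then show "gap 0 x + (- (2 * s)) * (g x \<bullet> grad \<psi> x) + s\<^sup>2 * (norm (grad \<psi> x))\<^sup>2 + ((p + 2) / 2 * s) * w x \<le> gap (- s) x"
      unfolding gap_split[OF sT(2), of x] by simp
  qed
  moreover have "integral\<^sup>L M (\<lambda>x. gap 0 x + (- (2 * s)) * (g x \<bullet> grad \<psi> x) + s\<^sup>2 * (norm (grad \<psi> x))\<^sup>2 + ((p + 2) / 2 * s) * w x)
      = K 0 + q * s + s\<^sup>2 * energy \<psi>"
    unfolding ints(1) by (simp add: q_def field_simps)
  moreover have "0 \<le> s\<^sup>2 * energy \<psi>"
    unfolding energy_def by (intro mult_nonneg_nonneg Bochner_Integration.integral_nonneg) simp_all
  ultimately have lo: "0 \<le> K (- s)" using P unfolding K_def q_def by linarith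
  have "continuous_on {- s..s} K"
  proof -
    obtain C where C: "C \<ge> 0" "\<And>\<tau> \<sigma>. \<bar>\<tau>\<bar> \<le> (1 - \<mu>) * \<eta> \<Longrightarrow> \<bar>\<sigma>\<bar> \<le> (1 - \<mu>) * \<eta> \<Longrightarrow> \<bar>K \<tau> - K \<sigma>\<bar> \<le> C * \<bar>\<tau> - \<sigma>\<bar>"
      using gap_lipschitz unfolding K_def by metis
    have "C-lipschitz_on {- s..s} K"
      by (rule lipschitz_onI[OF _ C(1)]) (use C(2) s(2) in \<open>auto simp: dist_real_def\<close>)
    then show ?thesis by (rule lipschitz_on_continuous_on)
  qed
  then obtain \<tau> where "- s \<le> \<tau>" "\<tau> \<le> s" "K \<tau> = 0"
    using IVT2'[of K s 0 "- s"] up lo s(1) by auto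
  then show thesis by (intro that[of \<tau>]) (auto simp: K_def)
qed

text \<open>Without the correction, the integrand changes only in \<open>A\<close>, and there all quantities are bounded.\<close>

lemma gap_zero_bound:
  assumes G: "AE x in M. norm (g x) \<le> G" and B: "\<And>x. x \<in> \<Omega> \<Longrightarrow> \<bar>u x - 1\<bar> \<le> B"
    and C: "\<And>x. \<phi> x \<le> C" "\<And>x. norm (grad \<phi> x) \<le> C"
  shows "\<bar>integral\<^sup>L M (gap 0)\<bar> \<le> ((G + t * C)\<^sup>2 + (B + t * C) powr p + G\<^sup>2 + B powr p) * measure lebesgue A"
proof -
  define k where "k = (G + t * C)\<^sup>2 + (B + t * C) powr p + G\<^sup>2 + B powr p"
  define h where "h x = indicat_real E x * (norm (g x))\<^sup>2 - indicat_real E x * (u x - 1) powr p" for x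
  have i0: "integrable M (gap 0)" by (rule gap_integrable) (use \<mu> \<eta> in simp)
  note [measurable] = measurable_facts
  have j1: "integrable M (\<lambda>x. indicat_real E x * (norm (g x))\<^sup>2)"
  proof (rule integrable_AE_le[OF _ G, of _ "G\<^sup>2"])
    show "\<bar>indicat_real E x * (norm (g x))\<^sup>2\<bar> \<le> G\<^sup>2" if "norm (g x) \<le> G" for x
      using power_mono[OF that, of 2] by (simp add: indicator_def)
  qed measurable
  have j2: "integrable M (\<lambda>x. indicat_real E x * (u x - 1) powr p)"
    using indicator_E_integrals(2) not_integrable_integral_eq by force
  have ih: "integrable M h" unfolding h_def[abs_def] by (rule Bochner_Integration.integrable_diff[OF j1 j2])
  have h0: "integral\<^sup>L M h = 0"
    unfolding h_def[abs_def] using indicator_E_integrals(1) by (simp add: Bochner_Integration.integral_diff[OF j1 j2])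
  have iA: "integrable M (indicat_real A)"
  proof (rule integrable_AE_bounded[of _ 1])
    have "A \<inter> \<Omega> = A" using A(1) by blast
    then have "A \<in> sets M" using A(3) sets_restrict_space_iff[of \<Omega> lebesgue A] sets_Omega A(1) by auto
    then show "indicat_real A \<in> borel_measurable M" by (rule borel_measurable_indicator)
  qed (simp add: indicator_def)
  have pw: "\<bar>gap 0 x - h x\<bar> \<le> k * indicat_real A x" if x: "x \<in> \<Omega>" "norm (g x) \<le> G" for x
  proof (cases "x \<in> A")
    case True
    have g2: "(norm (g x))\<^sup>2 \<le> G\<^sup>2" by (rule power_mono[OF x(2)]) simp
    have "norm (g x + t *\<^sub>R grad \<phi> x) \<le> norm (g x) + norm (t *\<^sub>R grad \<phi> x)" by (rule norm_triangle_ineq)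
    moreover have "norm (t *\<^sub>R grad \<phi> x) \<le> t * C" using t C(2)[of x] by (simp add: mult_left_mono)
    ultimately have "norm (g x + t *\<^sub>R grad \<phi> x) \<le> G + t * C" using x(2) by linarith
    then have g1: "(norm (g x + t *\<^sub>R grad \<phi> x))\<^sup>2 \<le> (G + t * C)\<^sup>2" by (rule power_mono) simp
    have e1: "0 \<le> indicat_real E1 x * (u x + t * \<phi> x - 1) powr p \<and> indicat_real E1 x * (u x + t * \<phi> x - 1) powr p \<le> (B + t * C) powr p"
    proof (cases "x \<in> E1")
      case xE: True
      then have "0 \<le> u x + t * \<phi> x - 1" by (simp add: E1_def above1_def)
      moreover have "t * \<phi> x \<le> t * C" using t C(1) by (intro mult_left_mono) auto
      then have "u x + t * \<phi> x - 1 \<le> B + t * C" using B[OF x(1)] by linarith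
      ultimately show ?thesis using xE p by (simp add: powr_mono2)
    qed simp
    have e2: "0 \<le> indicat_real E x * (u x - 1) powr p \<and> indicat_real E x * (u x - 1) powr p \<le> B powr p"
    proof (cases "x \<in> E")
      case xE: True
      have "u x - 1 \<le> B" using B[OF x(1)] by linarith
      then show ?thesis using xE u_gt1[OF xE] p by (simp add: powr_mono2)
    qed simp
    have e3: "0 \<le> indicat_real E1 x * (norm (g x + t *\<^sub>R grad \<phi> x))\<^sup>2 \<and> indicat_real E1 x * (norm (g x + t *\<^sub>R grad \<phi> x))\<^sup>2 \<le> (G + t * C)\<^sup>2"
      using g1 by (simp add: indicator_def)
    have e4: "0 \<le> indicat_real E x * (norm (g x))\<^sup>2 \<and> indicat_real E x * (norm (g x))\<^sup>2 \<le> G\<^sup>2"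
      using g2 by (simp add: indicator_def)
    have "gap 0 x = indicat_real E1 x * (norm (g x + t *\<^sub>R grad \<phi> x))\<^sup>2 - indicat_real E1 x * (u x + t * \<phi> x - 1) powr p"
      by (simp add: gap_def right_diff_distrib)
    then have "\<bar>gap 0 x - h x\<bar> \<le> k"
      unfolding h_def k_def abs_le_iff using e1 e2 e3 e4 by (elim conjE, intro conjI) linarith+
    then show ?thesis using True by simp
  next
    case False
    have "x \<in> E1 \<longleftrightarrow> x \<in> E" using E_E1 E1_E False by blast
    then show ?thesis using False off_A[OF False] by (simp add: gap_def h_def indicator_def)
  qed
  have "\<bar>integral\<^sup>L M (gap 0)\<bar> = \<bar>integral\<^sup>L M (\<lambda>x. gap 0 x - h x)\<bar>" using i0 ih h0 by simp
  also have "\<dots> \<le> integral\<^sup>L M (\<lambda>x. \<bar>gap 0 x - h x\<bar>)" by (rule integral_abs_bound)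
  also have "\<dots> \<le> integral\<^sup>L M (\<lambda>x. k * indicat_real A x)"
  proof (rule integral_mono_AE[OF integrable_abs[OF Bochner_Integration.integrable_diff[OF i0 ih]] integrable_mult_right[OF iA]])
    have "AE x in M. x \<in> \<Omega>" using AE_space[of M] by simp
    with G show "AE x in M. \<bar>gap 0 x - h x\<bar> \<le> k * indicat_real A x" by eventually_elim (rule pw)
  qed
  also have "\<dots> = k * measure lebesgue A"
    using integral_over_subset[OF A(1), of "\<lambda>_. 1"] A(3) by (simp add: set_lebesgue_integral_def)
  finally show ?thesis by (simp add: k_def)
qed

end

section \<open>Density estimates\<close>

context minimizer
begin

text \<open>Integrating by parts, and using that the Laplacian of \<open>\<phi>\<close> has integral zero, the first variation is the negative of
the integral of \<open>(u - 1) \<Delta>\<phi>\<close>. The positive part of \<open>u - 1\<close> gives the main term by concentration. The negative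
part lives in \<open>B_r(x0) - E\<close>, where it is at most \<open>L r\<close>, while \<open>\<bar>\<Delta>\<phi>\<bar> \<le> C / r\<close>.\<close>

lemma first_variation_at_frontier:
  assumes conc: "concentrated \<kappa> L c C x0 r \<phi>" and r: "r > 0" and C: "C \<ge> 0"
    and x0: "x0 \<in> frontier E" and sub: "ball x0 r \<subseteq> \<Omega>"
    and x1: "\<And>z. z \<in> ball x1 (\<kappa> * r) \<Longrightarrow> z \<in> E \<and> \<kappa> * r \<le> u z - 1 \<and> \<kappa> * r \<le> norm (z - x0) \<and> norm (z - x0) \<le> (1 - \<kappa>) * r"
  shows "integral\<^sup>L M (\<lambda>x. g x \<bullet> grad \<phi> x) \<le> - (c * r ^ DIM('a)) + L * C * measure lebesgue (ball x0 r - E)"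
proof -
  note t = concentratedD(1)[OF conc]
  obtain B where B: "B > 0" "\<And>x. x \<in> closure \<Omega> \<Longrightarrow> \<bar>u x\<bar> \<le> B" using u_bounded by metis
  define ub where "ub x = indicator \<Omega> x *\<^sub>R u x" for x
  have ubm: "ub \<in> borel_measurable lebesgue"
    unfolding ub_def[abs_def] using op continuous_u_Omega
    by (intro borel_imp_lebesgue_measurable borel_measurable_continuous_on_indicator) auto
  have ubb: "\<bar>ub x\<bar> \<le> B" for x
    using B(1) B(2)[OF Omega_closure, of x] by (cases "x \<in> \<Omega>") (auto simp: ub_def)
  define f where "f x = max (ub x - 1) 0" for x
  define h where "h x = max (1 - ub x) 0" for x
  have fm: "f \<in> borel_measurable lebesgue" "h \<in> borel_measurable lebesgue"
    unfolding f_def[abs_def] h_def[abs_def] using ubm by measurable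
  have fb: "\<bar>f x\<bar> \<le> B + 1" "\<bar>h x\<bar> \<le> B + 1" for x using ubb[of x] by (auto simp: f_def h_def)
  have tl: "test_function (ball x0 r) (laplacian \<phi>)" by (rule test_function_laplacian[OF t])
  have intf: "integrable lebesgue (\<lambda>x. f x * laplacian \<phi> x)" by (rule test_function_integrable[OF tl fm(1) fb(1)])
  have inth: "integrable lebesgue (\<lambda>x. h x * laplacian \<phi> x)" by (rule test_function_integrable[OF tl fm(2) fb(2)])
  have ltl: "integrable lebesgue (laplacian \<phi>)" by (rule integral_laplacian_test(2)[OF t])
  have near: "\<bar>u x - 1\<bar> \<le> L * norm (x - x0)" if "x \<in> ball x0 r" for x
  proof -
    have "x \<in> closure \<Omega>" using that sub Omega_closure by blast
    then show ?thesis using lip[of x x0] frontier_E(2)[OF x0] Omega_closure[OF frontier_E(1)[OF x0]] by simp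
  qed
  have ubu: "ub x = u x" if "x \<in> ball x0 r" for x using that sub by (auto simp: ub_def)
  have lower: "c * r ^ DIM('a) - C * 0 * r ^ (DIM('a) - 1) \<le> (LINT x|lebesgue. f x * laplacian \<phi> x)"
  proof (rule concentratedD(6)[OF conc order_refl intf])
    show "0 \<le> f x \<and> f x \<le> L * norm (x - x0) + 0" if "x \<in> ball x0 r" for x
      using near[OF that] L ubu[OF that] by (auto simp: f_def max_def)
    show "\<kappa> * r \<le> f x \<and> \<kappa> * r \<le> norm (x - x0) \<and> norm (x - x0) \<le> (1 - \<kappa>) * r" if x: "x \<in> ball x1 (\<kappa> * r)" for x
    proof -
      have "x \<in> E" using x1[OF x] by blast
      then have "ub x = u x" using E_subset by (auto simp: ub_def)
      then have "u x - 1 \<le> f x" by (simp add: f_def)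
      then show ?thesis using x1[OF x] by linarith
    qed
  qed
  have upper: "(LINT x|lebesgue. h x * laplacian \<phi> x) \<le> L * C * measure lebesgue (ball x0 r - E)"
  proof -
    have mD: "ball x0 r - E \<in> sets lebesgue" using E_measurable(1) by (intro sets.Diff) simp_all
    have "emeasure lebesgue (ball x0 r - E) \<le> emeasure lebesgue (ball x0 r)" by (rule emeasure_mono) auto
    also have "\<dots> < \<infinity>" using emeasure_lborel_ball_finite[of x0 r] by simp
    finally have iD: "integrable lebesgue (indicat_real (ball x0 r - E))" using mD by (simp add: integrable_indicator_iff)
    have "(LINT x|lebesgue. h x * laplacian \<phi> x) \<le> (LINT x|lebesgue. (L * C) * indicat_real (ball x0 r - E) x)"
    proof (rule integral_mono[OF inth integrable_mult_right[OF iD]])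
      fix x
      show "h x * laplacian \<phi> x \<le> (L * C) * indicat_real (ball x0 r - E) x"
      proof (cases "x \<in> ball x0 r")
        case True
        show ?thesis
        proof (cases "x \<in> E")
          case xE: True
          have "h x = 0" using ubu[OF True] u_gt1[OF xE] by (simp add: h_def)
          then show ?thesis using xE by simp
        next
          case False
          have "norm (x - x0) \<le> r" using True by (simp add: dist_norm norm_minus_commute)
          then have "L * norm (x - x0) \<le> L * r" using L by (intro mult_left_mono) auto
          then have "1 - u x \<le> L * r" using near[OF True] by linarith
          moreover have "0 \<le> L * r" using L r by simp
          ultimately have h: "0 \<le> h x" "h x \<le> L * r" using ubu[OF True] by (simp_all add: h_def)
          have "h x * laplacian \<phi> x \<le> h x * (C / r)"
            using concentratedD(5)[OF conc, of x] h(1) by (intro mult_left_mono) (auto simp: abs_le_iff)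
          also have "\<dots> \<le> (L * r) * (C / r)" using h C r by (intro mult_right_mono) auto
          also have "\<dots> = L * C" using r by simp
          finally show ?thesis using True False by simp
        qed
      next
        case False
        then show ?thesis using test_function_off(1)[OF tl False] by simp
      qed
    qed
    also have "\<dots> = L * C * measure lebesgue (ball x0 r - E)" using mD by simp
    finally show ?thesis .
  qed
  have "integral\<^sup>L M (\<lambda>x. g x \<bullet> grad \<phi> x) = - (LINT x:\<Omega>|lebesgue. u x * laplacian \<phi> x)"
    by (rule weak_test(2)[OF test_function_mono[OF t sub]])
  also have "(LINT x:\<Omega>|lebesgue. u x * laplacian \<phi> x) = (LINT x|lebesgue. ub x * laplacian \<phi> x)"
    by (simp add: set_lebesgue_integral_def ub_def mult.assoc)
  also have "\<dots> = (LINT x|lebesgue. f x * laplacian \<phi> x - h x * laplacian \<phi> x + laplacian \<phi> x)"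
  proof -
    have e: "ub x = f x - h x + 1" for x by (simp add: f_def h_def max_def)
    have "ub x * laplacian \<phi> x = f x * laplacian \<phi> x - h x * laplacian \<phi> x + laplacian \<phi> x" for x
      by (subst e) (simp only: distrib_right left_diff_distrib mult_1_left)
    then show ?thesis by simp
  qed
  also have "\<dots> = (LINT x|lebesgue. f x * laplacian \<phi> x) - (LINT x|lebesgue. h x * laplacian \<phi> x) + (LINT x|lebesgue. laplacian \<phi> x)"
    using intf inth ltl by simp
  finally show ?thesis using lower upper integral_laplacian_test(1)[OF t] by simp
qed

lemma positive_set_density:
  assumes c0: "c0 > 0" and r0: "r0 > 0" and Ene: "E \<noteq> {}"
    and nd: "\<And>x. x \<in> E \<Longrightarrow> infdist x F \<le> r0 \<Longrightarrow> 1 + c0 * infdist x F \<le> u x"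
  obtains c r2 where "c > 0" "r2 > 0"
    "\<And>x0 r. x0 \<in> frontier E \<Longrightarrow> 0 < r \<Longrightarrow> r \<le> r2 \<Longrightarrow> c * r ^ DIM('a) \<le> measure lebesgue (E \<inter> ball x0 r)"
proof -
  obtain \<kappa> r2 where \<kappa>: "0 < \<kappa>" "\<kappa> < 1 / 2" and r2: "r2 > 0" and gr:
    "\<And>x0 r. x0 \<in> frontier E \<Longrightarrow> 0 < r \<Longrightarrow> r \<le> r2 \<Longrightarrow> ball x0 r \<subseteq> \<Omega> \<and>
      (\<exists>x1. \<forall>z\<in>ball x1 (\<kappa> * r). z \<in> E \<and> \<kappa> * r \<le> u z - 1 \<and> \<kappa> * r \<le> norm (z - x0) \<and> norm (z - x0) \<le> (1 - \<kappa>) * r)"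
    using frontier_growth[OF c0 r0 Ene nd] by metis
  define V where "V = unit_ball_vol DIM('a)"
  have V: "V > 0" by (simp add: V_def)
  show thesis
  proof (rule that[of "V * \<kappa> ^ DIM('a)" r2])
    show "V * \<kappa> ^ DIM('a) > 0" "r2 > 0" using V \<kappa> r2 by simp_all
    fix x0 r assume x0: "x0 \<in> frontier E" and r: "0 < r" "r \<le> r2"
    obtain x1 where x1: "\<forall>z\<in>ball x1 (\<kappa> * r). z \<in> E \<and> \<kappa> * r \<le> u z - 1 \<and> \<kappa> * r \<le> norm (z - x0) \<and> norm (z - x0) \<le> (1 - \<kappa>) * r"
      using gr[OF x0 r] by blast
    have "ball x1 (\<kappa> * r) \<subseteq> E \<inter> ball x0 r"
    proof
      fix z assume "z \<in> ball x1 (\<kappa> * r)"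
      then have "z \<in> E" "norm (z - x0) \<le> (1 - \<kappa>) * r" using x1 by blast+
      moreover have "(1 - \<kappa>) * r < 1 * r" using \<kappa> r by (intro mult_strict_right_mono) auto
      ultimately show "z \<in> E \<inter> ball x0 r" by (simp add: dist_norm norm_minus_commute)
    qed
    moreover have "E \<inter> ball x0 r \<in> lmeasurable"
      using fmeasurable_Int_fmeasurable[OF _ E_measurable(1), of "ball x0 r"] by (simp add: Int_commute)
    ultimately have "measure lebesgue (ball x1 (\<kappa> * r)) \<le> measure lebesgue (E \<inter> ball x0 r)"
      by (intro measure_mono_fmeasurable) simp_all
    moreover have "measure lebesgue (ball x1 (\<kappa> * r)) = V * \<kappa> ^ DIM('a) * r ^ DIM('a)"
      using measure_ball[of "\<kappa> * r" x1] \<kappa> r by (simp add: V_def power_mult_distrib)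
    ultimately show "V * \<kappa> ^ DIM('a) * r ^ DIM('a) \<le> measure lebesgue (E \<inter> ball x0 r)" by simp
  qed
qed

lemma source_pos:
  assumes t: "test_function E \<psi>" and nn: "\<And>x. 0 \<le> \<psi> x" and b: "\<rho> > 0" "e > 0" "\<And>x. x \<in> ball z \<rho> \<Longrightarrow> e \<le> \<psi> x"
  shows "source \<psi> > 0"
proof -
  have zE: "ball z \<rho> \<subseteq> E"
  proof
    fix x assume "x \<in> ball z \<rho>"
    then have "\<psi> x \<noteq> 0" using b(2) b(3)[of x] by linarith
    then show "x \<in> E" using test_function_off(1)[OF t, of x] by blast
  qed
  define w where "w x = indicat_real E x * ((u x - 1) powr (p - 1) * \<psi> x)" for x
  have iw: "integrable M w" unfolding w_def[abs_def] by (rule weak_test_E(2)[OF t])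
  have w0: "0 \<le> w x" for x using nn by (simp add: w_def)
  have wp: "0 < w x" if "x \<in> ball z \<rho>" for x
  proof -
    have "x \<in> E" using that zE by blast
    then have "0 < (u x - 1) powr (p - 1)" using u_gt1[of x] by simp
    moreover have "0 < \<psi> x" using b(2) b(3)[OF that] by linarith
    ultimately show ?thesis using \<open>x \<in> E\<close> by (simp add: w_def)
  qed
  have "source \<psi> \<noteq> 0"
  proof
    assume "source \<psi> = 0"
    then have "integral\<^sup>L M w = 0" unfolding w_def[abs_def] source_def .
    then have "AE x in M. w x = 0" using integral_nonneg_eq_0_iff_AE[OF iw] w0 by simp
    then have "AE x in lebesgue. x \<in> \<Omega> \<longrightarrow> w x = 0" using sets_Omega by (subst (asm) AE_restrict_space_iff) auto
    then have "AE x in lebesgue. x \<notin> ball z \<rho>"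
      by eventually_elim (use wp zE E_subset in fastforce)
    then obtain N where N: "N \<in> null_sets lebesgue" "{x \<in> space lebesgue. \<not> x \<notin> ball z \<rho>} \<subseteq> N"
      by (auto simp: eventually_ae_filter)
    have "ball z \<rho> \<subseteq> N" using N(2) by force
    then have "negligible (ball z \<rho>)"
      by (rule negligible_subset[OF N(1)[folded negligible_iff_null_sets]])
    then show False using open_not_negligible[OF open_ball, of z \<rho>] b(1) by simp
  qed
  moreover have "0 \<le> source \<psi>"
    unfolding source_def using w0 unfolding w_def by (intro Bochner_Integration.integral_nonneg)
  ultimately show ?thesis by linarith
qed

text \<open>The competitor inequality reads \<open>t c r^N \<le> (1 + t L C) m + t\<^sup>2 C\<^sup>2 V r^N / 2 + O(r^(2 N))\<close>, where \<open>m\<close> is the measure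
of \<open>B_r(x0) - E\<close> and \<open>V\<close> that of the unit ball. The choice of \<open>t\<close> lets the second term absorb half of the left-hand
side, and smallness of \<open>r\<close> lets the third absorb a quarter.\<close>

lemma zero_set_density:
  assumes c0: "c0 > 0" and r0: "r0 > 0" and Ene: "E \<noteq> {}"
    and nd: "\<And>x. x \<in> E \<Longrightarrow> infdist x F \<le> r0 \<Longrightarrow> 1 + c0 * infdist x F \<le> u x"
  obtains c r3 where "c > 0" "r3 > 0"
    "\<And>x0 r. x0 \<in> frontier E \<Longrightarrow> 0 < r \<Longrightarrow> r \<le> r3 \<Longrightarrow> c * r ^ DIM('a) \<le> measure lebesgue (ball x0 r - E)"
proof -
  obtain \<kappa> r2 where \<kappa>: "0 < \<kappa>" "\<kappa> < 1 / 2" and r2: "r2 > 0" and gr: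
    "\<And>x0 r. x0 \<in> frontier E \<Longrightarrow> 0 < r \<Longrightarrow> r \<le> r2 \<Longrightarrow> ball x0 r \<subseteq> \<Omega> \<and>
      (\<exists>x1. \<forall>z\<in>ball x1 (\<kappa> * r). z \<in> E \<and> \<kappa> * r \<le> u z - 1 \<and> \<kappa> * r \<le> norm (z - x0) \<and> norm (z - x0) \<le> (1 - \<kappa>) * r)"
    using frontier_growth[OF c0 r0 Ene nd] by metis
  obtain c C where c: "c > 0" and C: "C > 0" and
    T: "\<And>(x0::'a) r. r > 0 \<Longrightarrow> \<exists>\<phi>. concentrated \<kappa> L c C x0 r \<phi>"
    using concentrated_test_functions[where 'a='a, OF dim \<kappa> less_imp_le[OF L]] by metis
  obtain z where z: "z \<in> E" using Ene by blast
  obtain R' where R': "R' > 0" "cball z R' \<subseteq> E" using open_E z open_contains_cball by blast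
  define R where "R = R' / 2"
  have R: "R > 0" "cball z (2 * R) \<subseteq> E" using R' by (simp_all add: R_def)
  define Q where "Q = cball z R"
  have QE: "Q \<subseteq> E" using R by (auto simp: Q_def)
  define \<psi> where "\<psi> x = flat_exp 0 (R\<^sup>2 - (norm (x - z))\<^sup>2)" for x
  have \<psi>off: "\<psi> x = 0" if "x \<notin> Q" for x
  proof -
    have "R \<le> norm (x - z)" using that by (simp add: Q_def dist_norm norm_minus_commute)
    then have "R\<^sup>2 \<le> (norm (x - z))\<^sup>2" using R by (intro power_mono) auto
    then show ?thesis by (simp add: \<psi>_def flat_exp_def)
  qed
  have t\<psi>: "test_function E \<psi>"
  proof (rule test_functionI[OF _ _ QE \<psi>off])
    have s: "C_on k UNIV (\<lambda>x. R\<^sup>2 - (norm (x - z))\<^sup>2)" for k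
      by (intro C_on_diff[OF open_UNIV] C_on_const[OF open_UNIV] C_on_dist_power2[OF open_UNIV])
    show "C_on k UNIV \<psi>" for k
      unfolding \<psi>_def[abs_def] by (rule C_on_compose[OF open_UNIV open_UNIV C_on_flat_exp s]) simp
  qed (simp add: Q_def)
  have g\<psi>: "grad \<psi> x = 0" if "x \<notin> Q" for x
  proof -
    have "pd i \<psi> x = 0" for i
      by (rule pd_zero_off_closed[where K=Q and f=\<psi>, OF _ \<psi>off that]) (simp add: Q_def)
    then show ?thesis by (simp add: grad_def)
  qed
  have "compact Q" "Q \<noteq> {}" using R by (auto simp: Q_def)
  moreover have "continuous_on Q u" using QE E_subset continuous_u_Omega continuous_on_subset by blast
  ultimately obtain xq where xq: "xq \<in> Q" "\<And>x. x \<in> Q \<Longrightarrow> u xq \<le> u x"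
    using continuous_attains_inf[of Q u] by blast
  define \<eta> where "\<eta> = u xq - 1"
  have \<eta>: "\<eta> > 0" using u_gt1 xq(1) QE by (auto simp: \<eta>_def)
  \<comment> \<open>solves \<open>p \<mu> powr (p - 1) = (p + 2) / 2\<close>, and \<open>\<mu> < 1\<close> because \<open>p > 2\<close>\<close>
  define \<mu> where "\<mu> = ((p + 2) / (2 * p)) powr (1 / (p - 1))"
  have \<mu>: "0 < \<mu>" "\<mu> < 1" "p * \<mu> powr (p - 1) = (p + 2) / 2"
  proof -
    have b: "0 < (p + 2) / (2 * p)" "(p + 2) / (2 * p) < 1" using p by (simp_all add: field_simps)
    show "0 < \<mu>" using b(1) p by (simp add: \<mu>_def)
    have "\<mu> < 1 powr (1 / (p - 1))" unfolding \<mu>_def using b p by (intro powr_less_mono2) auto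
    then show "\<mu> < 1" by simp
    have "\<mu> powr (p - 1) = (p + 2) / (2 * p)" unfolding \<mu>_def powr_powr using b(1) p by simp
    then show "p * \<mu> powr (p - 1) = (p + 2) / 2" using p by simp
  qed
  define e where "e = flat_exp 0 (R\<^sup>2 - (R / 2)\<^sup>2)"
  have eR: "R\<^sup>2 - (R / 2)\<^sup>2 > 0" using R by (simp add: power2_eq_square)
  have "e > 0" using eR by (simp add: e_def flat_exp_def)
  moreover have "e \<le> \<psi> x" if "x \<in> ball z (R / 2)" for x
  proof -
    have "norm (x - z) \<le> R / 2" using that by (simp add: dist_norm norm_minus_commute)
    then have "(norm (x - z))\<^sup>2 \<le> (R / 2)\<^sup>2" by (rule power_mono) simp
    then have le: "R\<^sup>2 - (R / 2)\<^sup>2 \<le> R\<^sup>2 - (norm (x - z))\<^sup>2" by simp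
    then have "- 1 / (R\<^sup>2 - (R / 2)\<^sup>2) \<le> - 1 / (R\<^sup>2 - (norm (x - z))\<^sup>2)" using eR by (simp add: frac_le)
    then show ?thesis using eR le by (simp add: e_def \<psi>_def flat_exp_def)
  qed
  ultimately have src: "source \<psi> > 0"
    using source_pos[OF t\<psi>, of "R / 2" e z] R by (simp add: \<psi>_def flat_exp_nonneg)
  obtain B0 where B0: "B0 > 0" "\<And>x. x \<in> closure \<Omega> \<Longrightarrow> \<bar>u x\<bar> \<le> B0" using u_bounded by metis
  define B where "B = B0 + 1"
  have B: "\<bar>u x - 1\<bar> \<le> B" if "x \<in> \<Omega>" for x using B0(2)[OF Omega_closure[OF that]] unfolding B_def by linarith
  define V where "V = unit_ball_vol DIM('a)"
  have V: "V > 0" by (simp add: V_def)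
  \<comment> \<open>minimizes the quadratic \<open>- t c + t\<^sup>2 C\<^sup>2 V / 2\<close>\<close>
  define t where "t = c / (C\<^sup>2 * V)"
  have t: "t > 0" using c C V by (simp add: t_def)
  define G where "G = DIM('a) * L"
  define K5 where "K5 = (G + t * C)\<^sup>2 + (B + t * C) powr p + G\<^sup>2 + B powr p"
  have K5: "K5 \<ge> 0" by (simp add: K5_def)
  define q where "q = (p - 2) / 2 * source \<psi>"
  have q: "q > 0" using src p by (simp add: q_def)
  \<comment> \<open>\<open>K6 r^N\<close> is the size of the correction \<open>\<tau>\<close>\<close>
  define K6 where "K6 = K5 * V / q"
  have K6: "K6 \<ge> 0" using K5 V q by (simp add: K6_def)
  have en: "energy \<psi> \<ge> 0" unfolding energy_def by (intro Bochner_Integration.integral_nonneg) simp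
  define \<tau>0 where "\<tau>0 = (1 - \<mu>) * \<eta>"
  have \<tau>0: "\<tau>0 > 0" using \<mu> \<eta> by (simp add: \<tau>0_def)
  define r3 where "r3 = Min {r2, 1, R, \<tau>0 / (K6 + 1), q / (energy \<psi> * K6 + 1), (t * c / 4) / (energy \<psi> / 2 * K6\<^sup>2 + 1)}"
  have pos: "0 < K6 + 1" "0 < energy \<psi> * K6 + 1" "0 < energy \<psi> / 2 * K6\<^sup>2 + 1"
    using K6 en by (simp_all add: add_nonneg_pos)
  have r3: "r3 > 0" using r2 R \<tau>0 q t c pos unfolding r3_def by (subst Min_gr_iff) auto
  have r3le: "r3 \<le> r2" "r3 \<le> 1" "r3 \<le> R" "r3 \<le> \<tau>0 / (K6 + 1)" "r3 \<le> q / (energy \<psi> * K6 + 1)"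
    "r3 \<le> (t * c / 4) / (energy \<psi> / 2 * K6\<^sup>2 + 1)"
    unfolding r3_def by (intro Min_le; simp)+
  define c' where "c' = (t * c / 4) / (1 + t * L * C)"
  have den: "0 < 1 + t * L * C" using t L C by (simp add: add_pos_pos)
  show thesis
  proof (rule that[of c' r3])
    show "c' > 0" using t c den by (simp add: c'_def)
    show "r3 > 0" by (rule r3)
    fix x0 r assume x0: "x0 \<in> frontier E" and r: "0 < r" "r \<le> r3"
    have sub: "ball x0 r \<subseteq> \<Omega>" using gr[OF x0 r(1)] r(2) r3le(1) by simp
    obtain x1 where x1: "\<And>z. z \<in> ball x1 (\<kappa> * r) \<Longrightarrow> z \<in> E \<and> \<kappa> * r \<le> u z - 1 \<and> \<kappa> * r \<le> norm (z - x0) \<and> norm (z - x0) \<le> (1 - \<kappa>) * r"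
      using gr[OF x0 r(1)] r(2) r3le(1) by (meson order_trans)
    obtain \<phi> where conc: "concentrated \<kappa> L c C x0 r \<phi>" using T[OF r(1)] by blast
    define A where "A = ball x0 r"
    have AQ: "A \<inter> Q = {}"
    proof (rule equals0I)
      fix x assume x: "x \<in> A \<inter> Q"
      have "dist x0 z \<le> dist x0 x + dist x z" by (rule dist_triangle)
      also have "\<dots> \<le> r + R" using x by (auto simp: A_def Q_def dist_commute)
      also have "\<dots> \<le> 2 * R" using r(2) r3le(3) by simp
      finally have "x0 \<in> E" using R(2) by (auto simp: dist_commute)
      then show False using u_gt1[of x0] frontier_E(2)[OF x0] by simp
    qed
    note \<mu>p = \<mu>(3) and tpos = t
    interpret variation \<Omega> u p L \<psi> Q \<eta> \<mu> \<phi> A t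
    proof
      show "test_function E \<psi>" by (rule t\<psi>)
      show "0 \<le> \<psi> x" "\<psi> x \<le> 1" for x unfolding \<psi>_def by (rule flat_exp_nonneg, rule flat_exp_le_1)
      show "x \<notin> Q \<Longrightarrow> \<psi> x = 0" "x \<notin> Q \<Longrightarrow> grad \<psi> x = 0" for x by (fact \<psi>off, fact g\<psi>)
      show "Q \<subseteq> E" by (rule QE)
      show "Q \<in> sets lebesgue" by (simp add: Q_def)
      show "\<eta> \<le> u x - 1" if "x \<in> Q" for x using xq(2)[OF that] by (simp add: \<eta>_def)
      show "0 < \<eta>" "0 < \<mu>" "\<mu> < 1" by (fact \<eta>, fact \<mu>(1), fact \<mu>(2))
      show "test_function A \<phi>" unfolding A_def by (rule concentratedD(1)[OF conc])
      show "0 \<le> \<phi> x" for x by (rule concentratedD(2)[OF conc])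
      show "A \<subseteq> \<Omega>" "A \<inter> Q = {}" "A \<in> sets lebesgue" "bounded A" "0 \<le> t"
        using sub AQ t by (simp_all add: A_def)
    qed
    define N where "N = DIM('a)"
    define m where "m = measure lebesgue (ball x0 r - E)"
    have mA: "measure lebesgue A = V * r ^ N" unfolding A_def N_def V_def using r(1) by (intro measure_ball) simp
    have r1: "r \<le> 1" using r(2) r3le(2) by simp
    have rN: "0 < r ^ N" "r ^ N \<le> r"
    proof -
      show "0 < r ^ N" using r(1) by simp
      have "r ^ N \<le> r ^ 1" using r(1) r1 dim by (intro power_decreasing) (auto simp: N_def)
      then show "r ^ N \<le> r" by simp
    qed
    define s where "s = K6 * r ^ N"
    have s0: "0 \<le> s" using K6 rN by (simp add: s_def)
    have sr: "s \<le> K6 * r" unfolding s_def using K6 rN by (intro mult_left_mono) auto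
    have s1: "s \<le> (1 - \<mu>) * \<eta>"
    proof -
      have "r * (K6 + 1) \<le> \<tau>0" using r(2) r3le(4) pos(1) by (simp add: pos_le_divide_eq[symmetric])
      then have "K6 * r \<le> \<tau>0" using r(1) by (simp add: algebra_simps)
      then show ?thesis using sr unfolding \<tau>0_def by linarith
    qed
    have s2: "energy \<psi> * s \<le> (p - 2) / 2 * source \<psi>"
    proof -
      have "r * (energy \<psi> * K6 + 1) \<le> q" using r(2) r3le(5) pos(2) by (simp add: pos_le_divide_eq[symmetric])
      then have "energy \<psi> * (K6 * r) \<le> q" using r(1) by (simp add: algebra_simps)
      then show ?thesis using mult_left_mono[OF sr en] unfolding q_def by linarith
    qed
    have C1: "\<phi> x \<le> C" "norm (grad \<phi> x) \<le> C" for x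
    proof -
      have "C * r \<le> C" using C r1 by simp
      then show "\<phi> x \<le> C" using concentratedD(3)[OF conc, of x] by linarith
      show "norm (grad \<phi> x) \<le> C" by (rule concentratedD(4)[OF conc])
    qed
    have P: "\<bar>integral\<^sup>L M (gap 0)\<bar> \<le> (p - 2) / 2 * source \<psi> * s"
    proof -
      have "\<bar>integral\<^sup>L M (gap 0)\<bar> \<le> K5 * measure lebesgue A"
        unfolding K5_def by (rule gap_zero_bound[OF _ B C1]) (use g_bounded in \<open>simp_all add: G_def\<close>)
      also have "\<dots> = q * s" unfolding mA s_def K6_def using q by simp
      finally show ?thesis by (simp add: q_def)
    qed
    obtain \<tau> where \<tau>: "\<bar>\<tau>\<bar> \<le> s" "integral\<^sup>L M (gap \<tau>) = 0"
      by (rule constraint_solvable[OF src \<mu>p s0 s1 s2 P])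
    have ineq: "0 \<le> t * integral\<^sup>L M (\<lambda>x. g x \<bullet> grad \<phi> x) + t\<^sup>2 / 2 * energy \<phi>
        + integral\<^sup>L M (indicat_real (A - E)) + \<tau>\<^sup>2 / 2 * energy \<psi>"
      by (rule competitor_inequality[OF order_trans[OF \<tau>(1) s1] \<tau>(2)])
    have mm: "integral\<^sup>L M (indicat_real (A - E)) = m"
    proof -
      have "A - E \<subseteq> \<Omega>" using sub by (auto simp: A_def)
      moreover have "A - E \<in> sets lebesgue" using E_measurable(1) by (intro sets.Diff) (simp_all add: A_def)
      ultimately show ?thesis using integral_over_subset[of "A - E" "\<lambda>_. 1"]
        by (simp add: set_lebesgue_integral_def m_def A_def)
    qed
    have X: "integral\<^sup>L M (\<lambda>x. g x \<bullet> grad \<phi> x) \<le> - (c * r ^ N) + L * C * m"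
      unfolding N_def m_def by (rule first_variation_at_frontier[OF conc r(1) less_imp_le[OF C] x0 sub x1])
    have Y: "energy \<phi> \<le> C\<^sup>2 * (V * r ^ N)"
    proof -
      have "energy \<phi> \<le> integral\<^sup>L M (\<lambda>x. C\<^sup>2 * indicat_real A x)"
        unfolding energy_def
      proof (rule integral_mono[OF integrable_pieces(3)])
        have "integrable lebesgue (indicat_real A)"
          unfolding A_def by (simp add: integrable_indicator_iff emeasure_lborel_ball_finite[unfolded infinity_ennreal_def])
        then show "integrable M (\<lambda>x. C\<^sup>2 * indicat_real A x)"
          by (intro integrable_mult_right integrable_on_subset_measure[OF sets_Omega])
        show "(norm (grad \<phi> x))\<^sup>2 \<le> C\<^sup>2 * indicat_real A x" for x
          using off_A(2)[of x] power_mono[OF C1(2)[of x], of 2] by (cases "x \<in> A") auto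
      qed
      also have "\<dots> = C\<^sup>2 * measure lebesgue A"
        using integral_over_subset[of A "\<lambda>_. 1"] sub by (simp add: set_lebesgue_integral_def A_def)
      finally show ?thesis by (simp add: mA)
    qed
    have Y': "t\<^sup>2 / 2 * energy \<phi> \<le> (t * c / 2) * r ^ N"
    proof -
      have "t\<^sup>2 / 2 * energy \<phi> \<le> t\<^sup>2 / 2 * (C\<^sup>2 * (V * r ^ N))" using Y by (intro mult_left_mono) auto
      also have "\<dots> = t * (t * (C\<^sup>2 * V)) / 2 * r ^ N" by (simp add: power2_eq_square)
      also have "t * (C\<^sup>2 * V) = c" using C V by (simp add: t_def)
      finally show ?thesis by simp
    qed
    have Z: "\<tau>\<^sup>2 / 2 * energy \<psi> \<le> (t * c / 4) * r ^ N"
    proof -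
      have "\<tau>\<^sup>2 \<le> s\<^sup>2" using \<tau>(1) s0 by (simp add: abs_le_square_iff[symmetric])
      also have "s\<^sup>2 = K6\<^sup>2 * r ^ N * r ^ N" by (simp add: s_def power2_eq_square)
      also have "\<dots> \<le> K6\<^sup>2 * r ^ N * r" using rN by (intro mult_left_mono) auto
      finally have "\<tau>\<^sup>2 / 2 * energy \<psi> \<le> (K6\<^sup>2 * r ^ N * r) / 2 * energy \<psi>"
        using en by (intro mult_right_mono divide_right_mono) auto
      also have "\<dots> = (energy \<psi> / 2 * K6\<^sup>2 * r) * r ^ N" by simp
      also have "\<dots> \<le> (t * c / 4) * r ^ N"
      proof (rule mult_right_mono)
        have "r * (energy \<psi> / 2 * K6\<^sup>2 + 1) \<le> t * c / 4" using order_trans[OF r(2) r3le(6)] pos(3) by (simp only: pos_le_divide_eq)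
        then show "energy \<psi> / 2 * K6\<^sup>2 * r \<le> t * c / 4" using r(1) by (simp add: algebra_simps)
      qed (use rN in simp)
      finally show ?thesis .
    qed
    have "t * integral\<^sup>L M (\<lambda>x. g x \<bullet> grad \<phi> x) \<le> t * (- (c * r ^ N) + L * C * m)"
      by (rule mult_left_mono[OF X less_imp_le[OF tpos]])
    also have "\<dots> = - ((t * c) * r ^ N) + t * L * C * m" by (simp add: algebra_simps)
    finally have "(t * c) * r ^ N \<le> t * L * C * m + (t * c / 2) * r ^ N + m + (t * c / 4) * r ^ N"
      using ineq Y' Z unfolding mm by linarith
    then have "(t * c / 4) * r ^ N \<le> m * (1 + t * L * C)" by (simp add: algebra_simps)
    then have "((t * c / 4) * r ^ N) / (1 + t * L * C) \<le> m" using den by (simp only: pos_divide_le_eq)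
    then show "c' * r ^ DIM('a) \<le> measure lebesgue (ball x0 r - E)"
      by (simp add: c'_def m_def N_def)
  qed
qed

end

text \<open>Radii beyond \<open>r3\<close> are treated by passing to the ball of radius \<open>k r \<le> r3\<close> inside, at the price of the factor
\<open>k ^ DIM('a)\<close>.\<close>

lemma density_bounds_extend:
  fixes E :: "'a::euclidean_space set"
  assumes E: "E \<in> sets lebesgue" and c: "c > 0" and r3: "r3 > 0" and \<delta>: "\<delta> > 0"
    and lower: "\<And>x0 r. x0 \<in> S \<Longrightarrow> 0 < r \<Longrightarrow> r \<le> r3 \<Longrightarrow> c * r ^ DIM('a) \<le> measure lebesgue (E \<inter> ball x0 r)"
    and upper: "\<And>x0 r. x0 \<in> S \<Longrightarrow> 0 < r \<Longrightarrow> r \<le> r3 \<Longrightarrow> c * r ^ DIM('a) \<le> measure lebesgue (ball x0 r - E)"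
  shows "\<exists>c'>0. \<forall>x0 r. x0 \<in> S \<and> 0 < r \<and> r \<le> \<delta> \<longrightarrow>
      c' \<le> measure lebesgue (E \<inter> ball x0 r) / measure lebesgue (ball x0 r) \<and>
      measure lebesgue (E \<inter> ball x0 r) / measure lebesgue (ball x0 r) \<le> 1 - c'"
proof -
  define V where "V = unit_ball_vol DIM('a)"
  have V: "V > 0" by (simp add: V_def)
  define k where "k = min 1 (r3 / \<delta>)"
  have k: "0 < k" "k \<le> 1" "k * \<delta> \<le> r3"
  proof -
    show "0 < k" using r3 \<delta> by (simp add: k_def)
    show "k \<le> 1" unfolding k_def by (rule min.cobounded1)
    have "k \<le> r3 / \<delta>" unfolding k_def by (rule min.cobounded2)
    then show "k * \<delta> \<le> r3" using \<delta> by (simp only: pos_le_divide_eq)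
  qed
  define c' where "c' = c * k ^ DIM('a) / V"
  have "c' \<le> measure lebesgue (E \<inter> ball x0 r) / measure lebesgue (ball x0 r) \<and>
      measure lebesgue (E \<inter> ball x0 r) / measure lebesgue (ball x0 r) \<le> 1 - c'"
    if x0: "x0 \<in> S" and r: "0 < r" "r \<le> \<delta>" for x0 r
  proof -
    have mb: "measure lebesgue (ball x0 r) = V * r ^ DIM('a)" unfolding V_def using r by (intro measure_ball) simp
    have pos: "0 < V * r ^ DIM('a)" using V r by simp
    have kr: "0 < k * r" "k * r \<le> r3" "k * r \<le> r"
    proof -
      show "0 < k * r" using k r by simp
      show "k * r \<le> r3" using k(3) mult_left_mono[OF r(2) less_imp_le[OF k(1)]] by linarith
      show "k * r \<le> r" using k(2) r by simp
    qed
    have sub: "ball x0 (k * r) \<subseteq> ball x0 r" using kr(3) by (rule subset_ball)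
    have lm: "ball x0 r \<in> lmeasurable" by simp
    have l1: "E \<inter> ball x0 r \<in> lmeasurable" using fmeasurable_Int_fmeasurable[OF lm E] by (simp add: Int_commute)
    have l2: "ball x0 r - E \<in> lmeasurable" using lm E by (rule fmeasurable_Diff)
    have s1: "E \<inter> ball x0 (k * r) \<in> sets lebesgue" "ball x0 (k * r) - E \<in> sets lebesgue"
      using E by (auto intro!: sets.Int sets.Diff)
    have ck: "c * (k * r) ^ DIM('a) = c' * (V * r ^ DIM('a))" using V by (simp add: c'_def power_mult_distrib)
    have a: "c' * (V * r ^ DIM('a)) \<le> measure lebesgue (E \<inter> ball x0 r)"
    proof -
      have "measure lebesgue (E \<inter> ball x0 (k * r)) \<le> measure lebesgue (E \<inter> ball x0 r)"
        by (rule measure_mono_fmeasurable[OF _ s1(1) l1]) (use sub in blast)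
      then show ?thesis using lower[OF x0 kr(1,2)] unfolding ck by linarith
    qed
    have b: "c' * (V * r ^ DIM('a)) \<le> measure lebesgue (ball x0 r - E)"
    proof -
      have "measure lebesgue (ball x0 (k * r) - E) \<le> measure lebesgue (ball x0 r - E)"
        by (rule measure_mono_fmeasurable[OF _ s1(2) l2]) (use sub in blast)
      then show ?thesis using upper[OF x0 kr(1,2)] unfolding ck by linarith
    qed
    have "measure lebesgue (ball x0 r - E) = measure lebesgue (ball x0 r - (E \<inter> ball x0 r))"
      by (rule arg_cong[where f="measure lebesgue"]) blast
    also have "\<dots> = measure lebesgue (ball x0 r) - measure lebesgue (E \<inter> ball x0 r)"
      by (rule measurable_measure_Diff[OF lm]) (use l1 in auto)
    finally have "measure lebesgue (E \<inter> ball x0 r) \<le> (1 - c') * (V * r ^ DIM('a))"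
      using b unfolding mb by (simp add: left_diff_distrib)
    then show ?thesis using a pos unfolding mb by (simp add: pos_le_divide_eq pos_divide_le_eq)
  qed
  moreover have "c' > 0" using c k V by (simp add: c'_def)
  ultimately show ?thesis by blast
qed

lemma frontier_eq_measure_boundary:
  fixes E :: "'a::euclidean_space set"
  assumes E: "E \<in> sets lebesgue" and c: "c > 0" and r3: "r3 > 0"
    and lower: "\<And>x0 r. x0 \<in> frontier E \<Longrightarrow> 0 < r \<Longrightarrow> r \<le> r3 \<Longrightarrow> c * r ^ DIM('a) \<le> measure lebesgue (E \<inter> ball x0 r)"
    and upper: "\<And>x0 r. x0 \<in> frontier E \<Longrightarrow> 0 < r \<Longrightarrow> r \<le> r3 \<Longrightarrow> c * r ^ DIM('a) \<le> measure lebesgue (ball x0 r - E)"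
  shows "frontier E = measure_boundary E"
proof (intro subset_antisym subsetI)
  fix x assume x: "x \<in> frontier E"
  show "x \<in> measure_boundary E"
    unfolding measure_boundary_def
  proof (intro CollectI allI impI)
    fix r :: real assume r: "r > 0"
    define s where "s = min r r3"
    have s: "0 < s" "s \<le> r3" "s \<le> r" using r r3 by (auto simp: s_def)
    have cs: "0 < c * s ^ DIM('a)" using c s by simp
    have sub: "ball x s \<subseteq> ball x r" using s(3) by (rule subset_ball)
    have lm: "ball x r \<in> lmeasurable" by simp
    have l1: "E \<inter> ball x r \<in> lmeasurable" using fmeasurable_Int_fmeasurable[OF lm E] by (simp add: Int_commute)
    have l2: "- E \<inter> ball x r \<in> lmeasurable"
      using fmeasurable_Diff[OF lm E] by (simp add: Diff_eq Int_commute)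
    have "measure lebesgue (E \<inter> ball x s) \<le> measure lebesgue (E \<inter> ball x r)"
      by (rule measure_mono_fmeasurable[OF _ _ l1]) (use sub E in auto)
    moreover have "measure lebesgue (ball x s - E) \<le> measure lebesgue (- E \<inter> ball x r)"
      by (rule measure_mono_fmeasurable[OF _ _ l2]) (use sub E in auto)
    ultimately show "0 < measure lebesgue (E \<inter> ball x r) \<and> 0 < measure lebesgue (- E \<inter> ball x r)"
      using lower[OF x s(1,2)] upper[OF x s(1,2)] cs by linarith
  qed
next
  fix x assume x: "x \<in> measure_boundary E"
  show "x \<in> frontier E"
  proof (rule ccontr)
    assume "x \<notin> frontier E"
    then have "x \<in> interior E \<or> x \<in> interior (- E)"
      by (auto simp: frontier_def interior_complement)
    then obtain r where r: "r > 0" "ball x r \<subseteq> E \<or> ball x r \<subseteq> - E"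
      by (auto simp: mem_interior)
    then have "- E \<inter> ball x r = {} \<or> E \<inter> ball x r = {}" by blast
    moreover have "measure lebesgue (E \<inter> ball x r) > 0" "measure lebesgue (- E \<inter> ball x r) > 0"
      using x r(1) by (auto simp: measure_boundary_def)
    ultimately show False by auto
  qed
qed

theorem proposition1p7:
  fixes \<Omega> :: "'a::euclidean_space set" and u :: "'a \<Rightarrow> real" and p \<delta>0 :: real
  assumes dim: "DIM('a) \<ge> 2"
    and dom: "smooth_bounded_domain \<Omega>"
    and p: "p > 2" "DIM('a) \<ge> 3 \<Longrightarrow> p < 2 * real DIM('a) / (real DIM('a) - 2)"
    and H10: "u \<in> H10 \<Omega>"
    and lip: "\<exists>L. L-lipschitz_on (closure \<Omega>) u"
    and nondeg: "nondegenerate \<Omega> u"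
    and eq: "solves_off_free_boundary \<Omega> p u"
    and min: "minimizes_J_on_M \<Omega> p u"
    and \<delta>0: "\<delta>0 = setdist (above1 \<Omega> u) (frontier \<Omega>)"
  shows "\<delta>0 > 0 \<and>
    (\<exists>c>0. \<forall>x0 r. x0 \<in> frontier (above1 \<Omega> u) \<and> 0 < r \<and> r \<le> \<delta>0 / 2 \<longrightarrow>
       c \<le> measure lebesgue (above1 \<Omega> u \<inter> ball x0 r) / measure lebesgue (ball x0 r) \<and>
       measure lebesgue (above1 \<Omega> u \<inter> ball x0 r) / measure lebesgue (ball x0 r) \<le> 1 - c) \<and>
    frontier (above1 \<Omega> u) = measure_boundary (above1 \<Omega> u)"
proof -
  obtain L0 where L0: "L0-lipschitz_on (closure \<Omega>) u" using lip by blast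
  \<comment> \<open>a Lipschitz constant may be zero; the estimates divide by it\<close>
  define L where "L = L0 + 1"
  have L0n: "L0 \<ge> 0" by (rule lipschitz_on_nonneg[OF L0])
  interpret minimizer \<Omega> u p L
  proof
    show "2 \<le> DIM('a)" by (rule dim)
    show "open \<Omega>" "bounded \<Omega>" using dom by (auto simp: smooth_bounded_domain_def)
    show "2 < p" by (rule p(1))
    show "0 < L" using L0n by (simp add: L_def)
    show "\<bar>u x - u y\<bar> \<le> L * norm (x - y)" if "x \<in> closure \<Omega>" "y \<in> closure \<Omega>" for x y
    proof -
      have "\<bar>u x - u y\<bar> \<le> L0 * norm (x - y)" using lipschitz_onD[OF L0 that] by (simp add: dist_norm)
      also have "\<dots> \<le> L * norm (x - y)" by (intro mult_right_mono) (simp_all add: L_def)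
      finally show ?thesis .
    qed
    show "u x = 0" if "x \<in> frontier \<Omega>" for x by (rule H10_lipschitz_zero_on_boundary[OF dom H10 L0 that])
    show "solves_off_free_boundary \<Omega> p u" by (rule eq)
    show "u \<in> H10 \<Omega>" by (rule H10)
    show "minimizes_J_on_M \<Omega> p u" by (rule min)
  qed
  have Ene: "E \<noteq> {}"
  proof
    assume "E = {}"
    moreover have "u \<in> M_set \<Omega> p" using min by (simp add: minimizes_J_on_M_def)
    ultimately show False by (simp add: M_set_def E_def[symmetric] set_lebesgue_integral_def)
  qed
  obtain r0 c0 where r0: "r0 > 0" and c0: "c0 > 0"
    and nd0: "\<forall>x0\<in>closure \<Omega>. u x0 > 1 \<longrightarrow>
      (let r = infdist x0 {x \<in> closure \<Omega>. u x \<le> 1} in r \<le> r0 \<longrightarrow> u x0 \<ge> 1 + c0 * r)"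
    using nondeg unfolding nondegenerate_def by blast
  have nd: "1 + c0 * infdist x F \<le> u x" if "x \<in> E" "infdist x F \<le> r0" for x
    using nd0 that E_iff[of x] unfolding F_def[symmetric] Let_def by blast
  obtain cz rz where z: "cz > 0" "rz > 0"
    "\<And>x0 r. x0 \<in> frontier E \<Longrightarrow> 0 < r \<Longrightarrow> r \<le> rz \<Longrightarrow> cz * r ^ DIM('a) \<le> measure lebesgue (ball x0 r - E)"
    using zero_set_density[OF c0 r0 Ene nd] by metis
  obtain cp rp where P: "cp > 0" "rp > 0"
    "\<And>x0 r. x0 \<in> frontier E \<Longrightarrow> 0 < r \<Longrightarrow> r \<le> rp \<Longrightarrow> cp * r ^ DIM('a) \<le> measure lebesgue (E \<inter> ball x0 r)"
    using positive_set_density[OF c0 r0 Ene nd] by metis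
  define c where "c = min cz cp"
  define r3 where "r3 = min rz rp"
  have c: "c > 0" "c \<le> cz" "c \<le> cp" using z P by (simp_all add: c_def)
  have r3: "r3 > 0" "r3 \<le> rz" "r3 \<le> rp" using z P by (simp_all add: r3_def)
  have mono: "c * r ^ DIM('a) \<le> C * r ^ DIM('a)" if "c \<le> C" "0 < r" for C r :: real
    using that by (intro mult_right_mono) auto
  have upper: "c * r ^ DIM('a) \<le> measure lebesgue (ball x0 r - E)" if "x0 \<in> frontier E" "0 < r" "r \<le> r3" for x0 r
    by (rule order_trans[OF mono[OF c(2) that(2)] z(3)[OF that(1,2) order_trans[OF that(3) r3(2)]]])
  have lower: "c * r ^ DIM('a) \<le> measure lebesgue (E \<inter> ball x0 r)" if "x0 \<in> frontier E" "0 < r" "r \<le> r3" for x0 r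
    by (rule order_trans[OF mono[OF c(3) that(2)] P(3)[OF that(1,2) order_trans[OF that(3) r3(3)]]])
  have \<delta>pos: "\<delta>0 > 0" using setdist_pos[OF Ene] unfolding \<delta>0 E_def .
  then have "\<delta>0 / 2 > 0" by simp
  from density_bounds_extend[OF E_measurable(1) c(1) r3(1) this lower upper]
    frontier_eq_measure_boundary[OF E_measurable(1) c(1) r3(1) lower upper] \<delta>pos
  show ?thesis unfolding E_def by blast
qed

end
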